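(* Let $r_n$ and $c_n$ denote the numbers of relaxed binary trees and of compacted binary trees of size $n$, respectively. Then, as $n\to\infty$, \[ c_n=\Theta\!\left(n!\,4^n e^{3a_1 n^{1/3}} n^{3/4}\right)\qquad\text{and}\qquad r_n=\Theta\!\left(n!\,4^n e^{3a_1 n^{1/3}} n\right), \] where $a_1\approx-2.338$ is the largest root of the Airy function $\mathrm{Ai}$.
   Context: A (rooted, plane) binary tree is either a leaf or an internal node with an ordered pair (left, right) of binary subtrees; its size is its number of internal nodes. Postorder traverses the left subtree, then the right subtree, then the root. A relaxed binary tree of size $n$ is obtained from a binary tree $T$ with $n$ internal nodes (called its spine) by keeping the left-most leaf of $T$ and turning every other leaf $\ell$ into a pointer to a vertex of $T$ which is either an internal node or the left-most leaf and which precedes $\ell$ in postorder. It is regarded as a directed acyclic graph whose vertices are the internal nodes of $T$ and the left-most leaf; each internal node has a left and a right out-edge, going to the corresponding child in $T$ if that child is an internal node or the left-most leaf, and otherwise to the target of the pointer replacing that child. Two relaxed trees are equal iff they have the same spine and the same pointer targets. For each vertex $u$ of a relaxed tree define a binary tree $B(u)$ recursively in postorder: if $u$ is the left-most leaf, $B(u)$ is a single leaf; otherwise, if the left and right out-neighbours of $u$ are $v,w$, $B(u)$ is the binary tree with left subtree $B(v)$ and right subtree $B(w)$. A compacted binary tree of size $n$ is a relaxed binary tree of size $n$ such that $B(u)$ and $B(v)$ are non-isomorphic for all distinct vertices $u\neq v$. The Airy function $\mathrm{Ai}$ is the unique solution of $\mathrm{Ai}''(x)=x\,\mathrm{Ai}(x)$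 with $\mathrm{Ai}(x)\to0$ as $x\to+\infty$ (with the standard normalization); all its zeros are real and negative, and $a_1$ is the largest one. *)

theory Defs
  imports "HOL-Analysis.Analysis" "HOL-Library.FuncSet" "HOL-Library.Landau_Symbols"
begin

datatype bt = Lf | Nd bt bt

fun bt_size :: "bt \<Rightarrow> nat" where
  "bt_size Lf = 0"
| "bt_size (Nd l r) = Suc (bt_size l + bt_size r)"

text \<open>Positions of nodes are paths from the root (False = left, True = right).
  Postorder list of all positions (leaves and internal nodes).\<close>
fun post :: "bt \<Rightarrow> bool list list" where
  "post Lf = [[]]"
| "post (Nd l r) = map (Cons False) (post l) @ map (Cons True) (post r) @ [[]]"

fun internal_pos :: "bt \<Rightarrow> bool list set" where
  "internal_pos Lf = {}"
| "internal_pos (Nd l r) = insert [] (Cons False ` internal_pos l \<union> Cons True ` internal_pos r)"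

fun leaf_pos :: "bt \<Rightarrow> bool list set" where
  "leaf_pos Lf = {[]}"
| "leaf_pos (Nd l r) = Cons False ` leaf_pos l \<union> Cons True ` leaf_pos r"

fun lml :: "bt \<Rightarrow> bool list" where
  "lml Lf = []"
| "lml (Nd l r) = False # lml l"

definition verts :: "bt \<Rightarrow> bool list set" where
  "verts T = insert (lml T) (internal_pos T)"

definition precedes :: "bt \<Rightarrow> bool list \<Rightarrow> bool list \<Rightarrow> bool" where
  "precedes T p q \<longleftrightarrow> (\<exists>i j. i < j \<and> j < length (post T) \<and> post T ! i = p \<and> post T ! j = q)"

definition ptr_leaves :: "bt \<Rightarrow> bool list set" where
  "ptr_leaves T = leaf_pos T - {lml T}"

text \<open>Relaxed binary trees of size n: a spine T together with a pointer assignment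
  (extensional function on the non-left-most leaves) mapping every such leaf to a vertex
  preceding it in postorder.\<close>
definition relaxed :: "nat \<Rightarrow> (bt \<times> (bool list \<Rightarrow> bool list)) set" where
  "relaxed n = {(T, ptr). bt_size T = n \<and>
      ptr \<in> (PiE (ptr_leaves T) (\<lambda>l. {v \<in> verts T. precedes T v l}))}"

definition outn :: "bt \<Rightarrow> (bool list \<Rightarrow> bool list) \<Rightarrow> bool list \<Rightarrow> bool \<Rightarrow> bool list" where
  "outn T ptr p b = (if p @ [b] \<in> verts T then p @ [b] else ptr (p @ [b]))"

text \<open>B(u), computed with fuel; since every edge goes to a vertex strictly earlier in
  postorder, fuel equal to the number of positions suffices.\<close>
fun Bf :: "bt \<Rightarrow> (bool list \<Rightarrow> bool list) \<Rightarrow> nat \<Rightarrow> bool list \<Rightarrow> bt" where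
  "Bf T ptr 0 u = Lf"
| "Bf T ptr (Suc k) u = (if u = lml T then Lf
      else Nd (Bf T ptr k (outn T ptr u False)) (Bf T ptr k (outn T ptr u True)))"

definition BB :: "bt \<Rightarrow> (bool list \<Rightarrow> bool list) \<Rightarrow> bool list \<Rightarrow> bt" where
  "BB T ptr u = Bf T ptr (length (post T)) u"

definition compacted :: "nat \<Rightarrow> (bt \<times> (bool list \<Rightarrow> bool list)) set" where
  "compacted n = {(T, ptr) \<in> relaxed n. inj_on (BB T ptr) (verts T)}"

definition r_num :: "nat \<Rightarrow> nat" where "r_num n = card (relaxed n)"
definition c_num :: "nat \<Rightarrow> nat" where "c_num n = card (compacted n)"

definition Airy_Ai :: "real \<Rightarrow> real" where
  "Airy_Ai = (THE f. (\<exists>f'. \<forall>x. (f has_real_derivative f' x) (at x) \<and>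
                              (f' has_real_derivative x * f x) (at x))
                   \<and> (f \<longlongrightarrow> 0) at_top
                   \<and> f 0 = 1 / (3 powr (2/3) * Gamma (2/3)))"

definition airy_a1 :: real where
  "airy_a1 = (GREATEST x. Airy_Ai x = 0)"

end

theory Submission
  imports Defs "HOL-Real_Asymp.Real_Asymp"
begin

text \<open>
  Reading the spine in postorder, a relaxed tree is a sequence of leaves and internal nodes in which a leaf preceded by
  \<open>k\<close> internal nodes has \<open>k + 1\<close> possible targets. If two vertices of a relaxed tree have equal trees, then a minimal
  such pair has equal out-neighbours, and the later vertex must be a cherry; so a compacted tree excludes \<open>k\<close>
  of the \<open>(k + 1)\<^sup>2\<close> pairs of targets at every cherry. Both numbers are therefore weighted counts of binary trees, and
  dissolving the last root of a forest yields a recurrence for weighted forests, a random walk in time \<open>N\<close> and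
  height \<open>y\<close> in which height is penalised at rate \<open>1 / N\<close>.

  At scale \<open>y = x / h\<close> with \<open>h = (2 / N)\<^bsup>1/3\<^esup>\<close> the recurrence is a perturbation of the Airy equation: with
  \<open>A x = Ai (a\<^sub>1 + x)\<close>, the function \<open>(1 - hx\<^sup>2/3 + (11/12 - e/8) h\<^sup>2x) A x\<close> is reproduced with growth rate
  \<open>2 + a\<^sub>1h\<^sup>2 + (4/3 - e/4) h\<^sup>3\<close> per step, up to an error of order \<open>h\<^sup>4x\<close> uniformly in \<open>x \<ge> h\<close>. Changing the rate by
  \<open>\<plusminus>\<sigma>h\<^bsup>7/2\<^esup>\<close> and the function by \<open>\<plusminus>h\<^bsup>3/2\<^esup>x\<close> turns it into a super- and a subsolution without any restriction on \<open>x\<close>.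
  As \<open>\<Sum>N\<^bsup>-7/6\<^esup>\<close> converges, the two products of growth rates agree up to a constant factor,
  and the comparison principle gives the theorem.
\<close>

section \<open>The Airy function\<close>

text \<open>The exponent \<open>7/2\<close> is dictated from two sides. The ansatz leaves an error
  of order \<open>h^4 x\<close>, while the growth rate may change only by a summable amount, and
  \<open>h^s = (2/N)^(s/3)\<close> is summable exactly for \<open>s > 3\<close>; an exponent
  strictly between 3 and 4 leaves room on both sides. The term \<open>(4/3 - e/4) h^3\<close> of the
  growth rate becomes the power \<open>N^(4/3 - e/4)\<close> of the product, since
  \<open>h^3 / 2 = 1/N\<close>. A single tree with \<open>n\<close> nodes is read off at time
  \<open>N = 2n\<close> and height 1, where \<open>A h\<close> is of order \<open>h\<close>, hence
  of order \<open>N^(-1/3)\<close>; this leaves \<open>n^(1 - e/4)\<close>. The share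
  \<open>e/4\<close> stems from the excluded pairs: their coefficient is about \<open>h^3\<close>,
  and they refer two steps back, which divides by about \<open>2 * 2\<close>. The obstacle is the
  minus sign of that term: the recurrence for forests is not monotone and cannot be compared
  directly with a super- or subsolution. Carrying along the forests whose last tree is not a leaf
  gives a pair of recurrences with nonnegative coefficients, because a cherry keeps the positive
  weight \<open>(j + 1)^2 - e j\<close>.\<close>

definition airy_ode :: "(real \<Rightarrow> real) \<Rightarrow> (real \<Rightarrow> real) \<Rightarrow> bool" where
  "airy_ode f f' \<longleftrightarrow> (\<forall>x. (f has_real_derivative f' x) (at x) \<and> (f' has_real_derivative x * f x) (at x))"

lemma airy_odeD:
  assumes "airy_ode f f'"
  shows "(f has_real_derivative f' x) (at x)" "(f' has_real_derivative x * f x) (at x)"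
  using assms by (auto simp: airy_ode_def)

lemma airy_ode_lincomb:
  assumes "airy_ode f f'" "airy_ode g g'"
  shows "airy_ode (\<lambda>x. p * f x + q * g x) (\<lambda>x. p * f' x + q * g' x)"
  unfolding airy_ode_def
  by (auto intro!: derivative_eq_intros airy_odeD[OF assms(1)] airy_odeD[OF assms(2)] simp: algebra_simps)

lemma airy_ode_continuous_on:
  assumes "airy_ode f f'" shows "continuous_on S f" "continuous_on S f'"
  using airy_odeD[OF assms] by (auto intro!: continuous_at_imp_continuous_on DERIV_isCont)

section \<open>Power series solutions of the Airy equation\<close>

fun airy_coeff :: "real \<Rightarrow> real \<Rightarrow> nat \<Rightarrow> real" where
  "airy_coeff p q 0 = p"
| "airy_coeff p q (Suc 0) = q"
| "airy_coeff p q (Suc (Suc 0)) = 0"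
| "airy_coeff p q (Suc (Suc (Suc n))) = airy_coeff p q n / ((real n + 2) * (real n + 3))"

text \<open>From some index on, the recurrence multiplies \<open>|a_n| R^n\<close> by
  \<open>R^3 / ((m + 2) * (m + 3)) <= 1\<close> every three steps, so the maximum over an initial
  segment bounds all terms. As \<open>R\<close> is arbitrary, the series is entire.\<close>

lemma airy_coeff_bound:
  assumes "R > 0"
  shows "\<exists>K. \<forall>n. \<bar>airy_coeff p q n\<bar> * R ^ n \<le> K"
proof -
  obtain n0 :: nat where n0: "real n0 \<ge> R ^ 3" using real_arch_simple by blast
  define K where "K = Max ((\<lambda>n. \<bar>airy_coeff p q n\<bar> * R ^ n) ` {..<n0+3})"
  have "\<bar>airy_coeff p q n\<bar> * R ^ n \<le> K" for n
  proof (induction n rule: less_induct)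
    case (less n)
    show ?case
    proof (cases "n < n0 + 3")
      case True
      then show ?thesis unfolding K_def by (intro Max_ge) auto
    next
      case False
      define m where "m = n - 3"
      have m: "n = Suc (Suc (Suc m))" "m \<ge> n0" using False by (auto simp: m_def)
      have d: "R ^ 3 \<le> (real m + 2) * (real m + 3)"
      proof -
        have "R ^ 3 \<le> real m" using n0 m by linarith
        also have "\<dots> \<le> (real m + 2) * (real m + 3)" by (simp add: algebra_simps)
        finally show ?thesis .
      qed
      have "\<bar>airy_coeff p q n\<bar> * R ^ n = (\<bar>airy_coeff p q m\<bar> * R ^ m) * (R ^ 3 / ((real m + 2) * (real m + 3)))"
        by (simp add: m power3_eq_cube abs_mult)
      also have "\<dots> \<le> (\<bar>airy_coeff p q m\<bar> * R ^ m) * 1"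
        using d assms by (intro mult_left_mono) auto
      also have "\<dots> \<le> K" using less[of m] m by simp
      finally show ?thesis .
    qed
  qed
  then show ?thesis by blast
qed

lemma airy_coeff_summable: "summable (\<lambda>n. airy_coeff p q n * x ^ n)"
proof -
  define R where "R = \<bar>x\<bar> + 1"
  have R: "R > 0" "\<bar>x\<bar> / R < 1" by (auto simp: R_def)
  obtain K where K: "\<And>n. \<bar>airy_coeff p q n\<bar> * R ^ n \<le> K" using airy_coeff_bound[OF R(1)] by blast
  have "summable (\<lambda>n. K * (\<bar>x\<bar> / R) ^ n)" using R by (intro summable_mult summable_geometric) auto
  moreover have "norm (airy_coeff p q n * x ^ n) \<le> K * (\<bar>x\<bar> / R) ^ n" for n
  proof -
    have "norm (airy_coeff p q n * x ^ n) = (\<bar>airy_coeff p q n\<bar> * R ^ n) * (\<bar>x\<bar> / R) ^ n"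
      using R by (simp add: abs_mult power_abs power_divide)
    also have "\<dots> \<le> K * (\<bar>x\<bar> / R) ^ n" using K[of n] R by (intro mult_right_mono) auto
    finally show ?thesis .
  qed
  ultimately show ?thesis by (rule summable_comparison_test'[where N=0])
qed

definition airy_sol :: "real \<Rightarrow> real \<Rightarrow> real \<Rightarrow> real" where
  "airy_sol p q x = (\<Sum>n. airy_coeff p q n * x ^ n)"

definition airy_sol' :: "real \<Rightarrow> real \<Rightarrow> real \<Rightarrow> real" where
  "airy_sol' p q x = (\<Sum>n. diffs (airy_coeff p q) n * x ^ n)"

lemma airy_diffs_summable: "summable (\<lambda>n. diffs (airy_coeff p q) n * x ^ n)"
  by (rule termdiff_converges_all) (rule airy_coeff_summable)

lemma airy_sol_ode: "airy_ode (airy_sol p q) (airy_sol' p q)"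
proof -
  have 1: "(airy_sol p q has_real_derivative airy_sol' p q x) (at x)" for x
    unfolding airy_sol_def[abs_def] airy_sol'_def
    by (rule termdiffs_strong_converges_everywhere) (rule airy_coeff_summable)
  have 2: "(airy_sol' p q has_real_derivative (\<Sum>n. diffs (diffs (airy_coeff p q)) n * x ^ n)) (at x)" for x
    unfolding airy_sol'_def[abs_def]
    by (rule termdiffs_strong_converges_everywhere) (rule airy_diffs_summable)
  \<comment> \<open>The series of the second derivative starts with the vanishing coefficient of
    \<open>x^2\<close>; what remains is \<open>x\<close> times the original series.\<close>
  have 3: "(\<Sum>n. diffs (diffs (airy_coeff p q)) n * x ^ n) = x * airy_sol p q x" for x
  proof -
    have s: "summable (\<lambda>n. diffs (diffs (airy_coeff p q)) n * x ^ n)"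
      by (rule termdiff_converges_all) (rule airy_diffs_summable)
    have "(\<Sum>n. diffs (diffs (airy_coeff p q)) n * x ^ n)
        = (\<Sum>n. diffs (diffs (airy_coeff p q)) (Suc n) * x ^ (Suc n)) + diffs (diffs (airy_coeff p q)) 0 * x ^ 0"
      by (rule suminf_split_head[OF s, THEN eq_diff_eq[THEN iffD1], symmetric])
    also have "diffs (diffs (airy_coeff p q)) 0 = 0" by (simp add: diffs_def)
    also have "(\<Sum>n. diffs (diffs (airy_coeff p q)) (Suc n) * x ^ (Suc n)) = (\<Sum>n. x * (airy_coeff p q n * x ^ n))"
    proof (rule suminf_cong)
      fix n
      have "diffs (diffs (airy_coeff p q)) (Suc n) = airy_coeff p q n"
        by (simp add: diffs_def divide_simps) (simp add: algebra_simps)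
      then show "diffs (diffs (airy_coeff p q)) (Suc n) * x ^ (Suc n) = x * (airy_coeff p q n * x ^ n)" by simp
    qed
    also have "\<dots> = x * airy_sol p q x"
      unfolding airy_sol_def by (rule suminf_mult) (rule airy_coeff_summable)
    finally show ?thesis by simp
  qed
  show ?thesis unfolding airy_ode_def using 1 2 3 by simp
qed

lemma airy_coeff_nonneg: "p \<ge> 0 \<Longrightarrow> q \<ge> 0 \<Longrightarrow> airy_coeff p q n \<ge> 0"
  by (induction p q n rule: airy_coeff.induct) auto

lemma airy_sol_0: "airy_sol p q 0 = p" "airy_sol' p q 0 = q"
  unfolding airy_sol_def airy_sol'_def by (simp_all add: diffs_def powser_zero)

lemma airy_sol_lower:
  assumes "p \<ge> 0" "q \<ge> 0" "x \<ge> 0"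
  shows "airy_sol p q x \<ge> p + q * x"
proof -
  have "(\<Sum>n<2. airy_coeff p q n * x ^ n) \<le> airy_sol p q x"
    unfolding airy_sol_def using assms
    by (intro sum_le_suminf airy_coeff_summable) (auto intro!: mult_nonneg_nonneg airy_coeff_nonneg)
  then show ?thesis by (simp add: numeral_2_eq_2)
qed

section \<open>Uniqueness and monotonicity of solutions\<close>

lemma airy_zero_right:
  assumes "airy_ode g g'" "g a = 0" "g' a = 0" "a \<le> x"
  shows "g x = 0"
proof -
  define K where "K = 1 + \<bar>a\<bar> + \<bar>x\<bar>"
  \<comment> \<open>Gronwall's argument: \<open>K\<close> bounds \<open>|1 + t|\<close> on the
    interval, so the damped energy cannot increase from its value 0 at \<open>a\<close>.\<close>
  define E where "E = (\<lambda>t. (g t ^ 2 + g' t ^ 2) * exp (- K * t))"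
  have "E x \<le> E a"
  proof (rule DERIV_nonpos_imp_nonincreasing[OF assms(4)])
    fix t assume t: "a \<le> t" "t \<le> x"
    let ?D = "(2 * g t * g' t + 2 * g' t * (t * g t) - K * (g t ^ 2 + g' t ^ 2)) * exp (- K * t)"
    have "DERIV E t :> ?D"
      unfolding E_def
      by (auto intro!: derivative_eq_intros airy_odeD[OF assms(1)] simp: algebra_simps power2_eq_square)
    moreover have "?D \<le> 0"
    proof -
      have a: "2 * \<bar>g t\<bar> * \<bar>g' t\<bar> \<le> g t ^ 2 + g' t ^ 2"
        using sum_squares_bound[of "\<bar>g t\<bar>" "\<bar>g' t\<bar>"] by simp
      have k: "\<bar>1 + t\<bar> \<le> K" using t unfolding K_def by linarith
      have "2 * g t * g' t + 2 * g' t * (t * g t) = (1 + t) * (2 * g t * g' t)" by (simp add: algebra_simps)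
      also have "\<dots> \<le> \<bar>1 + t\<bar> * (2 * \<bar>g t\<bar> * \<bar>g' t\<bar>)"
        using abs_ge_self[of "(1 + t) * (2 * g t * g' t)"] by (simp add: abs_mult)
      also have "\<dots> \<le> K * (g t ^ 2 + g' t ^ 2)" using a k by (intro mult_mono) auto
      finally show ?thesis by (intro mult_nonpos_nonneg) auto
    qed
    ultimately show "\<exists>y. DERIV E t :> y \<and> y \<le> 0" by blast
  qed
  also have "E a = 0" by (simp add: E_def assms)
  finally have "(g x ^ 2 + g' x ^ 2) * exp (- K * x) \<le> 0" by (simp add: E_def)
  then have "g x ^ 2 + g' x ^ 2 \<le> 0" by (simp add: mult_le_0_iff)
  then show ?thesis by (smt (verit) zero_le_power2 zero_eq_power2)
qed

lemma airy_zero_left: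
  assumes "airy_ode g g'" "g a = 0" "g' a = 0" "x \<le> a"
  shows "g x = 0"
proof -
  define K where "K = 1 + \<bar>a\<bar> + \<bar>x\<bar>"
  define E where "E = (\<lambda>t. (g t ^ 2 + g' t ^ 2) * exp (K * t))"
  have "E x \<le> E a"
  proof (rule DERIV_nonneg_imp_nondecreasing[OF assms(4)])
    fix t assume t: "x \<le> t" "t \<le> a"
    let ?D = "(2 * g t * g' t + 2 * g' t * (t * g t) + K * (g t ^ 2 + g' t ^ 2)) * exp (K * t)"
    have "DERIV E t :> ?D"
      unfolding E_def
      by (auto intro!: derivative_eq_intros airy_odeD[OF assms(1)] simp: algebra_simps power2_eq_square)
    moreover have "?D \<ge> 0"
    proof -
      have a: "2 * \<bar>g t\<bar> * \<bar>g' t\<bar> \<le> g t ^ 2 + g' t ^ 2"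
        using sum_squares_bound[of "\<bar>g t\<bar>" "\<bar>g' t\<bar>"] by simp
      have k: "\<bar>1 + t\<bar> \<le> K" using t unfolding K_def by linarith
      have "2 * g t * g' t + 2 * g' t * (t * g t) = (1 + t) * (2 * g t * g' t)" by (simp add: algebra_simps)
      also have "- \<dots> \<le> \<bar>1 + t\<bar> * (2 * \<bar>g t\<bar> * \<bar>g' t\<bar>)"
        using abs_ge_minus_self[of "(1 + t) * (2 * g t * g' t)"] by (simp add: abs_mult)
      also have "\<dots> \<le> K * (g t ^ 2 + g' t ^ 2)" using a k by (intro mult_mono) auto
      finally have "0 \<le> 2 * g t * g' t + 2 * g' t * (t * g t) + K * (g t ^ 2 + g' t ^ 2)"
        by (simp add: algebra_simps)
      then show ?thesis by (intro mult_nonneg_nonneg) auto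
    qed
    ultimately show "\<exists>y. DERIV E t :> y \<and> y \<ge> 0" by blast
  qed
  also have "E a = 0" by (simp add: E_def assms)
  finally have "(g x ^ 2 + g' x ^ 2) * exp (K * x) \<le> 0" by (simp add: E_def)
  then have "g x ^ 2 + g' x ^ 2 \<le> 0" by (simp add: mult_le_0_iff)
  then show ?thesis by (smt (verit) zero_le_power2 zero_eq_power2)
qed

lemma airy_zero:
  assumes "airy_ode g g'" "g a = 0" "g' a = 0"
  shows "g = (\<lambda>_. 0)"
  using airy_zero_left[OF assms] airy_zero_right[OF assms] by (metis linear)

text \<open>The derivative of \<open>g g'\<close> is \<open>g'^2 + t g^2\<close>, nonnegative on the
  half-line. Hence \<open>g^2\<close> keeps growing once it has started to, which drives both
  uniqueness and decay below.\<close>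

lemma airy_prod_mono:
  assumes "airy_ode g g'" "0 \<le> x" "x \<le> y"
  shows "g x * g' x \<le> g y * g' y"
proof (rule DERIV_nonneg_imp_nondecreasing[OF assms(3), where f = "\<lambda>t. g t * g' t"])
  fix t assume t: "x \<le> t" "t \<le> y"
  have "DERIV (\<lambda>t. g t * g' t) t :> g' t ^ 2 + t * g t ^ 2"
    by (auto intro!: derivative_eq_intros airy_odeD[OF assms(1)] simp: algebra_simps power2_eq_square)
  moreover have "g' t ^ 2 + t * g t ^ 2 \<ge> 0" using t assms by simp
  ultimately show "\<exists>y. DERIV (\<lambda>t. g t * g' t) t :> y \<and> y \<ge> 0" by blast
qed

lemma airy_sq_mono:
  assumes "airy_ode g g'" "0 \<le> a" "g a * g' a \<ge> 0" "a \<le> x"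
  shows "g a ^ 2 \<le> g x ^ 2"
proof (rule DERIV_nonneg_imp_nondecreasing[OF assms(4), where f = "\<lambda>t. g t ^ 2"])
  fix t assume t: "a \<le> t" "t \<le> x"
  have "DERIV (\<lambda>t. g t ^ 2) t :> 2 * (g t * g' t)"
    by (auto intro!: derivative_eq_intros airy_odeD[OF assms(1)] simp: algebra_simps power2_eq_square)
  moreover have "2 * (g t * g' t) \<ge> 0" using airy_prod_mono[OF assms(1,2) t(1)] assms by simp
  ultimately show "\<exists>y. DERIV (\<lambda>t. g t ^ 2) t :> y \<and> y \<ge> 0" by blast
qed

lemma airy_stays_pos:
  assumes g: "airy_ode g g'" and a: "0 \<le> a" "g a > 0" "g' a \<ge> 0" "a \<le> x"
  shows "g x > 0"
proof (rule ccontr)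
  assume "\<not> g x > 0"
  then obtain t where t: "a \<le> t" "t \<le> x" "g t = 0"
    using IVT2'[of g x 0 a] a airy_ode_continuous_on(1)[OF g] by auto
  have "g a ^ 2 \<le> g t ^ 2" by (rule airy_sq_mono[OF g]) (use a t in auto)
  then show False using t a by simp
qed

text \<open>Were \<open>g g'\<close> positive at some point, \<open>g^2\<close> would never again
  fall below its value there.\<close>

lemma airy_decay_prod_nonpos:
  assumes g: "airy_ode g g'" and lim: "(g \<longlongrightarrow> 0) at_top" and x: "x \<ge> 0"
  shows "g x * g' x \<le> 0"
proof (rule ccontr)
  assume "\<not> ?thesis"
  then have p: "g x * g' x > 0" by simp
  then have "g x \<noteq> 0" by auto
  then have "g x ^ 2 > 0" by simp
  have "((\<lambda>t. g t ^ 2) \<longlongrightarrow> 0 ^ 2) at_top" by (intro tendsto_intros lim)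
  then have "eventually (\<lambda>t. g t ^ 2 < g x ^ 2) at_top"
    using \<open>g x ^ 2 > 0\<close> by (intro order_tendstoD(2)[where y = "0 ^ 2"]) auto
  then have "eventually (\<lambda>t. g t ^ 2 < g x ^ 2 \<and> t \<ge> x) at_top"
    using eventually_ge_at_top by (rule eventually_conj)
  then obtain t where "g t ^ 2 < g x ^ 2" "t \<ge> x" by (auto simp: eventually_at_top_linorder)
  with airy_sq_mono[OF g x, of t] p show False by auto
qed

text \<open>The product \<open>g g'\<close> is nonpositive by decay and nondecreasing from the value
  0, so it vanishes and \<open>g^2\<close> stays 0 on the half-line; uniqueness for the initial
  value problem at 1 extends this to the whole line. Applied to a difference of solutions, it makes
  the \<open>THE\<close> in \<open>Airy_Ai\<close> well defined.\<close>

lemma airy_decay_unique: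
  assumes g: "airy_ode g g'" and lim: "(g \<longlongrightarrow> 0) at_top" and 0: "g 0 = 0"
  shows "g = (\<lambda>_. 0)"
proof -
  have pr: "g x * g' x = 0" if "x \<ge> 0" for x
    using airy_decay_prod_nonpos[OF g lim that] airy_prod_mono[OF g _ that] 0 by force
  have gz: "g x = 0" if "x \<ge> 0" for x
  proof -
    have "g x ^ 2 \<le> g 0 ^ 2"
    proof (rule DERIV_nonpos_imp_nonincreasing[OF that, where f = "\<lambda>t. g t ^ 2"])
      fix t assume t: "0 \<le> t" "t \<le> x"
      have "DERIV (\<lambda>t. g t ^ 2) t :> 2 * (g t * g' t)"
        by (auto intro!: derivative_eq_intros airy_odeD[OF g] simp: algebra_simps power2_eq_square)
      then show "\<exists>y. DERIV (\<lambda>t. g t ^ 2) t :> y \<and> y \<le> 0" using pr[of t] t by force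
    qed
    then show ?thesis using 0 by simp
  qed
  have "g' 1 = 0"
  proof (rule DERIV_local_const[of g "g' 1" 1 1])
    show "DERIV g 1 :> g' 1" by (rule airy_odeD[OF g])
    show "\<forall>y. \<bar>1 - y\<bar> < 1 \<longrightarrow> g 1 = g y" using gz by (auto simp: abs_if split: if_splits)
  qed auto
  with gz[of 1] show ?thesis using airy_zero[OF g, of 1] by simp
qed

text \<open>The recessive solution is \<open>y1 - c * y2\<close>, where \<open>c\<close> is the
  infimum of \<open>y1 / y2\<close> over the positive axis. The ratio decreases because the
  Wronskian is the constant 1, so \<open>c\<close> is also its limit.\<close>

lemma airy_decaying_exists:
  "\<exists>f f'. airy_ode f f' \<and> (f \<longlongrightarrow> 0) at_top \<and> f 0 = 1 \<and> (\<forall>x\<ge>0. f x > 0)"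
proof -
  define y1 where "y1 = airy_sol 1 0"
  define y1' where "y1' = airy_sol' 1 0"
  define y2 where "y2 = airy_sol 0 1"
  define y2' where "y2' = airy_sol' 0 1"
  have o1: "airy_ode y1 y1'" and o2: "airy_ode y2 y2'"
    unfolding y1_def y1'_def y2_def y2'_def by (rule airy_sol_ode)+
  have i: "y1 0 = 1" "y1' 0 = 0" "y2 0 = 0" "y2' 0 = 1"
    unfolding y1_def y1'_def y2_def y2'_def by (simp_all add: airy_sol_0)
  have p1: "y1 x \<ge> 1" if "x \<ge> 0" for x
    using airy_sol_lower[of 1 0 x] that by (simp add: y1_def)
  have p2: "y2 x \<ge> x" if "x \<ge> 0" for x
    using airy_sol_lower[of 0 1 x] that by (simp add: y2_def)
  define W where "W = (\<lambda>x. y1 x * y2' x - y1' x * y2 x)"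
  have W: "W x = 1" for x
  proof -
    have "DERIV W t :> 0" for t unfolding W_def
      by (auto intro!: derivative_eq_intros airy_odeD[OF o1] airy_odeD[OF o2] simp: algebra_simps)
    then have "W x = W 0" using DERIV_isconst_all by blast
    then show ?thesis by (simp add: W_def i)
  qed
  define r where "r = (\<lambda>x. y1 x / y2 x)"
  have dr: "r y < r x" if "0 < x" "x < y" for x y
  proof (rule DERIV_neg_imp_decreasing[OF that(2)])
    fix t assume t: "x \<le> t" "t \<le> y"
    then have y2: "y2 t > 0" using p2[of t] that by linarith
    have "DERIV r t :> (y1' t * y2 t - y1 t * y2' t) / (y2 t * y2 t)"
      unfolding r_def using y2 by (auto intro!: derivative_eq_intros airy_odeD[OF o1] airy_odeD[OF o2])
    also have "y1' t * y2 t - y1 t * y2' t = -1" using W[of t] by (simp add: W_def)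
    finally show "\<exists>y. DERIV r t :> y \<and> y < 0" using y2 by (intro exI conjI) (auto simp: divide_neg_pos)
  qed
  have rpos: "r x \<ge> 0" if "x > 0" for x using p1[of x] p2[of x] that by (simp add: r_def)
  define c where "c = Inf (r ` {0<..})"
  have bdd: "bdd_below (r ` {0<..})" using rpos by (intro bdd_belowI[of _ 0]) auto
  have cle: "c \<le> r x" if "x > 0" for x unfolding c_def using that bdd by (intro cInf_lower) auto
  have clt: "c < r x" if "x > 0" for x using cle[of "x+1"] dr[of x "x+1"] that by simp
  have cap: "\<exists>x1>0. \<forall>x\<ge>x1. r x < c + d" if "d > 0" for d
  proof -
    have "\<exists>v \<in> r ` {0<..}. v < c + d"
    proof -
      have "r ` {0<..} \<noteq> {}" by simp
      moreover have "Inf (r ` {0<..}) < c + d" using that by (simp add: c_def)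
      ultimately show ?thesis by (rule cInf_lessD)
    qed
    then obtain x1 where "x1 > 0" "r x1 < c + d" by blast
    then show ?thesis using dr[of x1] by (metis less_eq_real_def order_less_trans)
  qed
  define f where "f = (\<lambda>x. 1 * y1 x + (- c) * y2 x)"
  define f' where "f' = (\<lambda>x. 1 * y1' x + (- c) * y2' x)"
  have of: "airy_ode f f'" unfolding f_def f'_def by (rule airy_ode_lincomb[OF o1 o2])
  have fr: "f x = y2 x * (r x - c)" if "x > 0" for x
    using p2[of x] that by (simp add: f_def r_def field_simps)
  have f0: "f 0 = 1" by (simp add: f_def i)
  have fpos: "f x > 0" if "x \<ge> 0" for x
    using fr[of x] clt[of x] p2[of x] that f0 by (cases "x = 0") (auto intro!: mult_pos_pos)
  \<comment> \<open>If \<open>f'\<close> were positive at \<open>x0\<close>, then for small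
    \<open>d\<close> also \<open>f - d * y2\<close> would have positive value and slope there and
    stay positive, against \<open>y1 / y2 < c + d\<close> far out.\<close>
  have f'np: "f' x0 \<le> 0" if x0: "x0 \<ge> 0" for x0
  proof (rule ccontr)
    assume "\<not> ?thesis"
    then have f'p: "f' x0 > 0" by simp
    define M where "M = 1 + \<bar>y2 x0\<bar> + \<bar>y2' x0\<bar>"
    define d where "d = min (f x0) (f' x0) / M"
    have M: "M > 0" by (auto simp: M_def)
    have d: "d > 0" using M f'p fpos[OF x0] by (auto simp: d_def)
    have "d * M \<le> f x0" "d * M \<le> f' x0" using M by (auto simp: d_def)
    moreover have "d * y2 x0 < d * M" "d * y2' x0 < d * M"
      using d by (auto simp: M_def)
    ultimately have u0: "f x0 - d * y2 x0 > 0" "f' x0 - d * y2' x0 > 0" by auto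
    define u where "u = (\<lambda>x. 1 * f x + (-d) * y2 x)"
    define u' where "u' = (\<lambda>x. 1 * f' x + (-d) * y2' x)"
    have ou: "airy_ode u u'" unfolding u_def u'_def by (rule airy_ode_lincomb[OF of o2])
    have up: "u x > 0" if "x \<ge> x0" for x
      by (rule airy_stays_pos[OF ou x0]) (use u0 that in \<open>auto simp: u_def u'_def\<close>)
    obtain x1 where x1: "x1 > 0" "\<forall>x\<ge>x1. r x < c + d" using cap[OF d] by blast
    define x where "x = max x0 x1"
    have x: "x \<ge> x0" "x > 0" "r x < c + d" using x1 by (auto simp: x_def)
    have y2: "y2 x > 0" using p2[of x] x by simp
    have "f x < y2 x * d" using fr[of x] x y2 by simp
    with up[of x] x show False by (simp add: u_def mult.commute)
  qed
  have fmono: "f y \<le> f x" if "0 \<le> x" "x \<le> y" for x y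
    by (rule DERIV_nonpos_imp_nonincreasing[OF that(2)])
       (use that f'np airy_odeD[OF of] in \<open>meson order_trans\<close>)
  \<comment> \<open>If \<open>f\<close> stayed above \<open>L\<close>, then
    \<open>f'' = t f >= L\<close> for \<open>t >= 1\<close>; at \<open>X\<close> the slope would
    have been forced up to 1.\<close>
  have small: "\<exists>x\<ge>0. f x < L" if L: "L > 0" for L
  proof (rule ccontr)
    assume "\<not> ?thesis"
    then have fL: "f x \<ge> L" if "x \<ge> 0" for x using that by force
    define X where "X = 1 + (1 - f' 1) / L"
    have X1: "X \<ge> 1" using f'np[of 1] L by (simp add: X_def)
    have "f' 1 - L * 1 \<le> f' X - L * X"
    proof (rule DERIV_nonneg_imp_nondecreasing[OF X1, where f = "\<lambda>t. f' t - L * t"])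
      fix t assume t: "1 \<le> t" "t \<le> X"
      have "DERIV (\<lambda>t. f' t - L * t) t :> t * f t - L"
        by (auto intro!: derivative_eq_intros airy_odeD[OF of])
      moreover have "1 * L \<le> t * f t" using t fL[of t] L by (intro mult_mono) auto
      ultimately show "\<exists>y. DERIV (\<lambda>t. f' t - L * t) t :> y \<and> y \<ge> 0" by force
    qed
    then have "f' X \<ge> f' 1 + L * (X - 1)" by (simp add: algebra_simps)
    also have "L * (X - 1) = 1 - f' 1" using L by (simp add: X_def)
    finally show False using f'np[of X] X1 by simp
  qed
  have "(f \<longlongrightarrow> 0) at_top"
  proof (rule tendstoI)
    fix e :: real assume "e > 0"
    then obtain x where x: "x \<ge> 0" "f x < e" using small by blast
    have "\<forall>t\<ge>x. dist (f t) 0 < e"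
    proof (intro allI impI)
      fix t assume t: "t \<ge> x"
      show "dist (f t) 0 < e" using fmono[OF x(1) t] fpos[of t] x t by (simp add: dist_real_def)
    qed
    then show "eventually (\<lambda>t. dist (f t) 0 < e) at_top" unfolding eventually_at_top_linorder by blast
  qed
  with of f0 fpos show ?thesis by blast
qed

section \<open>The function \<open>Airy_Ai\<close> and its largest zero\<close>

lemma Airy_Ai_props:
  obtains Ai' where "airy_ode Airy_Ai Ai'" "(Airy_Ai \<longlongrightarrow> 0) at_top" "\<And>x. x \<ge> 0 \<Longrightarrow> Airy_Ai x > 0"
    "\<And>x. x \<ge> 0 \<Longrightarrow> Ai' x \<le> 0"
proof -
  obtain f f' where f: "airy_ode f f'" "(f \<longlongrightarrow> 0) at_top" "f 0 = 1" "\<And>x. x \<ge> 0 \<Longrightarrow> f x > 0"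
    using airy_decaying_exists by blast
  define v :: real where "v = 1 / (3 powr (2/3) * Gamma (2/3))"
  have v: "v > 0" by (auto simp: v_def intro!: Gamma_real_pos)
  define g where "g = (\<lambda>x. v * f x + 0 * f x)"
  define g' where "g' = (\<lambda>x. v * f' x + 0 * f' x)"
  have g: "airy_ode g g'" unfolding g_def g'_def by (rule airy_ode_lincomb[OF f(1) f(1)])
  have lim: "(g \<longlongrightarrow> 0) at_top" unfolding g_def using tendsto_mult_right_zero[OF f(2), of v] by simp
  have gpos: "g x > 0" if "x \<ge> 0" for x using f(4)[OF that] v by (simp add: g_def)
  have eq: "Airy_Ai = g" unfolding Airy_Ai_def
  proof (rule the_equality)
    show "(\<exists>f'. \<forall>x. (g has_real_derivative f' x) (at x) \<and> (f' has_real_derivative x * g x) (at x)) \<and>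
      (g \<longlongrightarrow> 0) at_top \<and> g 0 = 1 / (3 powr (2/3) * Gamma (2/3))"
      using g lim f(3) by (auto simp: airy_ode_def g_def v_def)
  next
    fix k assume k: "(\<exists>k'. \<forall>x. (k has_real_derivative k' x) (at x) \<and> (k' has_real_derivative x * k x) (at x)) \<and>
      (k \<longlongrightarrow> 0) at_top \<and> k 0 = 1 / (3 powr (2/3) * Gamma (2/3))"
    then obtain k' where k': "airy_ode k k'" by (auto simp: airy_ode_def)
    have "(\<lambda>x. 1 * k x + (-1) * g x) = (\<lambda>_. 0)"
    proof (rule airy_decay_unique[OF airy_ode_lincomb[OF k' g]])
      have "((\<lambda>x. k x - g x) \<longlongrightarrow> 0 - 0) at_top" using k lim by (intro tendsto_diff) auto
      then show "((\<lambda>x. 1 * k x + (-1) * g x) \<longlongrightarrow> 0) at_top" by simp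
      show "1 * k 0 + (-1) * g 0 = 0" using k f(3) by (simp add: g_def v_def)
    qed
    then have "k x = g x" for x by (metis add_uminus_conv_diff eq_iff_diff_eq_0 mult_1 mult_minus1)
    then show "k = g" by blast
  qed
  have "g' x \<le> 0" if "x \<ge> 0" for x
    using airy_decay_prod_nonpos[OF g lim that] gpos[OF that] by (simp add: mult_le_0_iff)
  with that[of g'] eq g lim gpos show ?thesis by blast
qed

text \<open>Without a zero, \<open>f\<close> would be positive and concave on the negative axis. A
  positive slope there would bring \<open>f\<close> down to 0 further left, so
  \<open>f' <= 0\<close> and \<open>f >= f 0\<close>; but then \<open>f'' <= - f 0\<close> left of
  \<open>-1\<close>, and \<open>f'\<close> turns positive far to the left.\<close>

lemma Airy_Ai_has_zero: "\<exists>x<0. Airy_Ai x = 0"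
proof (rule ccontr)
  assume nz: "\<not> ?thesis"
  obtain Ai' where ai: "airy_ode Airy_Ai Ai'" "\<And>x. x \<ge> 0 \<Longrightarrow> Airy_Ai x > 0"
    using Airy_Ai_props by metis
  define f where "f = Airy_Ai"
  have fpos: "f x > 0" for x
  proof (rule ccontr)
    assume n: "\<not> f x > 0"
    then have "x < 0" using ai(2)[of x] by (force simp: f_def)
    then obtain t where "x \<le> t" "t \<le> 0" "f t = 0"
      using IVT'[of f x 0 0] n ai airy_ode_continuous_on(1)[OF ai(1)] unfolding f_def
      by (smt (verit))
    then show False using nz ai(2)[of 0] unfolding f_def by (cases "t = 0") auto
  qed
  have d'mono: "Ai' y \<le> Ai' x" if "x \<le> y" "y \<le> 0" for x y
  proof (rule DERIV_nonpos_imp_nonincreasing[OF that(1)])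
    fix t assume t: "x \<le> t" "t \<le> y"
    show "\<exists>y. DERIV Ai' t :> y \<and> y \<le> 0"
      using airy_odeD(2)[OF ai(1), of t] fpos[of t] t that unfolding f_def
      by (intro exI[of _ "t * Airy_Ai t"]) (auto intro: mult_nonpos_nonneg)
  qed
  have np: "Ai' x0 \<le> 0" if "x0 \<le> 0" for x0
  proof (rule ccontr)
    assume "\<not> ?thesis"
    then have p: "Ai' x0 > 0" by simp
    \<comment> \<open>The zero of the tangent at \<open>x0\<close>, which lies above the concave
      \<open>f\<close>.\<close>
    define X where "X = x0 - f x0 / Ai' x0"
    have X: "X \<le> x0" using p fpos[of x0] by (simp add: X_def)
    have "f X - Ai' x0 * X \<le> f x0 - Ai' x0 * x0"
    proof (rule DERIV_nonneg_imp_nondecreasing[OF X, where f = "\<lambda>t. f t - Ai' x0 * t"])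
      fix t assume t: "X \<le> t" "t \<le> x0"
      have "DERIV (\<lambda>t. f t - Ai' x0 * t) t :> Ai' t - Ai' x0" unfolding f_def
        by (auto intro!: derivative_eq_intros airy_odeD[OF ai(1)])
      then show "\<exists>y. DERIV (\<lambda>t. f t - Ai' x0 * t) t :> y \<and> y \<ge> 0"
        using d'mono[of t x0] t that by force
    qed
    then have "f X \<le> f x0 - Ai' x0 * (x0 - X)" by (simp add: algebra_simps)
    also have "\<dots> = 0" using p by (simp add: X_def)
    finally show False using fpos[of X] by simp
  qed
  \<comment> \<open>Going left from \<open>-1\<close>, the slope gains at least \<open>f 0\<close>
    per unit length, so it has reached 1 at \<open>X\<close>.\<close>
  define X where "X = - (1 + (1 - Ai' (-1)) / f 0)"
  have X: "X \<le> -1" using np[of "-1"] fpos[of 0] by (simp add: X_def)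
  have f0: "f t \<ge> f 0" if "t \<le> 0" for t
    by (rule DERIV_nonpos_imp_nonincreasing[OF that])
       (use np airy_odeD(1)[OF ai(1)] in \<open>auto simp: f_def\<close>)
  have "Ai' (-1) + f 0 * (-1) \<le> Ai' X + f 0 * X"
  proof (rule DERIV_nonpos_imp_nonincreasing[OF X, where f = "\<lambda>t. Ai' t + f 0 * t"])
    fix t assume t: "X \<le> t" "t \<le> -1"
    have "DERIV (\<lambda>t. Ai' t + f 0 * t) t :> t * f t + f 0" unfolding f_def
      by (auto intro!: derivative_eq_intros airy_odeD[OF ai(1)])
    moreover have "1 * f 0 \<le> (- t) * f t" using t f0[of t] fpos[of 0] by (intro mult_mono) auto
    ultimately show "\<exists>y. DERIV (\<lambda>t. Ai' t + f 0 * t) t :> y \<and> y \<le> 0" by force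
  qed
  then have "Ai' X \<ge> Ai' (-1) + f 0 * (- 1 - X)" by (simp add: algebra_simps)
  also have "f 0 * (- 1 - X) = 1 - Ai' (-1)" using fpos[of 0] by (simp add: X_def)
  finally show False using np[of X] X by simp
qed

text \<open>The set of zeros is nonempty, closed and bounded above by 0, so \<open>GREATEST\<close>
  picks its supremum; to the right of it the intermediate value theorem forbids a change of
  sign.\<close>

lemma airy_a1_props:
  "airy_a1 < 0" "Airy_Ai airy_a1 = 0" "x > airy_a1 \<Longrightarrow> Airy_Ai x > 0"
proof -
  obtain Ai' where ai: "airy_ode Airy_Ai Ai'" "\<And>x. x \<ge> 0 \<Longrightarrow> Airy_Ai x > 0"
    using Airy_Ai_props by metis
  define Z where "Z = {x. Airy_Ai x = 0}"
  have ne: "Z \<noteq> {}" using Airy_Ai_has_zero by (auto simp: Z_def)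
  have ub: "z < 0" if "z \<in> Z" for z using that ai(2)[of z] by (force simp: Z_def)
  have bdd: "bdd_above Z" using ub by (intro bdd_aboveI[of _ 0]) force
  have cl: "closed Z"
  proof -
    have "closed (Airy_Ai -` {0})"
      by (rule continuous_closed_vimage) (auto intro!: DERIV_isCont airy_odeD(1)[OF ai(1)])
    moreover have "Airy_Ai -` {0} = Z" by (auto simp: Z_def)
    ultimately show ?thesis by simp
  qed
  define m where "m = Sup Z"
  have mZ: "m \<in> Z" unfolding m_def by (rule closed_contains_Sup[OF ne bdd cl])
  have mub: "z \<le> m" if "z \<in> Z" for z unfolding m_def using that bdd by (rule cSup_upper)
  have a1: "airy_a1 = m" unfolding airy_a1_def
    by (rule Greatest_equality) (use mZ mub in \<open>auto simp: Z_def\<close>)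
  show "airy_a1 < 0" "Airy_Ai airy_a1 = 0" using a1 mZ ub by (auto simp: Z_def)
  show "Airy_Ai x > 0" if "x > airy_a1"
  proof (rule ccontr)
    assume n: "\<not> ?thesis"
    then have "x < 0" using ai(2)[of x] by force
    then obtain t where "x \<le> t" "t \<le> 0" "Airy_Ai t = 0"
      using IVT'[of Airy_Ai x 0 0] n ai airy_ode_continuous_on(1)[OF ai(1)]
      by (smt (verit))
    then show False using mub[of t] a1 that by (simp add: Z_def)
  qed
qed


text \<open>For \<open>t >= 1\<close> the sum \<open>u = Ai' + Ai\<close> satisfies
  \<open>u' = u + (t - 1) Ai\<close>, so a positive value of \<open>u\<close> would grow and, as
  \<open>Ai' <= 0\<close>, keep \<open>Ai\<close> away from 0. Hence \<open>u <= 0\<close> and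
  \<open>Ai\<close> times \<open>exp x\<close> decreases. Convexity carries the bound over to
  \<open>Ai'\<close>, and compactness covers the interval up to 2.\<close>

lemma Airy_Ai_decay:
  assumes ai: "airy_ode Airy_Ai Ai'"
  shows "\<exists>C. \<forall>x\<ge>airy_a1. \<bar>Airy_Ai x\<bar> \<le> C * exp (- x) \<and> \<bar>Ai' x\<bar> \<le> C * exp (- x)"
proof -
  obtain Ai2 where p: "airy_ode Airy_Ai Ai2" "(Airy_Ai \<longlongrightarrow> 0) at_top" "\<And>x. x \<ge> 0 \<Longrightarrow> Airy_Ai x > 0"
    "\<And>x. x \<ge> 0 \<Longrightarrow> Ai2 x \<le> 0" using Airy_Ai_props by metis
  have "Ai2 = Ai'" using airy_odeD(1)[OF ai] airy_odeD(1)[OF p(1)] DERIV_unique by blast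
  with p have np: "Ai' x \<le> 0" if "x \<ge> 0" for x using that by simp
  note pos = p(3)
  have le: "Ai' x0 \<le> - Airy_Ai x0" if x0: "x0 \<ge> 1" for x0
  proof (rule ccontr)
    define u where "u = (\<lambda>x. Ai' x + Airy_Ai x)"
    assume "\<not> ?thesis"
    then have u0: "u x0 > 0" by (simp add: u_def)
    have ge: "Airy_Ai x \<ge> u x0" if x: "x \<ge> x0" for x
    proof -
      have "u x0 * exp (- x0) \<le> u x * exp (- x)"
      proof (rule DERIV_nonneg_imp_nondecreasing[OF x, where f = "\<lambda>t. u t * exp (- t)"])
        fix t assume t: "x0 \<le> t" "t \<le> x"
        have "DERIV (\<lambda>t. u t * exp (- t)) t :> (t - 1) * Airy_Ai t * exp (- t)" unfolding u_def
          by (auto intro!: derivative_eq_intros airy_odeD[OF ai] simp: algebra_simps)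
        moreover have "(t - 1) * Airy_Ai t * exp (- t) \<ge> 0" using pos[of t] t x0 by simp
        ultimately show "\<exists>y. DERIV (\<lambda>t. u t * exp (- t)) t :> y \<and> y \<ge> 0" by blast
      qed
      then have "u x0 * exp (x - x0) \<le> u x" by (simp add: exp_diff exp_minus field_simps)
      moreover have "u x0 * 1 \<le> u x0 * exp (x - x0)" using u0 x by (intro mult_left_mono) auto
      ultimately show ?thesis using np[of x] x x0 by (simp add: u_def)
    qed
    have "eventually (\<lambda>t. Airy_Ai t < u x0 \<and> t \<ge> x0) at_top"
      using order_tendstoD(2)[OF p(2) u0] eventually_ge_at_top by (rule eventually_conj)
    then obtain t where "Airy_Ai t < u x0" "t \<ge> x0" by (auto simp: eventually_at_top_linorder)
    with ge[of t] show False by simp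
  qed
  define c where "c = Airy_Ai 1 * exp 1"
  have b1: "Airy_Ai x \<le> c * exp (- x)" if x: "x \<ge> 1" for x
  proof -
    have "Airy_Ai x * exp x \<le> Airy_Ai 1 * exp 1"
    proof (rule DERIV_nonpos_imp_nonincreasing[OF x, where f = "\<lambda>t. Airy_Ai t * exp t"])
      fix t assume t: "1 \<le> t" "t \<le> x"
      have "DERIV (\<lambda>t. Airy_Ai t * exp t) t :> (Ai' t + Airy_Ai t) * exp t"
        by (auto intro!: derivative_eq_intros airy_odeD[OF ai] simp: algebra_simps)
      moreover have "(Ai' t + Airy_Ai t) * exp t \<le> 0" using le[of t] t by (intro mult_nonpos_nonneg) auto
      ultimately show "\<exists>y. DERIV (\<lambda>t. Airy_Ai t * exp t) t :> y \<and> y \<le> 0" by blast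
    qed
    then show ?thesis by (simp add: c_def exp_minus field_simps)
  qed
  have b2: "\<bar>Ai' x\<bar> \<le> c * exp 1 * exp (- x)" if x: "x \<ge> 2" for x
  proof -
    \<comment> \<open>As \<open>Ai'\<close> increases, \<open>- Ai' x\<close> is at most the mean
      descent over \<open>[x - 1, x]\<close>.\<close>
    obtain \<xi> where \<xi>: "x - 1 < \<xi>" "\<xi> < x" "Airy_Ai x - Airy_Ai (x - 1) = (x - (x - 1)) * Ai' \<xi>"
      using MVT2[of "x - 1" x Airy_Ai Ai'] airy_odeD(1)[OF ai] by auto
    have "Ai' \<xi> \<le> Ai' x"
    proof (rule DERIV_nonneg_imp_nondecreasing[of \<xi> x])
      fix t assume t: "\<xi> \<le> t" "t \<le> x"
      have "t * Airy_Ai t \<ge> 0" using pos[of t] t \<xi> x by simp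
      then show "\<exists>y. DERIV Ai' t :> y \<and> y \<ge> 0" using airy_odeD(2)[OF ai] by blast
    qed (use \<xi> in auto)
    then have "- Ai' x \<le> Airy_Ai (x - 1)" using \<xi> pos[of x] x by simp
    also have "\<dots> \<le> c * exp (- (x - 1))" using b1[of "x - 1"] x by simp
    finally show ?thesis using np[of x] x by (simp add: exp_diff exp_minus field_simps)
  qed
  have "\<exists>B. \<forall>x\<in>{airy_a1..2}. \<bar>Airy_Ai x\<bar> * exp x \<le> B \<and> \<bar>Ai' x\<bar> * exp x \<le> B"
  proof -
    have "continuous_on {airy_a1..2} (\<lambda>x. \<bar>Airy_Ai x\<bar> * exp x + \<bar>Ai' x\<bar> * exp x)"
      by (intro continuous_intros airy_ode_continuous_on[OF ai])
    then have "bounded ((\<lambda>x. \<bar>Airy_Ai x\<bar> * exp x + \<bar>Ai' x\<bar> * exp x) ` {airy_a1..2})"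
      by (intro compact_imp_bounded compact_continuous_image) auto
    then obtain B where B: "\<And>x. x \<in> {airy_a1..2} \<Longrightarrow> \<bar>\<bar>Airy_Ai x\<bar> * exp x + \<bar>Ai' x\<bar> * exp x\<bar> \<le> B"
      unfolding bounded_iff ball_simps real_norm_def by blast
    have "\<bar>Airy_Ai x\<bar> * exp x \<le> B \<and> \<bar>Ai' x\<bar> * exp x \<le> B" if "x \<in> {airy_a1..2}" for x
    proof -
      have "0 \<le> \<bar>Airy_Ai x\<bar> * exp x" "0 \<le> \<bar>Ai' x\<bar> * exp x" by simp_all
      then show ?thesis using B[OF that] by linarith
    qed
    then show ?thesis by blast
  qed
  then obtain B where B: "\<And>x. x \<in> {airy_a1..2} \<Longrightarrow> \<bar>Airy_Ai x\<bar> * exp x \<le> B \<and> \<bar>Ai' x\<bar> * exp x \<le> B" by blast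
  define C where "C = \<bar>B\<bar> + \<bar>c\<bar> + \<bar>c\<bar> * exp 1"
  have "\<bar>Airy_Ai x\<bar> \<le> C * exp (- x) \<and> \<bar>Ai' x\<bar> \<le> C * exp (- x)" if x: "x \<ge> airy_a1" for x
  proof (cases "x \<le> 2")
    case True
    have "B \<le> C" unfolding C_def by (smt (verit) mult_nonneg_nonneg exp_ge_zero)
    then have "\<bar>Airy_Ai x\<bar> * exp x \<le> C" "\<bar>Ai' x\<bar> * exp x \<le> C"
      using B[of x] x True by auto
    then show ?thesis by (simp add: exp_minus field_simps)
  next
    case False
    have "c * exp 1 \<le> \<bar>c\<bar> * exp 1" "0 \<le> \<bar>c\<bar> * exp 1" by (auto intro!: mult_right_mono)
    then have "c \<le> C" "c * exp 1 \<le> C" unfolding C_def by linarith+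
    then have "c * exp (- x) \<le> C * exp (- x)" "c * exp 1 * exp (- x) \<le> C * exp (- x)"
      by (auto intro!: mult_right_mono)
    moreover have "\<bar>Airy_Ai x\<bar> = Airy_Ai x" using pos[of x] False by simp
    ultimately show ?thesis using b1[of x] b2[of x] False by (intro conjI) linarith+
  qed
  then show ?thesis by blast
qed

section \<open>The Airy function with its largest zero moved to the origin\<close>

locale airy_shift =
  fixes a :: real and A A' :: "real \<Rightarrow> real"
  assumes DA: "\<And>x. (A has_real_derivative A' x) (at x)"
    and DA': "\<And>x. (A' has_real_derivative (a + x) * A x) (at x)"
    and A_0: "A 0 = 0" and A'_0: "A' 0 > 0"
    and A_pos: "\<And>x. x > 0 \<Longrightarrow> A x > 0"
    and A_decay: "\<exists>C. \<forall>x\<ge>0. \<bar>A x\<bar> \<le> C * exp (- x) \<and> \<bar>A' x\<bar> \<le> C * exp (- x)"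

lemma airy_shift_exists: "\<exists>A A'. airy_shift airy_a1 A A'"
proof -
  obtain Ai' where ai: "airy_ode Airy_Ai Ai'" using Airy_Ai_props by metis
  obtain C where C: "\<And>x. x \<ge> airy_a1 \<Longrightarrow> \<bar>Airy_Ai x\<bar> \<le> C * exp (- x) \<and> \<bar>Ai' x\<bar> \<le> C * exp (- x)"
    using Airy_Ai_decay[OF ai] by blast
  have nz: "Ai' airy_a1 \<noteq> 0"
  proof
    assume "Ai' airy_a1 = 0"
    then have "Airy_Ai = (\<lambda>_. 0)" using airy_zero[OF ai airy_a1_props(2)] by simp
    then show False using airy_a1_props(1) airy_a1_props(3)[of 0] by (metis less_irrefl)
  qed
  have nn: "Ai' airy_a1 \<ge> 0"
  proof (rule ccontr)
    assume "\<not> ?thesis"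
    then obtain d where d: "d > 0" "\<forall>h>0. h < d \<longrightarrow> Airy_Ai (airy_a1 + h) < Airy_Ai airy_a1"
      using DERIV_neg_dec_right[OF airy_odeD(1)[OF ai]] by (meson not_le)
    from d(2)[rule_format, of "d/2"] d(1) show False
      using airy_a1_props(2) airy_a1_props(3)[of "airy_a1 + d/2"] by simp
  qed
  have "airy_shift airy_a1 (\<lambda>x. Airy_Ai (airy_a1 + x)) (\<lambda>x. Ai' (airy_a1 + x))"
  proof
    show "((\<lambda>x. Airy_Ai (airy_a1 + x)) has_real_derivative Ai' (airy_a1 + x)) (at x)" for x
      using DERIV_shift[of Airy_Ai "Ai' (airy_a1 + x)" x airy_a1] airy_odeD(1)[OF ai] by (simp add: add.commute)
    show "((\<lambda>x. Ai' (airy_a1 + x)) has_real_derivative (airy_a1 + x) * Airy_Ai (airy_a1 + x)) (at x)" for x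
      using DERIV_shift[of Ai' "(airy_a1 + x) * Airy_Ai (airy_a1 + x)" x airy_a1] airy_odeD(2)[OF ai]
      by (simp add: add.commute)
    show "Airy_Ai (airy_a1 + 0) = 0" "Ai' (airy_a1 + 0) > 0" using nz nn airy_a1_props(2) by auto
    show "Airy_Ai (airy_a1 + x) > 0" if "x > 0" for x using airy_a1_props(3) that by simp
    have "\<bar>Airy_Ai (airy_a1 + x)\<bar> \<le> (C * exp (- airy_a1)) * exp (- x) \<and>
        \<bar>Ai' (airy_a1 + x)\<bar> \<le> (C * exp (- airy_a1)) * exp (- x)" if "x \<ge> 0" for x
      using C[of "airy_a1 + x"] that by (simp add: exp_add exp_diff exp_minus field_simps)
    then show "\<exists>C. \<forall>x\<ge>0. \<bar>Airy_Ai (airy_a1 + x)\<bar> \<le> C * exp (- x) \<and> \<bar>Ai' (airy_a1 + x)\<bar> \<le> C * exp (- x)"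
      by blast
  qed
  then show ?thesis by blast
qed

section \<open>Error terms\<close>

text \<open>At time \<open>N\<close> heights are measured in units of \<open>1 / hh N\<close>, so that \<open>XX N y\<close> is the scaled height;
  all expansions below are in powers of \<open>h = hh N\<close>, with \<open>1 / N = h\<^sup>3 / 2\<close>.\<close>
definition hh :: "nat \<Rightarrow> real" where "hh N = (2 / real N) powr (1/3)"
definition XX :: "nat \<Rightarrow> nat \<Rightarrow> real" where "XX N y = real y * hh N"

lemma hh_cube: "N > 0 \<Longrightarrow> hh N ^ 3 = 2 / real N"
  by (simp add: hh_def powr_powr flip: powr_realpow)

lemma hh_pos: "N > 0 \<Longrightarrow> hh N > 0"
  by (simp add: hh_def)

lemma hh_mono: "0 < M \<Longrightarrow> M \<le> N \<Longrightarrow> hh N \<le> hh M"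
  unfolding hh_def by (intro powr_mono2) (auto simp: frac_le)

text \<open>At \<open>N = 16\<close> the quotient \<open>2 / N\<close> is
  \<open>1/8 = (1/2)^3\<close>. This is the origin of the threshold 16 in the error
  estimates.\<close>

lemma hh_le: "N \<ge> 16 \<Longrightarrow> hh N \<le> 1/2"
proof (rule power_le_imp_le_base[of _ 2])
  assume "N \<ge> 16"
  then have "2 / real N \<le> 1/8" by (simp add: field_simps)
  then have "hh N ^ 3 \<le> 1/8" using hh_cube[of N] \<open>N \<ge> 16\<close> by simp
  then show "hh N ^ Suc 2 \<le> (1/2) ^ Suc 2" by (simp add: power3_eq_cube numeral_2_eq_2)
qed auto

lemma XX_ge: "y \<ge> 1 \<Longrightarrow> XX N y \<ge> hh N"
  unfolding XX_def by (simp add: hh_def mult_le_cancel_right1)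

lemma hX_facts:
  assumes "N \<ge> 16" "y \<ge> 1"
  shows "0 < hh N" "hh N \<le> 1/2" "hh N \<le> XX N y" "0 < XX N y" "hh N \<le> 1"
  using hh_pos[of N] hh_le[of N] XX_ge[of y N] assms by auto

text \<open>Two classes of error terms of order \<open>h\<^sup>i x\<^sup>j\<close>, uniform in \<open>x \<ge> h\<close>: up to a polynomial factor in \<open>x\<close>,
  and even after multiplication by any polynomial in \<open>x\<close>. As \<open>x \<ge> h\<close>, a factor \<open>h\<close> may be
  traded for a factor \<open>x\<close>.\<close>
definition poly_bdd :: "nat \<Rightarrow> nat \<Rightarrow> (nat \<Rightarrow> nat \<Rightarrow> real) \<Rightarrow> bool" where
  "poly_bdd i j f \<longleftrightarrow> (\<exists>C k. C \<ge> 0 \<and> (\<forall>N\<ge>16. \<forall>y\<ge>1. \<bar>f N y\<bar> \<le> C * (1 + XX N y) ^ k * (hh N ^ i * XX N y ^ j)))"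

definition rapid_bdd :: "nat \<Rightarrow> nat \<Rightarrow> (nat \<Rightarrow> nat \<Rightarrow> real) \<Rightarrow> bool" where
  "rapid_bdd i j f \<longleftrightarrow> (\<forall>k. \<exists>C\<ge>0. \<forall>N\<ge>16. \<forall>y\<ge>1. \<bar>f N y\<bar> * (1 + XX N y) ^ k \<le> C * (hh N ^ i * XX N y ^ j))"

lemma poly_bddI:
  assumes "C \<ge> 0" "\<And>N y. N \<ge> 16 \<Longrightarrow> y \<ge> 1 \<Longrightarrow> \<bar>f N y\<bar> \<le> C * (1 + XX N y) ^ k * (hh N ^ i * XX N y ^ j)"
  shows "poly_bdd i j f"
  using assms unfolding poly_bdd_def by blast

lemma poly_bdd_cong: "(\<And>N y. N \<ge> 16 \<Longrightarrow> y \<ge> 1 \<Longrightarrow> f N y = g N y) \<Longrightarrow> poly_bdd i j f \<longleftrightarrow> poly_bdd i j g"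
  unfolding poly_bdd_def by simp

lemma rapid_bdd_cong: "(\<And>N y. N \<ge> 16 \<Longrightarrow> y \<ge> 1 \<Longrightarrow> f N y = g N y) \<Longrightarrow> rapid_bdd i j f \<longleftrightarrow> rapid_bdd i j g"
  unfolding rapid_bdd_def by simp

text \<open>Two trades are combined: a surplus factor \<open>h\<close> becomes a factor
  \<open>x\<close>, or is dropped since \<open>h <= 1\<close>, and surplus powers of
  \<open>x\<close> are absorbed by \<open>(1 + x)^j\<close>.\<close>

lemma scale_weaken:
  assumes "N \<ge> 16" "y \<ge> 1" "i' \<le> i" "i' + j' \<le> i + j"
  shows "hh N ^ i * XX N y ^ j \<le> (1 + XX N y) ^ j * (hh N ^ i' * XX N y ^ j')"
proof -
  note b = hX_facts[OF assms(1,2)]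
  define h where "h = hh N"
  define x where "x = XX N y"
  have b: "0 < h" "h \<le> 1" "h \<le> x" "0 < x" using b by (auto simp: h_def x_def)
  have "h ^ i * x ^ j \<le> (1 + x) ^ j * (h ^ i' * x ^ j')"
  proof (cases "j' \<le> j")
    case True
    have "h ^ i \<le> h ^ i'" using b assms by (intro power_decreasing) auto
    moreover have "x ^ j \<le> (1 + x) ^ j * x ^ j'"
    proof -
      have "x ^ j = x ^ (j - j') * x ^ j'" using True by (simp flip: power_add)
      also have "x ^ (j - j') \<le> (1 + x) ^ (j - j')" using b by (intro power_mono) auto
      also have "(1 + x) ^ (j - j') \<le> (1 + x) ^ j" using b by (intro power_increasing) auto
      finally show ?thesis using b by simp
    qed
    ultimately have "h ^ i * x ^ j \<le> h ^ i' * ((1 + x) ^ j * x ^ j')" using b by (intro mult_mono) auto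
    then show ?thesis by (simp add: mult_ac)
  next
    case False
    have "h ^ i = h ^ i' * h ^ (i - i')" using assms by (simp flip: power_add)
    also have "h ^ (i - i') \<le> h ^ (j' - j)" using b assms False by (intro power_decreasing) auto
    also have "h ^ (j' - j) \<le> x ^ (j' - j)" using b by (intro power_mono) auto
    finally have "h ^ i \<le> h ^ i' * x ^ (j' - j)" using b by simp
    then have "h ^ i * x ^ j \<le> (h ^ i' * x ^ (j' - j)) * x ^ j" using b by (intro mult_right_mono) auto
    also have "\<dots> = 1 * (h ^ i' * x ^ j')" using False by (simp add: mult.assoc flip: power_add)
    also have "\<dots> \<le> (1 + x) ^ j * (h ^ i' * x ^ j')" using b by (intro mult_right_mono) auto
    finally show ?thesis .
  qed
  then show ?thesis by (simp add: h_def x_def)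
qed

lemma poly_bdd_weaken:
  assumes "poly_bdd i j f" "i' \<le> i" "i' + j' \<le> i + j"
  shows "poly_bdd i' j' f"
proof -
  obtain C k where C: "C \<ge> 0" "\<And>N y. N \<ge> 16 \<Longrightarrow> y \<ge> 1 \<Longrightarrow> \<bar>f N y\<bar> \<le> C * (1 + XX N y) ^ k * (hh N ^ i * XX N y ^ j)"
    using assms(1) unfolding poly_bdd_def by blast
  show ?thesis
  proof (rule poly_bddI[OF C(1), where k = "k + j"])
    fix N y :: nat assume Ny: "N \<ge> 16" "y \<ge> 1"
    note C(2)[OF Ny]
    also have "C * (1 + XX N y) ^ k * (hh N ^ i * XX N y ^ j)
        \<le> C * (1 + XX N y) ^ k * ((1 + XX N y) ^ j * (hh N ^ i' * XX N y ^ j'))"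
      using C(1) hX_facts[OF Ny] by (intro mult_left_mono scale_weaken[OF Ny assms(2,3)]) auto
    finally show "\<bar>f N y\<bar> \<le> C * (1 + XX N y) ^ (k + j) * (hh N ^ i' * XX N y ^ j')"
      by (simp add: power_add mult_ac)
  qed
qed

lemma rapid_bdd_weaken:
  assumes "rapid_bdd i j f" "i' \<le> i" "i' + j' \<le> i + j"
  shows "rapid_bdd i' j' f"
  unfolding rapid_bdd_def
proof
  fix k
  obtain C where C: "C \<ge> 0" "\<And>N y. N \<ge> 16 \<Longrightarrow> y \<ge> 1 \<Longrightarrow> \<bar>f N y\<bar> * (1 + XX N y) ^ (k + j) \<le> C * (hh N ^ i * XX N y ^ j)"
    using assms(1) unfolding rapid_bdd_def by blast
  have "\<bar>f N y\<bar> * (1 + XX N y) ^ k \<le> C * (hh N ^ i' * XX N y ^ j')" if Ny: "N \<ge> 16" "y \<ge> 1" for N y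
  proof -
    have "(\<bar>f N y\<bar> * (1 + XX N y) ^ k) * (1 + XX N y) ^ j \<le> C * (hh N ^ i * XX N y ^ j)"
      using C(2)[OF Ny] by (simp add: power_add mult_ac)
    also have "\<dots> \<le> C * ((1 + XX N y) ^ j * (hh N ^ i' * XX N y ^ j'))"
      using C(1) by (intro mult_left_mono scale_weaken[OF Ny assms(2,3)])
    also have "\<dots> = (C * (hh N ^ i' * XX N y ^ j')) * (1 + XX N y) ^ j" by (simp add: mult_ac)
    finally show ?thesis using hX_facts[OF Ny] by (subst (asm) mult_le_cancel_right) auto
  qed
  then show "\<exists>C\<ge>0. \<forall>N\<ge>16. \<forall>y\<ge>1. \<bar>f N y\<bar> * (1 + XX N y) ^ k \<le> C * (hh N ^ i' * XX N y ^ j')"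
    using C(1) by blast
qed

lemma poly_bdd_mult:
  assumes "poly_bdd i j f" "poly_bdd i' j' g"
  shows "poly_bdd (i + i') (j + j') (\<lambda>N y. f N y * g N y)"
proof -
  obtain C k where C: "C \<ge> 0" "\<And>N y. N \<ge> 16 \<Longrightarrow> y \<ge> 1 \<Longrightarrow> \<bar>f N y\<bar> \<le> C * (1 + XX N y) ^ k * (hh N ^ i * XX N y ^ j)"
    using assms(1) unfolding poly_bdd_def by blast
  obtain D l where D: "D \<ge> 0" "\<And>N y. N \<ge> 16 \<Longrightarrow> y \<ge> 1 \<Longrightarrow> \<bar>g N y\<bar> \<le> D * (1 + XX N y) ^ l * (hh N ^ i' * XX N y ^ j')"
    using assms(2) unfolding poly_bdd_def by blast
  show ?thesis
  proof (rule poly_bddI[of "C * D" _ "k + l"])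
    fix N y :: nat assume Ny: "N \<ge> 16" "y \<ge> 1"
    have "\<bar>f N y * g N y\<bar> \<le> (C * (1 + XX N y) ^ k * (hh N ^ i * XX N y ^ j)) * (D * (1 + XX N y) ^ l * (hh N ^ i' * XX N y ^ j'))"
      unfolding abs_mult using C(1) D(1) hX_facts[OF Ny] by (intro mult_mono C(2) D(2) Ny) auto
    then show "\<bar>f N y * g N y\<bar> \<le> C * D * (1 + XX N y) ^ (k + l) * (hh N ^ (i + i') * XX N y ^ (j + j'))"
      by (simp add: power_add mult_ac)
  qed (use C D in auto)
qed

lemma rapid_bdd_mult:
  assumes "poly_bdd i' j' g" "rapid_bdd i j f"
  shows "rapid_bdd (i' + i) (j' + j) (\<lambda>N y. g N y * f N y)"
  unfolding rapid_bdd_def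
proof
  fix k
  obtain D l where D: "D \<ge> 0" "\<And>N y. N \<ge> 16 \<Longrightarrow> y \<ge> 1 \<Longrightarrow> \<bar>g N y\<bar> \<le> D * (1 + XX N y) ^ l * (hh N ^ i' * XX N y ^ j')"
    using assms(1) unfolding poly_bdd_def by blast
  obtain C where C: "C \<ge> 0" "\<And>N y. N \<ge> 16 \<Longrightarrow> y \<ge> 1 \<Longrightarrow> \<bar>f N y\<bar> * (1 + XX N y) ^ (k + l) \<le> C * (hh N ^ i * XX N y ^ j)"
    using assms(2) unfolding rapid_bdd_def by blast
  have "\<bar>g N y * f N y\<bar> * (1 + XX N y) ^ k \<le> (D * C) * (hh N ^ (i' + i) * XX N y ^ (j' + j))" if Ny: "N \<ge> 16" "y \<ge> 1" for N y
  proof -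
    note b = hX_facts[OF Ny]
    have "\<bar>g N y * f N y\<bar> * (1 + XX N y) ^ k \<le> (D * (1 + XX N y) ^ l * (hh N ^ i' * XX N y ^ j')) * \<bar>f N y\<bar> * (1 + XX N y) ^ k"
      unfolding abs_mult using b by (intro mult_right_mono D(2) Ny) auto
    also have "\<dots> = D * (hh N ^ i' * XX N y ^ j') * (\<bar>f N y\<bar> * (1 + XX N y) ^ (k + l))"
      by (simp add: power_add mult_ac)
    also have "\<dots> \<le> D * (hh N ^ i' * XX N y ^ j') * (C * (hh N ^ i * XX N y ^ j))"
      using D(1) b by (intro mult_left_mono C(2) Ny) auto
    finally show ?thesis by (simp add: power_add mult_ac)
  qed
  then show "\<exists>C\<ge>0. \<forall>N\<ge>16. \<forall>y\<ge>1. \<bar>g N y * f N y\<bar> * (1 + XX N y) ^ k \<le> C * (hh N ^ (i' + i) * XX N y ^ (j' + j))"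
    using C(1) D(1) by (intro exI[of _ "D * C"]) auto
qed

lemma poly_bdd_add:
  assumes "poly_bdd i j f" "poly_bdd i j g"
  shows "poly_bdd i j (\<lambda>N y. f N y + g N y)"
proof -
  obtain C k where C: "C \<ge> 0" "\<And>N y. N \<ge> 16 \<Longrightarrow> y \<ge> 1 \<Longrightarrow> \<bar>f N y\<bar> \<le> C * (1 + XX N y) ^ k * (hh N ^ i * XX N y ^ j)"
    using assms(1) unfolding poly_bdd_def by blast
  obtain D l where D: "D \<ge> 0" "\<And>N y. N \<ge> 16 \<Longrightarrow> y \<ge> 1 \<Longrightarrow> \<bar>g N y\<bar> \<le> D * (1 + XX N y) ^ l * (hh N ^ i * XX N y ^ j)"
    using assms(2) unfolding poly_bdd_def by blast
  show ?thesis
  proof (rule poly_bddI[of "C + D" _ "k + l"])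
    fix N y :: nat assume Ny: "N \<ge> 16" "y \<ge> 1"
    note b = hX_facts[OF Ny]
    have "C * (1 + XX N y) ^ k * (hh N ^ i * XX N y ^ j) \<le> C * (1 + XX N y) ^ (k + l) * (hh N ^ i * XX N y ^ j)"
      using C(1) b by (intro mult_right_mono mult_left_mono power_increasing) auto
    moreover have "D * (1 + XX N y) ^ l * (hh N ^ i * XX N y ^ j) \<le> D * (1 + XX N y) ^ (k + l) * (hh N ^ i * XX N y ^ j)"
      using D(1) b by (intro mult_right_mono mult_left_mono power_increasing) auto
    ultimately show "\<bar>f N y + g N y\<bar> \<le> (C + D) * (1 + XX N y) ^ (k + l) * (hh N ^ i * XX N y ^ j)"
      using C(2)[OF Ny] D(2)[OF Ny] by (simp add: distrib_right)
  qed (use C D in auto)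
qed

lemma rapid_bdd_add:
  assumes "rapid_bdd i j f" "rapid_bdd i j g"
  shows "rapid_bdd i j (\<lambda>N y. f N y + g N y)"
  unfolding rapid_bdd_def
proof
  fix k
  obtain C where C: "C \<ge> 0" "\<And>N y. N \<ge> 16 \<Longrightarrow> y \<ge> 1 \<Longrightarrow> \<bar>f N y\<bar> * (1 + XX N y) ^ k \<le> C * (hh N ^ i * XX N y ^ j)"
    using assms(1) unfolding rapid_bdd_def by blast
  obtain D where D: "D \<ge> 0" "\<And>N y. N \<ge> 16 \<Longrightarrow> y \<ge> 1 \<Longrightarrow> \<bar>g N y\<bar> * (1 + XX N y) ^ k \<le> D * (hh N ^ i * XX N y ^ j)"
    using assms(2) unfolding rapid_bdd_def by blast
  have "\<bar>f N y + g N y\<bar> * (1 + XX N y) ^ k \<le> (C + D) * (hh N ^ i * XX N y ^ j)" if Ny: "N \<ge> 16" "y \<ge> 1" for N y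
  proof -
    have "\<bar>f N y + g N y\<bar> * (1 + XX N y) ^ k \<le> (\<bar>f N y\<bar> + \<bar>g N y\<bar>) * (1 + XX N y) ^ k"
      using hX_facts[OF Ny] by (intro mult_right_mono) auto
    also have "\<dots> \<le> (C + D) * (hh N ^ i * XX N y ^ j)"
      using C(2)[OF Ny] D(2)[OF Ny] by (simp add: distrib_right)
    finally show ?thesis .
  qed
  then show "\<exists>C\<ge>0. \<forall>N\<ge>16. \<forall>y\<ge>1. \<bar>f N y + g N y\<bar> * (1 + XX N y) ^ k \<le> C * (hh N ^ i * XX N y ^ j)"
    using C(1) D(1) by (intro exI[of _ "C + D"]) auto
qed

lemma poly_bdd_const: "poly_bdd 0 0 (\<lambda>N y. c)"
  by (rule poly_bddI[of "\<bar>c\<bar>" _ 0]) auto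

lemma poly_bdd_h: "poly_bdd 1 0 (\<lambda>N y. hh N)"
  by (rule poly_bddI[of 1 _ 0]) (auto simp: hh_def)

lemma poly_bdd_X: "poly_bdd 0 1 (\<lambda>N y. XX N y)"
  by (rule poly_bddI[of 1 _ 0]) (auto simp: XX_def hh_def)

lemma poly_bdd_cmult: "poly_bdd i j f \<Longrightarrow> poly_bdd i j (\<lambda>N y. c * f N y)"
  using poly_bdd_mult[OF poly_bdd_const, of i j f c] by simp

lemma rapid_bdd_cmult: "rapid_bdd i j f \<Longrightarrow> rapid_bdd i j (\<lambda>N y. c * f N y)"
  using rapid_bdd_mult[OF poly_bdd_const, of i j f c] by simp

lemma poly_bdd_diff: "poly_bdd i j f \<Longrightarrow> poly_bdd i j g \<Longrightarrow> poly_bdd i j (\<lambda>N y. f N y - g N y)"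
  using poly_bdd_add[of i j f "\<lambda>N y. (-1) * g N y"] poly_bdd_cmult[of i j g "-1"] by simp

lemma rapid_bdd_diff: "rapid_bdd i j f \<Longrightarrow> rapid_bdd i j g \<Longrightarrow> rapid_bdd i j (\<lambda>N y. f N y - g N y)"
  using rapid_bdd_add[of i j f "\<lambda>N y. (-1) * g N y"] rapid_bdd_cmult[of i j g "-1"] by simp

lemma poly_bdd_h_power: "poly_bdd n 0 (\<lambda>N y. hh N ^ n)"
  by (rule poly_bddI[of 1 _ 0]) (auto simp: hh_def)

lemma poly_bdd0_h: "poly_bdd 0 0 (\<lambda>N y. hh N)" by (rule poly_bdd_weaken[OF poly_bdd_h]) auto
lemma poly_bdd0_X: "poly_bdd 0 0 (\<lambda>N y. XX N y)" by (rule poly_bdd_weaken[OF poly_bdd_X]) auto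
lemma poly_bdd0_mult: "poly_bdd 0 0 f \<Longrightarrow> poly_bdd 0 0 g \<Longrightarrow> poly_bdd 0 0 (\<lambda>N y. f N y * g N y)"
  using poly_bdd_mult[of 0 0 f 0 0 g] by simp
lemma poly_bdd0_power: "poly_bdd 0 0 f \<Longrightarrow> poly_bdd 0 0 (\<lambda>N y. f N y ^ n)"
  by (induction n) (auto intro: poly_bdd_const poly_bdd0_mult)

lemmas poly_bdd0_intros = poly_bdd_const poly_bdd0_h poly_bdd0_X poly_bdd0_power poly_bdd0_mult poly_bdd_add poly_bdd_diff

lemma rapid_bddD:
  assumes "rapid_bdd i j f"
  obtains C where "C \<ge> 0" "\<And>N y. N \<ge> 16 \<Longrightarrow> y \<ge> 1 \<Longrightarrow> \<bar>f N y\<bar> * (1 + XX N y) ^ k \<le> C * (hh N ^ i * XX N y ^ j)"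
  using assms unfolding rapid_bdd_def by blast

section \<open>Rapidly decreasing functions of one variable and Taylor expansion\<close>

definition rapid :: "(real \<Rightarrow> real) \<Rightarrow> bool" where
  "rapid f \<longleftrightarrow> (\<forall>k. \<exists>C\<ge>0. \<forall>\<xi>\<ge>0. \<bar>f \<xi>\<bar> * (1 + \<xi>) ^ k \<le> C)"

lemma rapid_add: "rapid f \<Longrightarrow> rapid g \<Longrightarrow> rapid (\<lambda>\<xi>. f \<xi> + g \<xi>)"
  unfolding rapid_def
proof
  fix k assume "\<forall>k. \<exists>C\<ge>0. \<forall>\<xi>\<ge>0. \<bar>f \<xi>\<bar> * (1 + \<xi>) ^ k \<le> C" "\<forall>k. \<exists>C\<ge>0. \<forall>\<xi>\<ge>0. \<bar>g \<xi>\<bar> * (1 + \<xi>) ^ k \<le> C"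
  then obtain C D where C: "C \<ge> 0" "\<And>\<xi>. \<xi> \<ge> 0 \<Longrightarrow> \<bar>f \<xi>\<bar> * (1 + \<xi>) ^ k \<le> C"
    and D: "D \<ge> 0" "\<And>\<xi>. \<xi> \<ge> 0 \<Longrightarrow> \<bar>g \<xi>\<bar> * (1 + \<xi>) ^ k \<le> D" by metis
  have "\<bar>f \<xi> + g \<xi>\<bar> * (1 + \<xi>) ^ k \<le> C + D" if "\<xi> \<ge> 0" for \<xi>
  proof -
    have "\<bar>f \<xi> + g \<xi>\<bar> * (1 + \<xi>) ^ k \<le> (\<bar>f \<xi>\<bar> + \<bar>g \<xi>\<bar>) * (1 + \<xi>) ^ k"
      using that by (intro mult_right_mono) auto
    then show ?thesis using C(2)[OF that] D(2)[OF that] by (simp add: distrib_right)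
  qed
  then show "\<exists>C\<ge>0. \<forall>\<xi>\<ge>0. \<bar>f \<xi> + g \<xi>\<bar> * (1 + \<xi>) ^ k \<le> C" using C D by (intro exI[of _ "C + D"]) auto
qed

lemma rapid_linear_mult: 
  assumes "rapid f" shows "rapid (\<lambda>\<xi>. (p + q * \<xi>) * f \<xi>)"
  unfolding rapid_def
proof
  fix k obtain C where C: "C \<ge> 0" "\<And>\<xi>. \<xi> \<ge> 0 \<Longrightarrow> \<bar>f \<xi>\<bar> * (1 + \<xi>) ^ (Suc k) \<le> C"
    using assms unfolding rapid_def by metis
  have "\<bar>(p + q * \<xi>) * f \<xi>\<bar> * (1 + \<xi>) ^ k \<le> (\<bar>p\<bar> + \<bar>q\<bar>) * C" if "\<xi> \<ge> 0" for \<xi>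
  proof -
    have "\<bar>p + q * \<xi>\<bar> \<le> \<bar>p\<bar> * 1 + \<bar>q\<bar> * \<xi>" using that by (simp add: abs_mult order_trans[OF abs_triangle_ineq])
    also have "\<dots> \<le> \<bar>p\<bar> * (1 + \<xi>) + \<bar>q\<bar> * (1 + \<xi>)" using that by (intro add_mono mult_left_mono) auto
    finally have "\<bar>p + q * \<xi>\<bar> * (\<bar>f \<xi>\<bar> * (1 + \<xi>) ^ k) \<le> ((\<bar>p\<bar> + \<bar>q\<bar>) * (1 + \<xi>)) * (\<bar>f \<xi>\<bar> * (1 + \<xi>) ^ k)"
      using that by (intro mult_right_mono) (auto simp: distrib_right)
    also have "\<dots> = (\<bar>p\<bar> + \<bar>q\<bar>) * (\<bar>f \<xi>\<bar> * (1 + \<xi>) ^ (Suc k))" by (simp add: mult_ac)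
    also have "\<dots> \<le> (\<bar>p\<bar> + \<bar>q\<bar>) * C" using C(2)[OF that] by (intro mult_left_mono) auto
    finally show ?thesis by (simp add: abs_mult mult_ac)
  qed
  then show "\<exists>C\<ge>0. \<forall>\<xi>\<ge>0. \<bar>(p + q * \<xi>) * f \<xi>\<bar> * (1 + \<xi>) ^ k \<le> C"
    using C by (intro exI[of _ "(\<bar>p\<bar> + \<bar>q\<bar>) * C"]) auto
qed

lemma rapid_exp_bound:
  assumes "\<exists>C. \<forall>x\<ge>0. \<bar>f x\<bar> \<le> C * exp (- x)"
  shows "rapid f"
  unfolding rapid_def
proof
  fix k :: nat
  obtain C where C: "\<And>x. x \<ge> 0 \<Longrightarrow> \<bar>f x\<bar> \<le> C * exp (- x)" using assms by blast
  have C0: "C \<ge> 0" using C[of 0] by simp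
  \<comment> \<open>Taking \<open>Suc k\<close> instead of \<open>k\<close> keeps the divisor in
    \<open>(1 + x / n)^n <= exp x\<close> nonzero.\<close>
  define n where "n = Suc k"
  have b: "(1 + \<xi>) ^ k \<le> real n ^ n * exp \<xi>" if "\<xi> \<ge> 0" for \<xi>
  proof -
    have "(1 + \<xi>) ^ k \<le> (1 + \<xi>) ^ n" using that by (intro power_increasing) (auto simp: n_def)
    also have "\<dots> \<le> (real n * (1 + \<xi> / real n)) ^ n" using that by (intro power_mono) (auto simp: n_def field_simps)
    also have "\<dots> = real n ^ n * (1 + \<xi> / real n) ^ n" by (rule power_mult_distrib)
    also have "\<dots> \<le> real n ^ n * exp \<xi>"
      using that by (intro mult_left_mono exp_ge_one_plus_x_over_n_power_n) (auto simp: n_def)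
    finally show ?thesis .
  qed
  have "\<bar>f \<xi>\<bar> * (1 + \<xi>) ^ k \<le> C * real n ^ n" if "\<xi> \<ge> 0" for \<xi>
  proof -
    have "\<bar>f \<xi>\<bar> * (1 + \<xi>) ^ k \<le> (C * exp (- \<xi>)) * (real n ^ n * exp \<xi>)"
      using that C0 by (intro mult_mono C b) auto
    then show ?thesis by (simp add: exp_minus field_simps)
  qed
  then show "\<exists>C\<ge>0. \<forall>\<xi>\<ge>0. \<bar>f \<xi>\<bar> * (1 + \<xi>) ^ k \<le> C" using C0 by (intro exI[of _ "C * real n ^ n"]) auto
qed

text \<open>The condition \<open>XX N y <= 2 * u N y + 1\<close> lets a polynomial weight in the
  scaled height be replaced by the same weight at \<open>u N y\<close>, at the price of
  \<open>2^k\<close>.\<close>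

lemma rapid_bdd_compose:
  assumes "rapid f" "\<And>N y. N \<ge> 16 \<Longrightarrow> y \<ge> 1 \<Longrightarrow> u N y \<ge> 0 \<and> XX N y \<le> 2 * u N y + 1"
  shows "rapid_bdd 0 0 (\<lambda>N y. f (u N y))"
  unfolding rapid_bdd_def
proof
  fix k obtain C where C: "C \<ge> 0" "\<And>\<xi>. \<xi> \<ge> 0 \<Longrightarrow> \<bar>f \<xi>\<bar> * (1 + \<xi>) ^ k \<le> C"
    using assms unfolding rapid_def by metis
  have "\<bar>f (u N y)\<bar> * (1 + XX N y) ^ k \<le> C * 2 ^ k" if Ny: "N \<ge> 16" "y \<ge> 1" for N y
  proof -
    have "(1 + XX N y) ^ k \<le> (2 * (1 + u N y)) ^ k"
      using assms(2)[OF Ny] hX_facts[OF Ny] by (intro power_mono) auto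
    then have "\<bar>f (u N y)\<bar> * (1 + XX N y) ^ k \<le> \<bar>f (u N y)\<bar> * (2 * (1 + u N y)) ^ k" by (intro mult_left_mono) auto
    also have "\<dots> = (\<bar>f (u N y)\<bar> * (1 + u N y) ^ k) * 2 ^ k" by (simp only: power_mult_distrib mult_ac)
    also have "\<dots> \<le> C * 2 ^ k" using C(2) assms(2)[OF Ny] by (intro mult_right_mono) auto
    finally show ?thesis .
  qed
  then show "\<exists>C\<ge>0. \<forall>N\<ge>16. \<forall>y\<ge>1. \<bar>f (u N y)\<bar> * (1 + XX N y) ^ k \<le> C * (hh N ^ 0 * XX N y ^ 0)"
    using C(1) by (intro exI[of _ "C * 2 ^ k"]) auto
qed

text \<open>Lagrange's form of the remainder is evaluated at a point between \<open>u N y\<close>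
  and \<open>XX N y\<close>. That point inherits the comparability with \<open>XX N y\<close>, so
  the derivative of order \<open>n\<close> is still rapidly decreasing there.\<close>

lemma rapid_bdd_taylor:
  fixes D :: "nat \<Rightarrow> real \<Rightarrow> real"
  assumes n: "n > 0" and D: "\<And>m t. m < n \<Longrightarrow> DERIV (D m) t :> D (Suc m) t"
    and r: "rapid (D n)" and u: "poly_bdd i j (\<lambda>N y. u N y - XX N y)"
    and uX: "\<And>N y. N \<ge> 16 \<Longrightarrow> y \<ge> 1 \<Longrightarrow> u N y \<ge> 0 \<and> XX N y \<le> 2 * u N y + 1"
  shows "rapid_bdd (n * i) (n * j) (\<lambda>N y. D 0 (u N y) - (\<Sum>m<n. D m (XX N y) / fact m * (u N y - XX N y) ^ m))"
proof -
  define Q where "Q = (\<lambda>N y t. t \<ge> 0 \<and> XX N y \<le> 2 * t + 1 \<and>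
     D 0 (u N y) - (\<Sum>m<n. D m (XX N y) / fact m * (u N y - XX N y) ^ m) = (u N y - XX N y) ^ n * (D n t / fact n))"
  have ex: "\<exists>t. Q N y t"     if Ny: "N \<ge> 16" "y \<ge> 1" for N y
  proof (cases "u N y = XX N y")
    case True
    have "(\<Sum>m<n. D m (XX N y) / fact m * (0::real) ^ m) = D 0 (XX N y)"
    proof -
      have "(\<Sum>m<n. D m (XX N y) / fact m * (0::real) ^ m) = (\<Sum>m\<in>{0}. D m (XX N y) / fact m * (0::real) ^ m)"
        using n by (intro sum.mono_neutral_right) auto
      then show ?thesis by simp
    qed
    then show ?thesis using True n hX_facts[OF Ny] by (intro exI[of _ "XX N y"]) (auto simp: Q_def)
  next
    case False
    have "\<exists>t. (if u N y < XX N y then u N y < t \<and> t < XX N y else XX N y < t \<and> t < u N y) \<and>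
      D 0 (u N y) = (\<Sum>m<n. (D m (XX N y) / fact m) * (u N y - XX N y) ^ m) + (D n t / fact n) * (u N y - XX N y) ^ n"
      by (rule Taylor[of n D "D 0" "min (u N y) (XX N y)" "max (u N y) (XX N y)"]) (use n D False in auto)
    then obtain t where t: "if u N y < XX N y then u N y < t \<and> t < XX N y else XX N y < t \<and> t < u N y"
      "D 0 (u N y) = (\<Sum>m<n. (D m (XX N y) / fact m) * (u N y - XX N y) ^ m) + (D n t / fact n) * (u N y - XX N y) ^ n"
      by blast
    then show ?thesis using uX[OF Ny] hX_facts[OF Ny] by (intro exI[of _ t]) (auto simp: Q_def split: if_splits)
  qed
  \<comment> \<open>Only the position of the intermediate point matters, so an arbitrary choice for
    each \<open>N\<close> and \<open>y\<close> will do.\<close>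
  define t where "t = (\<lambda>N y. SOME t. Q N y t)"
  have t: "Q N y (t N y)" if "N \<ge> 16" "y \<ge> 1" for N y
    unfolding t_def using ex[OF that] by (rule someI_ex)
  have pw: "poly_bdd (m * i) (m * j) (\<lambda>N y. (u N y - XX N y) ^ m)" for m
  proof (induction m)
    case 0 then show ?case using poly_bdd_const[of 1] by simp
  next
    case (Suc m) show ?case using poly_bdd_mult[OF u Suc] by simp
  qed
  have "rapid_bdd 0 0 (\<lambda>N y. D n (t N y))" by (rule rapid_bdd_compose[OF r]) (use t in \<open>auto simp: Q_def\<close>)
  then have "rapid_bdd 0 0 (\<lambda>N y. (1 / fact n) * D n (t N y))" by (rule rapid_bdd_cmult)
  from rapid_bdd_mult[OF pw this, of n]
  have "rapid_bdd (n * i) (n * j) (\<lambda>N y. (u N y - XX N y) ^ n * (D n (t N y) / fact n))" by simp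
  then show ?thesis by (subst rapid_bdd_cong[OF t[unfolded Q_def, THEN conjunct2, THEN conjunct2]])
qed

section \<open>Expansion of the recurrence\<close>

lemma hh_N: "N > 0 \<Longrightarrow> real N = 2 / hh N ^ 3"
  using hh_cube[of N] by simp

text \<open>The polynomial correction \<open>1 - 2y\<^sup>2 / (3N) + \<mu>y / N\<close> with \<open>\<mu> = 11/6 - e/4\<close>: the quadratic coefficient cancels
  the terms \<open>h\<^sup>3 x A'(x)\<close> and the linear one the terms \<open>h\<^sup>4 A'(x)\<close> in the expansion of the recurrence.\<close>
definition Pol :: "real \<Rightarrow> real \<Rightarrow> real \<Rightarrow> real" where
  "Pol e h x = 1 - h * x ^ 2 / 3 + (11/12 - e/8) * h ^ 2 * x"

text \<open>At time \<open>N = l + 2 * j + 1\<close> and height \<open>y = l + 1\<close> this is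
  \<open>(j + 2) / (l + j + 1)\<close>: the weight of a step that appends a leaf, divided by a
  quotient of factorials.\<close>

definition alpha :: "nat \<Rightarrow> nat \<Rightarrow> real" where
  "alpha N y = (real N + 4 - real y) / (real N + real y)"

text \<open>With \<open>u = 1/N\<close> the cube of the ratio is \<open>1 / (1 + u)\<close>.
  Dividing \<open>1 - \<rho>^3\<close> by \<open>1 + \<rho> + \<rho>^2\<close>, which lies between
  \<open>3 - 3u\<close> and \<open>3\<close>, gives \<open>1 - \<rho> = u/3 + O(u^2)\<close>, and
  \<open>u/3 = h^3/6\<close>.\<close>

lemma hh_ratio_facts:
  assumes "N \<ge> 16"
  defines "\<rho> \<equiv> hh (Suc N) / hh N" and "h \<equiv> hh N"
  shows "0 < \<rho>" "\<rho> \<le> 1" "1/2 \<le> \<rho>" "\<bar>1 - \<rho>\<bar> \<le> h ^ 3" "\<bar>\<rho> - 1 + h ^ 3 / 6\<bar> \<le> h ^ 6" "\<bar>\<rho> ^ 3 - 1\<bar> \<le> h ^ 3"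
    "1 - \<rho> \<ge> 0"
proof -
  have h: "0 < h" "h \<le> 1/2" using hX_facts[of N 1] assms by auto
  show p: "0 < \<rho>" using hh_pos[of "Suc N"] h by (simp add: \<rho>_def h_def)
  define u where "u = h ^ 3 / 2"
  have u: "0 < u" "u \<le> 1/16"
  proof -
    show "0 < u" using h by (simp add: u_def)
    have "h ^ 3 \<le> (1/2) ^ 3" using h by (intro power_mono) auto
    then show "u \<le> 1/16" by (simp add: u_def power3_eq_cube)
  qed
  have N: "real N = 1 / u" using hh_N[of N] assms(1) by (simp add: u_def h_def)
  have "\<rho> ^ 3 = (2 / real (Suc N)) / (2 / real N)"
    unfolding \<rho>_def power_divide using hh_cube[of N] hh_cube[of "Suc N"] assms by simp
  also have "\<dots> = real N / (real N + 1)" using assms by (simp add: field_simps)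
  also have "\<dots> = 1 / (1 + u)" using u by (simp add: N field_simps)
  finally have r3: "\<rho> ^ 3 = 1 / (1 + u)" .
  then have r3': "1 - \<rho> ^ 3 = u / (1 + u)" using u by (simp add: field_simps)
  have "\<rho> ^ 3 \<le> 1 ^ 3" using r3 u by simp
  then show le1: "\<rho> \<le> 1" using p by (meson power_mono_iff less_imp_le zero_less_numeral zero_le_one)
  then show "1 - \<rho> \<ge> 0" by simp
  define s where "s = 1 + \<rho> + \<rho> ^ 2"
  have fac: "(1 - \<rho>) * s = u / (1 + u)" unfolding r3'[symmetric] s_def by (simp add: algebra_simps power2_eq_square power3_eq_cube)
  have s: "1 \<le> s" "s \<le> 3" using p le1 by - (use power_le_one[of \<rho> 2] in \<open>auto simp: s_def\<close>)
  have uu: "u / (1 + u) \<le> u" "u / (1 + u) \<ge> u - u ^ 2" using u by (auto simp: field_simps power2_eq_square power3_eq_cube)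
  have b1: "1 - \<rho> \<le> u"
  proof -
    have "1 - \<rho> \<le> (1 - \<rho>) * s" using s le1 mult_left_mono[of 1 s "1 - \<rho>"] by simp
    also note fac
    also note uu(1)
    finally show ?thesis .
  qed
  then show "1/2 \<le> \<rho>" using u by simp
  show "\<bar>1 - \<rho>\<bar> \<le> h ^ 3" using b1 le1 u by (simp add: u_def)
  have h6: "h ^ 6 = 4 * u ^ 2" by (simp add: u_def power_divide flip: power_mult)
  have lo: "1 - \<rho> \<ge> (u - u ^ 2) / 3"
  proof -
    have "(1 - \<rho>) * s \<le> (1 - \<rho>) * 3" using s le1 by (intro mult_left_mono) auto
    then have "u - u ^ 2 \<le> (1 - \<rho>) * 3" unfolding fac by (rule order_trans[OF uu(2)])
    then show ?thesis by simp
  qed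
  have hi: "1 - \<rho> \<le> u / 3 + u ^ 2"
  proof -
    have s3: "s \<ge> 3 - 3 * u"
    proof -
      have "(1 - u) ^ 2 \<le> \<rho> ^ 2" using b1 u by (intro power_mono) auto
      moreover have "1 - 2 * u \<le> (1 - u) ^ 2" by (simp add: power2_eq_square algebra_simps)
      ultimately show ?thesis using b1 by (simp add: s_def)
    qed
    have "(1 - \<rho>) * (3 - 3 * u) \<le> (1 - \<rho>) * s" using s3 le1 by (intro mult_left_mono) auto
    then have "(1 - \<rho>) * (3 - 3 * u) \<le> u" unfolding fac by (rule order_trans[OF _ uu(1)])
    then have "3 * (1 - \<rho>) \<le> u + 3 * (u * (1 - \<rho>))" by (simp add: algebra_simps)
    also have "u * (1 - \<rho>) \<le> u * u" using b1 u by (intro mult_left_mono) auto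
    finally show ?thesis by (simp add: power2_eq_square)
  qed
  show "\<bar>\<rho> - 1 + h ^ 3 / 6\<bar> \<le> h ^ 6"
    using lo hi zero_le_power2[of u] unfolding h6 by (simp add: u_def abs_le_iff)
  have "\<bar>\<rho> ^ 3 - 1\<bar> = u / (1 + u)" unfolding r3'[symmetric] using \<open>\<rho> ^ 3 \<le> 1 ^ 3\<close> by simp
  also note uu(1)
  also have "u \<le> h ^ 3" using u by (simp add: u_def)
  finally show "\<bar>\<rho> ^ 3 - 1\<bar> \<le> h ^ 3" .
qed

lemma hh_ratio2_facts:
  assumes "N \<ge> 16"
  defines "\<rho> \<equiv> hh (N - 2) / hh N" and "h \<equiv> hh N"
  shows "1 \<le> \<rho>" "\<rho> \<le> 2" "\<bar>\<rho> - 1\<bar> \<le> 2 * h ^ 3"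
proof -
  have h: "0 < h" "h \<le> 1/2" using hX_facts[of N 1] assms by auto
  have p: "0 < \<rho>" using hh_pos[of "N - 2"] h assms by (simp add: \<rho>_def h_def)
  define u where "u = h ^ 3"
  have u: "0 < u" "u \<le> 1/8"
  proof -
    show "0 < u" using h by (simp add: u_def)
    have "h ^ 3 \<le> (1/2) ^ 3" using h by (intro power_mono) auto
    then show "u \<le> 1/8" by (simp add: u_def power3_eq_cube)
  qed
  have N: "real N = 2 / u" using hh_N[of N] assms(1) by (simp add: u_def h_def)
  have "\<rho> ^ 3 = (2 / real (N - 2)) / (2 / real N)"
    unfolding \<rho>_def power_divide using hh_cube[of N] hh_cube[of "N - 2"] assms by simp
  also have "\<dots> = real N / (real N - 2)" using assms by (simp add: field_simps of_nat_diff)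
  also have "\<dots> = 1 / (1 - u)" using u unfolding N by (simp add: field_simps)
  finally have r3: "\<rho> ^ 3 = 1 / (1 - u)" .
  then have r3': "\<rho> ^ 3 - 1 = u / (1 - u)" using u by (simp add: field_simps)
  show ge1: "1 \<le> \<rho>"
  proof (rule ccontr)
    assume "\<not> 1 \<le> \<rho>"
    then have "\<rho> ^ 3 < 1" using p by (intro power_less_one_iff[THEN iffD2]) auto
    moreover have "u / (1 - u) > 0" using u by simp
    ultimately show False using r3' by simp
  qed
  have fac: "(\<rho> - 1) * (1 + \<rho> + \<rho> ^ 2) = u / (1 - u)" unfolding r3'[symmetric]
    by (simp add: algebra_simps power2_eq_square power3_eq_cube)
  have uu: "u / (1 - u) \<le> 2 * u" using u by (simp add: field_simps power2_eq_square)
  have "\<rho> - 1 \<le> (\<rho> - 1) * (1 + \<rho> + \<rho> ^ 2)"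
    using ge1 mult_left_mono[of 1 "1 + \<rho> + \<rho> ^ 2" "\<rho> - 1"] by simp
  also note fac
  also note uu
  finally have b: "\<rho> - 1 \<le> 2 * u" .
  then show "\<bar>\<rho> - 1\<bar> \<le> 2 * h ^ 3" "\<rho> \<le> 2" using ge1 u by (auto simp: u_def)
qed

lemma poly_bdd_rho: "poly_bdd 3 0 (\<lambda>N y. hh (Suc N) / hh N - 1)"
  by (rule poly_bddI[of 1 _ 0]) (use hh_ratio_facts(4) in \<open>auto simp: abs_minus_commute\<close>)

lemma poly_bdd_rho_expansion: "poly_bdd 6 0 (\<lambda>N y. hh (Suc N) / hh N - 1 + hh N ^ 3 / 6)"
  by (rule poly_bddI[of 1 _ 0]) (use hh_ratio_facts(5) in auto)

lemma poly_bdd_rho_cube: "poly_bdd 3 0 (\<lambda>N y. (hh (Suc N) / hh N) ^ 3 - 1)"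
  by (rule poly_bddI[of 1 _ 0]) (use hh_ratio_facts(6) in auto)

lemma poly_bdd_rho2: "poly_bdd 3 0 (\<lambda>N y. hh (N - 2) / hh N - 1)"
  by (rule poly_bddI[of 2 _ 0]) (use hh_ratio2_facts(3) in auto)

lemma alpha_expansion:
  assumes "N \<ge> 16" "y \<ge> 1"
  defines "h \<equiv> hh N" and "x \<equiv> XX N y"
  shows "1 - alpha N y = (h ^ 2 * x - 2 * h ^ 3) / (1 + h ^ 2 * x / 2)"
proof -
  have h: "0 < h" using hX_facts[of N y] assms by auto
  have N: "real N = 2 / h ^ 3" using hh_N[of N] assms(1) by (simp add: h_def)
  have y: "real y = x / h" using h by (simp add: x_def XX_def h_def)
  have pos: "real N + real y > 0" using assms by simp
  have "1 - alpha N y = (2 * real y - 4) / (real N + real y)"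
    unfolding alpha_def using pos by (simp add: field_simps)
  also have "\<dots> = ((2 * real y - 4) * (h ^ 3 / 2)) / ((real N + real y) * (h ^ 3 / 2))"
    using h by simp
  also have "(2 * real y - 4) * (h ^ 3 / 2) = h ^ 2 * x - 2 * h ^ 3"
    using h by (simp add: y field_simps power2_eq_square power3_eq_cube)
  also have "(real N + real y) * (h ^ 3 / 2) = 1 + h ^ 2 * x / 2"
    using h by (simp add: y N field_simps power2_eq_square power3_eq_cube)
  finally show ?thesis .
qed

text \<open>The exact value of \<open>1 - alpha N y\<close> is \<open>c / (1 + v)\<close> with
  \<open>c = h^2 x - 2 h^3\<close> and \<open>v = h^2 x / 2\<close>, so the error is at most
  \<open>|c| v\<close>, of order \<open>h^4 x^2\<close>; one factor \<open>x\<close> goes into the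
  polynomial allowance.\<close>

lemma poly_bdd_alpha: "poly_bdd 4 1 (\<lambda>N y. (1 - alpha N y) - (hh N ^ 2 * XX N y - 2 * hh N ^ 3))"
proof (rule poly_bddI[of 2 _ 1])
  fix N y :: nat assume Ny: "N \<ge> 16" "y \<ge> 1"
  define h where "h = hh N"
  define x where "x = XX N y"
  have b: "0 < h" "h \<le> 1" "h \<le> x" "0 < x" using hX_facts[OF Ny] by (auto simp: h_def x_def)
  define c where "c = h ^ 2 * x - 2 * h ^ 3"
  define v where "v = h ^ 2 * x / 2"
  have v: "v > 0" using b by (simp add: v_def)
  have "h ^ 3 \<le> h ^ 2 * x" using b by (simp add: power2_eq_square power3_eq_cube)
  then have c: "\<bar>c\<bar> \<le> 2 * (h ^ 2 * x)" unfolding c_def abs_le_iff using b zero_le_power[of h 3] by linarith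
  have "(1 - alpha N y) - c = c / (1 + v) - c"
    using alpha_expansion[OF Ny] by (simp add: h_def x_def c_def v_def)
  also have "\<dots> = - (c * v / (1 + v))" using v by (simp add: field_simps)
  finally have "\<bar>(1 - alpha N y) - c\<bar> = \<bar>c\<bar> * v / (1 + v)" using v by (simp add: abs_mult)
  also have "\<dots> \<le> \<bar>c\<bar> * v" using v divide_left_mono[of 1 "1 + v" "\<bar>c\<bar> * v"] by simp
  also have "\<dots> \<le> (2 * (h ^ 2 * x)) * v" using c v by (intro mult_right_mono) auto
  also have "\<dots> = 1 * x * (h ^ 4 * x)" by (simp add: v_def power2_eq_square power4_eq_xxxx)
  also have "\<dots> \<le> 2 * (1 + x) ^ 1 * (h ^ 4 * x)" using b by (intro mult_right_mono) auto
  finally show "\<bar>(1 - alpha N y) - (hh N ^ 2 * XX N y - 2 * hh N ^ 3)\<bar> \<le> 2 * (1 + XX N y) ^ 1 * (hh N ^ 4 * XX N y ^ 1)"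
    by (simp add: c_def h_def x_def)
qed simp

lemma poly_bdd_Pol_minus_1: "poly_bdd 1 1 (\<lambda>N y. Pol e (hh N) (XX N y) - 1)"
proof -
  have i: "poly_bdd 0 0 (\<lambda>N y. (11/12 - e/8) * hh N - (1/3) * XX N y)" by (intro poly_bdd0_intros)
  have "poly_bdd 1 1 (\<lambda>N y. hh N * XX N y * ((11/12 - e/8) * hh N - (1/3) * XX N y))"
    using poly_bdd_mult[OF poly_bdd_mult[OF poly_bdd_h poly_bdd_X] i] by simp
  then show ?thesis by (simp add: Pol_def algebra_simps power2_eq_square)
qed

section \<open>The profile and its residual\<close>

context airy_shift
begin

lemma rapid_A: "rapid A" using A_decay by (intro rapid_exp_bound) meson
lemma rapid_A': "rapid A'" using A_decay by (intro rapid_exp_bound) meson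
lemma rapid_zA: "rapid f \<Longrightarrow> rapid (\<lambda>x. (a + x) * f x)"
  using rapid_linear_mult[of f a 1] by simp

lemma rapid_cmult: "rapid f \<Longrightarrow> rapid (\<lambda>x. c * f x)"
  using rapid_linear_mult[of f c 0] by simp

text \<open>The zero of \<open>A\<close> at the origin supplies the factor \<open>x\<close>: for
  \<open>x < 1\<close> by the mean value theorem, while for \<open>x >= 1\<close> the factor only
  weakens the bound.\<close>

lemma rapid_bdd_A: "rapid_bdd 0 1 (\<lambda>N y. A (XX N y))"
  unfolding rapid_bdd_def
proof
  fix k
  obtain C where C: "C \<ge> 0" "\<And>\<xi>. \<xi> \<ge> 0 \<Longrightarrow> \<bar>A \<xi>\<bar> * (1 + \<xi>) ^ k \<le> C" using rapid_A unfolding rapid_def by meson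
  obtain B where B: "B \<ge> 0" "\<And>\<xi>. \<xi> \<ge> 0 \<Longrightarrow> \<bar>A' \<xi>\<bar> * (1 + \<xi>) ^ 0 \<le> B" using rapid_A' unfolding rapid_def by meson
  have "\<bar>A x\<bar> * (1 + x) ^ k \<le> (C + B * 2 ^ k) * x" if x: "x > 0" for x
  proof (cases "x \<ge> 1")
    case True
    have "\<bar>A x\<bar> * (1 + x) ^ k \<le> C * x" using C(2)[of x] x C(1) True by (intro order_trans[OF C(2)]) (auto simp: mult_le_cancel_left1)
    also have "\<dots> \<le> (C + B * 2 ^ k) * x" using x B by (intro mult_right_mono) auto
    finally show ?thesis .
  next
    case False
    obtain z where z: "0 < z" "z < x" "A x - A 0 = (x - 0) * A' z" using MVT2[OF x, of A A'] DA by blast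
    then have "\<bar>A x\<bar> \<le> x * B" using B(2)[of z] x by (simp add: A_0 abs_mult)
    moreover have "(1 + x) ^ k \<le> 2 ^ k" using False x by (intro power_mono) auto
    ultimately have "\<bar>A x\<bar> * (1 + x) ^ k \<le> (x * B) * 2 ^ k" using x B by (intro mult_mono) auto
    also have "\<dots> \<le> (C + B * 2 ^ k) * x" using x C by (simp add: algebra_simps)
    finally show ?thesis .
  qed
  then show "\<exists>C\<ge>0. \<forall>N\<ge>16. \<forall>y\<ge>1. \<bar>A (XX N y)\<bar> * (1 + XX N y) ^ k \<le> C * (hh N ^ 0 * XX N y ^ 1)"
    using B C hX_facts by (intro exI[of _ "C + B * 2 ^ k"]) auto
qed

lemma rapid_bdd_A': "rapid_bdd 0 0 (\<lambda>N y. A' (XX N y))"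
  by (rule rapid_bdd_compose[OF rapid_A']) (auto simp: XX_def hh_def)

text \<open>The derivatives of \<open>A\<close> up to order five, reduced to \<open>A\<close> and
  \<open>A'\<close> by \<open>A'' = (a + x) * A\<close>.\<close>

definition DD :: "nat \<Rightarrow> real \<Rightarrow> real" where
  "DD m x = [A x, A' x, (a + x) * A x, A x + (a + x) * A' x, 2 * A' x + (a + x) ^ 2 * A x,
     4 * ((a + x) * A x) + (a + x) * ((a + x) * A' x)] ! m"

lemma DA'_distrib: "(A' has_real_derivative a * A x + x * A x) (at x)"
  using DA'[of x] by (simp add: distrib_right)

lemma DD_deriv: "m < 5 \<Longrightarrow> DERIV (DD m) t :> DD (Suc m) t"
proof -
  assume "m < 5"
  then consider "m = 0" | "m = 1" | "m = 2" | "m = 3" | "m = 4" by linarith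
  then show ?thesis
    by cases (simp_all add: DD_def[abs_def] numeral_eq_Suc, (auto intro!: derivative_eq_intros DA DA' DA'_distrib simp: algebra_simps)+)
qed

lemma rapid_DD: "rapid (DD 2)" "rapid (DD 5)"
proof -
  show "rapid (DD 2)" using rapid_zA[OF rapid_A] by (simp add: DD_def[abs_def] numeral_eq_Suc)
  have "rapid (\<lambda>x. 4 * ((a + x) * A x) + (a + x) * ((a + x) * A' x))"
    by (intro rapid_add rapid_cmult rapid_zA rapid_A rapid_A')
  then show "rapid (DD 5)" by (simp add: DD_def[abs_def] numeral_eq_Suc)
qed

lemma rapid_bdd_A_taylor5:
  assumes "poly_bdd 1 0 (\<lambda>N y. u N y - XX N y)"
    and "\<And>N y. N \<ge> 16 \<Longrightarrow> y \<ge> 1 \<Longrightarrow> u N y \<ge> 0 \<and> XX N y \<le> 2 * u N y + 1"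
  shows "rapid_bdd 5 0 (\<lambda>N y. A (u N y) - (A (XX N y) + (u N y - XX N y) * A' (XX N y)
    + (u N y - XX N y) ^ 2 / 2 * ((a + XX N y) * A (XX N y))
    + (u N y - XX N y) ^ 3 / 6 * (A (XX N y) + (a + XX N y) * A' (XX N y))
    + (u N y - XX N y) ^ 4 / 24 * (2 * A' (XX N y) + (a + XX N y) ^ 2 * A (XX N y))))"
  using rapid_bdd_taylor[of 5 DD 1 0 u, OF _ DD_deriv rapid_DD(2) assms]
  by (simp add: DD_def eval_nat_numeral fact_Suc algebra_simps)

lemma rapid_bdd_A_taylor2:
  assumes "poly_bdd i j (\<lambda>N y. u N y - XX N y)"
    and "\<And>N y. N \<ge> 16 \<Longrightarrow> y \<ge> 1 \<Longrightarrow> u N y \<ge> 0 \<and> XX N y \<le> 2 * u N y + 1"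
  shows "rapid_bdd (2 * i) (2 * j) (\<lambda>N y. A (u N y) - (A (XX N y) + (u N y - XX N y) * A' (XX N y)))"
  using rapid_bdd_taylor[of 2 DD i j u, OF _ DD_deriv rapid_DD(1) assms]
  by (simp add: DD_def eval_nat_numeral algebra_simps)


definition profile :: "real \<Rightarrow> nat \<Rightarrow> nat \<Rightarrow> real" where
  "profile e N y = Pol e (hh N) (XX N y) * A (XX N y)"

definition S0 :: "real \<Rightarrow> real \<Rightarrow> real" where
  "S0 e h = 2 + a * h ^ 2 + (4/3 - e/4) * h ^ 3"

text \<open>The term two steps back appears with the leading value of its coefficient:
  \<open>betaq\<close> is about \<open>h^3\<close>, and the two growth factors in between multiply
  to about 4.\<close>

definition residual :: "real \<Rightarrow> nat \<Rightarrow> nat \<Rightarrow> real" where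
  "residual e N y = profile e N (y + 1) + alpha N y * profile e N (y - 1) - S0 e (hh N) * profile e (Suc N) y
     - e * hh N ^ 3 / 4 * profile e (N - 2) (y - 1)"

text \<open>All terms below order \<open>h\<^sup>4\<close> cancel, and those of order \<open>h\<^sup>4\<close> vanish at \<open>x = 0\<close>.\<close>
lemma main_polynomial:
  fixes h x e A1 B1 :: real
  defines "T \<equiv> \<lambda>s. A1 + s * B1 + s ^ 2 / 2 * ((a + x) * A1) + s ^ 3 / 6 * (A1 + (a + x) * B1)
     + s ^ 4 / 24 * (2 * B1 + (a + x) ^ 2 * A1)"
  shows "Pol e h (x + h) * T h + Pol e h (x - h) * T (- h)
    - (h ^ 2 * x - 2 * h ^ 3) * (Pol e h (x - h) * (A1 - h * B1))
    - S0 e h * (Pol e h x * (A1 - h ^ 3 / 6 * x * B1))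
    - e * h ^ 3 / 4 * (A1 - h * B1)
    = h ^ 4 * ((1/12)*a^2 + (1/6)*x*a + (-29/36)*x^2 + (-1/36)*h*x^2*a^2 + (-1/18)*h*x^3*a + (-1/36)*h*x^4 + (95/36)*h*x + (11/144)*h^2*x*a^2 + (11/72)*h^2*x^2*a + (11/144)*h^2*x^3 + (-1/3)*h*a + (-79/36)*h^2 + (-1/36)*h^3*a^2 + (-1/18)*h^3*x*a + (-1/36)*h^3*x^2 + (-1/96)*h^2*x*a^2*e + (-1/48)*h^2*x^2*a*e + (-1/96)*h^2*x^3*e + (5/24)*h^2*e + (1/48)*h*x*e + (-1/12)*x^2*e + (-1/32)*h*x*e^2) * A1
      + (h ^ 4 * x * ((41/18)*h*x + (-1/18)*h*a + (-269/72)*h^2 + (13/48)*h^2*e + (-4/9)*x^2 + (-1/6)*h*x*e + (-1/18)*h^2*x^2*a + (11/72)*h^3*x*a + (-1/48)*h^3*x*a*e + (-2/27)*h^3*x^2 + (11/54)*h^4*x + (-19/288)*h^4*x*e + (1/72)*h^3*x^2*e + (1/192)*h^4*x*e^2)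
       + h ^ 5 * ((11/36)*h*a + (22/9)*h^2 + (-1/24)*h*a*e + (-1/4)*h^2*e)) * B1"
  unfolding T_def Pol_def S0_def
  by (simp add: field_simps eval_nat_numeral)

text \<open>The shifts by \<open>h\<close> have coefficients near 1 and need the Taylor polynomial
  of degree four; its error \<open>h^5\<close> counts as \<open>h^4 x\<close> because
  \<open>h <= x\<close>. Linear approximation suffices for terms with a prefactor of order
  \<open>h^2 x\<close> or \<open>h^3\<close>, and for the passage to time \<open>N + 1\<close>,
  which shifts \<open>x\<close> only by order \<open>h^3 x\<close>. The rest is the exact identity
  \<open>main_polynomial\<close>.\<close>

lemma residual_bound: "rapid_bdd 4 1 (residual e)"
proof -
  define P where "P = (\<lambda>N y. Pol e (hh N) (XX N y))"
  define Pp where "Pp = (\<lambda>N y. Pol e (hh N) (XX N y + hh N))"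
  define Pm where "Pm = (\<lambda>N y. Pol e (hh N) (XX N y - hh N))"
  define u2 where "u2 = (\<lambda>N y. hh (N - 2) / hh N * (XX N y - hh N))"
  define u3 where "u3 = (\<lambda>N y. hh (Suc N) / hh N * XX N y)"
  define P2 where "P2 = (\<lambda>N y. Pol e (hh (N - 2)) (u2 N y))"
  define P3 where "P3 = (\<lambda>N y. Pol e (hh (Suc N)) (u3 N y))"
  define A1 where "A1 = (\<lambda>N y. A (XX N y))"
  define B1 where "B1 = (\<lambda>N y. A' (XX N y))"
  define T where "T = (\<lambda>s N y. A1 N y + s * B1 N y + s ^ 2 / 2 * ((a + XX N y) * A1 N y)
     + s ^ 3 / 6 * (A1 N y + (a + XX N y) * B1 N y) + s ^ 4 / 24 * (2 * B1 N y + (a + XX N y) ^ 2 * A1 N y))"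
  define r1 where "r1 = (\<lambda>N y. A (XX N y + hh N) - T (hh N) N y)"
  define r2 where "r2 = (\<lambda>N y. A (XX N y - hh N) - T (- hh N) N y)"
  define s2 where "s2 = (\<lambda>N y. A (XX N y - hh N) - (A1 N y - hh N * B1 N y))"
  define s3 where "s3 = (\<lambda>N y. A (u3 N y) - (A1 N y - hh N ^ 3 / 6 * XX N y * B1 N y))"
  define s4 where "s4 = (\<lambda>N y. A (u2 N y) - (A1 N y - hh N * B1 N y))"
  define c2 where "c2 = (\<lambda>N y. hh N ^ 2 * XX N y - 2 * hh N ^ 3)"
  define da where "da = (\<lambda>N y. (1 - alpha N y) - c2 N y)"
  define r3c where "r3c = (\<lambda>N y::nat. (hh (Suc N) / hh N) ^ 3 - 1)"
  have A1: "rapid_bdd 0 1 A1" unfolding A1_def by (rule rapid_bdd_A)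
  have B1: "rapid_bdd 0 0 B1" unfolding B1_def by (rule rapid_bdd_A')
  have Xh: "XX N y - hh N \<ge> 0 \<and> XX N y \<le> 2 * (XX N y - hh N) + 1" if "N \<ge> 16" "y \<ge> 1" for N y
    using hX_facts[OF that] by auto
  have Xh': "XX N y + hh N \<ge> 0 \<and> XX N y \<le> 2 * (XX N y + hh N) + 1" if "N \<ge> 16" "y \<ge> 1" for N y
    using hX_facts[OF that] by auto
  have u2: "u2 N y \<ge> 0 \<and> XX N y \<le> 2 * u2 N y + 1" if "N \<ge> 16" "y \<ge> 1" for N y
  proof -
    have "1 * (XX N y - hh N) \<le> u2 N y" unfolding u2_def
      using hh_ratio2_facts(1)[OF that(1)] Xh[OF that] by (intro mult_right_mono) auto
    then show ?thesis using Xh[OF that] by auto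
  qed
  have u3: "u3 N y \<ge> 0 \<and> XX N y \<le> 2 * u3 N y + 1" if "N \<ge> 16" "y \<ge> 1" for N y
  proof -
    have "1/2 * XX N y \<le> u3 N y" unfolding u3_def
      using hh_ratio_facts(3)[OF that(1)] hX_facts[OF that] by (intro mult_right_mono) auto
    then show ?thesis using hX_facts[OF that] by auto
  qed
  have pX0: "poly_bdd 0 0 (\<lambda>N y. XX N y)" by (rule poly_bdd0_X)
  have pP: "poly_bdd 0 0 P" "poly_bdd 0 0 Pp" "poly_bdd 0 0 Pm" "poly_bdd 0 0 (\<lambda>N y. S0 e (hh N))"
    unfolding P_def Pp_def Pm_def Pol_def S0_def divide_inverse by (intro poly_bdd0_intros)+
  have r1: "rapid_bdd 5 0 r1" unfolding r1_def T_def A1_def B1_def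
    using rapid_bdd_A_taylor5[of "\<lambda>N y. XX N y + hh N"] poly_bdd_h Xh' by simp
  have r2: "rapid_bdd 5 0 r2" unfolding r2_def T_def A1_def B1_def
    using rapid_bdd_A_taylor5[of "\<lambda>N y. XX N y - hh N"] poly_bdd_cmult[OF poly_bdd_h, of "-1"] Xh by simp
  have s2: "rapid_bdd 2 0 s2" unfolding s2_def A1_def B1_def
    using rapid_bdd_A_taylor2[of 1 0 "\<lambda>N y. XX N y - hh N"] poly_bdd_cmult[OF poly_bdd_h, of "-1"] Xh by simp
  have pXh: "poly_bdd 0 1 (\<lambda>N y. XX N y - hh N)" by (intro poly_bdd_diff poly_bdd_X poly_bdd_weaken[OF poly_bdd_h]) auto
  have s4: "rapid_bdd 2 0 s4"
  proof -
    have d: "poly_bdd 3 1 (\<lambda>N y. (hh (N - 2) / hh N - 1) * (XX N y - hh N))"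
      using poly_bdd_mult[OF poly_bdd_rho2 pXh] by simp
    have "poly_bdd 1 0 (\<lambda>N y. (-1) * hh N + (hh (N - 2) / hh N - 1) * (XX N y - hh N))"
      by (intro poly_bdd_add poly_bdd_cmult poly_bdd_h poly_bdd_weaken[OF d]) auto
    then have "poly_bdd 1 0 (\<lambda>N y. u2 N y - XX N y)" by (simp add: u2_def algebra_simps)
    from rapid_bdd_A_taylor2[OF this u2]
    have 1: "rapid_bdd 2 0 (\<lambda>N y. A (u2 N y) - (A1 N y + (u2 N y - XX N y) * B1 N y))" by (simp add: A1_def B1_def)
    have 2: "rapid_bdd 2 0 (\<lambda>N y. (hh (N - 2) / hh N - 1) * (XX N y - hh N) * B1 N y)"
      by (rule rapid_bdd_weaken[OF rapid_bdd_mult[OF d B1]]) auto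
    show ?thesis using rapid_bdd_add[OF 1 2] by (simp add: s4_def u2_def algebra_simps)
  qed
  have s3: "rapid_bdd 6 1 s3"
  proof -
    have d: "poly_bdd 3 1 (\<lambda>N y. (hh (Suc N) / hh N - 1) * XX N y)" using poly_bdd_mult[OF poly_bdd_rho poly_bdd_X] by simp
    then have "poly_bdd 3 1 (\<lambda>N y. u3 N y - XX N y)" by (simp add: u3_def algebra_simps)
    from rapid_bdd_A_taylor2[OF this u3]
    have 0: "rapid_bdd 6 2 (\<lambda>N y. A (u3 N y) - (A1 N y + (u3 N y - XX N y) * B1 N y))" by (simp add: A1_def B1_def)
    have 1: "rapid_bdd 6 1 (\<lambda>N y. A (u3 N y) - (A1 N y + (u3 N y - XX N y) * B1 N y))"
      by (rule rapid_bdd_weaken[OF 0]) auto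
    have 2: "rapid_bdd 6 1 (\<lambda>N y. (hh (Suc N) / hh N - 1 + hh N ^ 3 / 6) * XX N y * B1 N y)"
      using rapid_bdd_mult[OF poly_bdd_mult[OF poly_bdd_rho_expansion poly_bdd_X] B1] by simp
    show ?thesis using rapid_bdd_add[OF 1 2] by (simp add: s3_def u3_def algebra_simps)
  qed
  have A2: "rapid_bdd 0 0 (\<lambda>N y. A (u2 N y))" by (rule rapid_bdd_compose[OF rapid_A u2])
  have A3: "rapid_bdd 0 0 (\<lambda>N y. A (u3 N y))" by (rule rapid_bdd_compose[OF rapid_A u3])
  have Am: "rapid_bdd 0 0 (\<lambda>N y. A (XX N y - hh N))" by (rule rapid_bdd_compose[OF rapid_A Xh])
  have c2: "poly_bdd 2 1 c2" unfolding c2_def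
  proof (intro poly_bdd_diff poly_bdd_cmult)
    show "poly_bdd 2 1 (\<lambda>N y. hh N ^ 2 * XX N y)" using poly_bdd_mult[OF poly_bdd_h_power poly_bdd_X] by simp
    show "poly_bdd 2 1 (\<lambda>N y. hh N ^ 3)" by (rule poly_bdd_weaken[OF poly_bdd_h_power]) auto
  qed
  have da: "poly_bdd 4 1 da" unfolding da_def c2_def by (rule poly_bdd_alpha)
  have PmI: "poly_bdd 1 1 (\<lambda>N y. P N y - 1)" unfolding P_def by (rule poly_bdd_Pol_minus_1)
  have h2: "poly_bdd 0 0 (\<lambda>N y. hh (N - 2) / hh N)"
  proof (rule poly_bddI[of 2 _ 0])
    fix N y :: nat assume Ny: "N \<ge> 16"
    have "1 \<le> hh (N - 2) / hh N" "hh (N - 2) / hh N \<le> 2" using hh_ratio2_facts(1,2)[OF Ny] by auto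
    then show "\<bar>hh (N - 2) / hh N\<bar> \<le> 2 * (1 + XX N y) ^ 0 * (hh N ^ 0 * XX N y ^ 0)"
      by (simp del: abs_divide)
  qed simp
  have P2: "poly_bdd 1 1 (\<lambda>N y. P2 N y - 1)"
  proof -
    define g where "g = (\<lambda>N (y::nat). hh (N - 2) / hh N)"
    have g: "poly_bdd 0 0 g" using h2 by (simp add: g_def)
    have i: "poly_bdd 0 0 (\<lambda>N y. g N y * g N y * ((11/12 - e/8) * (hh N * g N y) - (1/3) * (g N y * (XX N y - hh N))))"
      by (intro poly_bdd0_intros g)
    have "poly_bdd 1 1 (\<lambda>N y. hh N * (XX N y - hh N) * (g N y * g N y * ((11/12 - e/8) * (hh N * g N y) - (1/3) * (g N y * (XX N y - hh N)))))"
      using poly_bdd_mult[OF poly_bdd_mult[OF poly_bdd_h pXh] i] by simp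
    also have "?this \<longleftrightarrow> ?thesis"
    proof (rule poly_bdd_cong)
      fix N y :: nat assume Ny: "N \<ge> 16" "y \<ge> 1"
      have e: "hh (N - 2) = hh N * g N y" using hX_facts[OF Ny] by (simp add: g_def)
      have u: "u2 N y = g N y * (XX N y - hh N)" by (simp add: u2_def g_def)
      show "hh N * (XX N y - hh N) * (g N y * g N y * ((11/12 - e/8) * (hh N * g N y) - (1/3) * (g N y * (XX N y - hh N)))) = P2 N y - 1"
        unfolding P2_def Pol_def e u by (simp add: field_simps power2_eq_square)
    qed
    finally show ?thesis .
  qed
  \<comment> \<open>From \<open>N\<close> to \<open>N + 1\<close> both \<open>h\<close> and
    \<open>x\<close> are multiplied by the same ratio, so both corrections in \<open>Pol\<close>,
    being of total degree three, are multiplied by its cube.\<close>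
  have P3: "P3 N y = P N y + r3c N y * (P N y - 1)" if "N \<ge> 16" "y \<ge> 1" for N y
  proof -
    have h: "hh N > 0" using hX_facts[OF that] by auto
    define g where "g = hh (Suc N) / hh N"
    have e: "hh (Suc N) = g * hh N" using h by (simp add: g_def)
    show ?thesis unfolding P3_def u3_def P_def Pol_def r3c_def g_def[symmetric] unfolding e
      by (simp add: field_simps power2_eq_square power3_eq_cube)
  qed
  have r3c: "poly_bdd 3 0 r3c" unfolding r3c_def by (rule poly_bdd_rho_cube)
  define p where "p = (\<lambda>N y. let h = hh N; x = XX N y in (1/12)*a^2 + (1/6)*x*a + (-29/36)*x^2 + (-1/36)*h*x^2*a^2 + (-1/18)*h*x^3*a + (-1/36)*h*x^4 + (95/36)*h*x + (11/144)*h^2*x*a^2 + (11/72)*h^2*x^2*a + (11/144)*h^2*x^3 + (-1/3)*h*a + (-79/36)*h^2 + (-1/36)*h^3*a^2 + (-1/18)*h^3*x*a + (-1/36)*h^3*x^2 + (-1/96)*h^2*x*a^2*e + (-1/48)*h^2*x^2*a*e + (-1/96)*h^2*x^3*e + (5/24)*h^2*e + (1/48)*h*x*e + (-1/12)*x^2*e + (-1/32)*h*x*e^2)"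
  define q1 where "q1 = (\<lambda>N y. let h = hh N; x = XX N y in (41/18)*h*x + (-1/18)*h*a + (-269/72)*h^2 + (13/48)*h^2*e + (-4/9)*x^2 + (-1/6)*h*x*e + (-1/18)*h^2*x^2*a + (11/72)*h^3*x*a + (-1/48)*h^3*x*a*e + (-2/27)*h^3*x^2 + (11/54)*h^4*x + (-19/288)*h^4*x*e + (1/72)*h^3*x^2*e + (1/192)*h^4*x*e^2)"
  define q2 where "q2 = (\<lambda>N (y::nat). let h = hh N in (11/36)*h*a + (22/9)*h^2 + (-1/24)*h*a*e + (-1/4)*h^2*e)"
  have pq: "poly_bdd 0 0 p" "poly_bdd 0 0 q1" "poly_bdd 0 0 q2"
    unfolding p_def q1_def q2_def Let_def by (intro poly_bdd0_intros)+
  define E where "E = (\<lambda>N y. hh N ^ 4 * p N y * A1 N y + (hh N ^ 4 * XX N y * q1 N y + hh N ^ 5 * q2 N y) * B1 N y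
     + Pp N y * r1 N y + Pm N y * r2 N y - c2 N y * Pm N y * s2 N y - da N y * Pm N y * A (XX N y - hh N)
     - S0 e (hh N) * P N y * s3 N y - S0 e (hh N) * r3c N y * (P N y - 1) * A (u3 N y)
     - (e / 4 * hh N ^ 3) * (P2 N y - 1) * A (u2 N y) - (e / 4 * hh N ^ 3) * s4 N y)"
  have "rapid_bdd 4 1 E" unfolding E_def
  proof (intro rapid_bdd_add rapid_bdd_diff)
    show "rapid_bdd 4 1 (\<lambda>N y. hh N ^ 4 * p N y * A1 N y)"
      using rapid_bdd_mult[OF poly_bdd_mult[OF poly_bdd_h_power[of 4] pq(1)] A1] by simp
    have "poly_bdd 4 1 (\<lambda>N y. hh N ^ 4 * XX N y * q1 N y + hh N ^ 5 * q2 N y)"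
      using poly_bdd_mult[OF poly_bdd_mult[OF poly_bdd_h_power[of 4] poly_bdd_X] pq(2)]
        poly_bdd_weaken[OF poly_bdd_mult[OF poly_bdd_h_power[of 5] pq(3)], of 4 1] by (intro poly_bdd_add) auto
    from rapid_bdd_mult[OF this B1]
    show "rapid_bdd 4 1 (\<lambda>N y. (hh N ^ 4 * XX N y * q1 N y + hh N ^ 5 * q2 N y) * B1 N y)" by simp
    show "rapid_bdd 4 1 (\<lambda>N y. Pp N y * r1 N y)" by (rule rapid_bdd_weaken[OF rapid_bdd_mult[OF pP(2) r1]]) auto
    show "rapid_bdd 4 1 (\<lambda>N y. Pm N y * r2 N y)" by (rule rapid_bdd_weaken[OF rapid_bdd_mult[OF pP(3) r2]]) auto
    show "rapid_bdd 4 1 (\<lambda>N y. c2 N y * Pm N y * s2 N y)"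
      by (rule rapid_bdd_weaken[OF rapid_bdd_mult[OF poly_bdd_mult[OF c2 pP(3)] s2]]) auto
    show "rapid_bdd 4 1 (\<lambda>N y. da N y * Pm N y * A (XX N y - hh N))"
      by (rule rapid_bdd_weaken[OF rapid_bdd_mult[OF poly_bdd_mult[OF da pP(3)] Am]]) auto
    show "rapid_bdd 4 1 (\<lambda>N y. S0 e (hh N) * P N y * s3 N y)"
      by (rule rapid_bdd_weaken[OF rapid_bdd_mult[OF poly_bdd_mult[OF pP(4) pP(1)] s3]]) auto
    show "rapid_bdd 4 1 (\<lambda>N y. S0 e (hh N) * r3c N y * (P N y - 1) * A (u3 N y))"
      by (rule rapid_bdd_weaken[OF rapid_bdd_mult[OF poly_bdd_mult[OF poly_bdd_mult[OF pP(4) r3c] PmI] A3]]) auto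
    show "rapid_bdd 4 1 (\<lambda>N y. (e / 4 * hh N ^ 3) * (P2 N y - 1) * A (u2 N y))"
      by (rule rapid_bdd_weaken[OF rapid_bdd_mult[OF poly_bdd_mult[OF poly_bdd_cmult[OF poly_bdd_h_power[of 3]] P2] A2]]) auto
    show "rapid_bdd 4 1 (\<lambda>N y. (e / 4 * hh N ^ 3) * s4 N y)"
      by (rule rapid_bdd_weaken[OF rapid_bdd_mult[OF poly_bdd_cmult[OF poly_bdd_h_power[of 3]] s4]]) auto
  qed
  also have "?this \<longleftrightarrow> ?thesis"
  proof (rule rapid_bdd_cong)
    fix N y :: nat assume Ny: "N \<ge> 16" "y \<ge> 1"
    have h: "hh N > 0" using hX_facts[OF Ny] by auto
    have X1: "XX N (y + 1) = XX N y + hh N" by (simp add: XX_def algebra_simps)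
    have X2: "XX N (y - 1) = XX N y - hh N" using Ny by (simp add: XX_def of_nat_diff algebra_simps)
    have X3: "XX (Suc N) y = u3 N y" using h by (simp add: XX_def u3_def)
    have X4: "XX (N - 2) (y - 1) = u2 N y" using h Ny by (simp add: XX_def u2_def of_nat_diff field_simps)
    have F1: "profile e N (y + 1) = Pp N y * (T (hh N) N y + r1 N y)" unfolding profile_def X1 by (simp add: Pp_def r1_def)
    have F2: "profile e N (y - 1) = Pm N y * A (XX N y - hh N)" unfolding profile_def X2 by (simp add: Pm_def)
    have F3: "profile e (Suc N) y = (P N y + r3c N y * (P N y - 1)) * A (u3 N y)"
      unfolding profile_def X3 P3[OF Ny, symmetric] by (simp add: P3_def)
    have F4: "profile e (N - 2) (y - 1) = P2 N y * A (u2 N y)" unfolding profile_def X4 by (simp add: P2_def)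
    have al: "alpha N y = 1 - c2 N y - da N y" by (simp add: da_def)
    have Am2: "A (XX N y - hh N) = T (- hh N) N y + r2 N y" by (simp add: r2_def)
    have Am3: "s2 N y = A (XX N y - hh N) - (A1 N y - hh N * B1 N y)" by (simp add: s2_def)
    have A3: "s3 N y = A (u3 N y) - (A1 N y - hh N ^ 3 / 6 * XX N y * B1 N y)" by (simp add: s3_def)
    have A4: "s4 N y = A (u2 N y) - (A1 N y - hh N * B1 N y)" by (simp add: s4_def)
    have M: "hh N ^ 4 * p N y * A1 N y + (hh N ^ 4 * XX N y * q1 N y + hh N ^ 5 * q2 N y) * B1 N y
      = Pp N y * T (hh N) N y + Pm N y * T (- hh N) N y - c2 N y * (Pm N y * (A1 N y - hh N * B1 N y))
        - S0 e (hh N) * (P N y * (A1 N y - hh N ^ 3 / 6 * XX N y * B1 N y))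
        - e * hh N ^ 3 / 4 * (A1 N y - hh N * B1 N y)"
      using main_polynomial[of e "hh N" "XX N y" "A1 N y" "B1 N y"]
      unfolding Pp_def Pm_def T_def c2_def P_def p_def q1_def q2_def Let_def by simp
    \<comment> \<open>The bookkeeping is done for free variables linked only by
      \<open>Amv = Tm + r2v\<close>, so that the values of \<open>A\<close> act as atoms.\<close>
    have "Pp N y * (T (hh N) N y + r1 N y) + (1 - c2 N y - da N y) * (Pm N y * Amv)
        - S * ((P N y + r3c N y * (P N y - 1)) * A3v) - e * h3 / 4 * (P2 N y * A2v)
      = (Pp N y * T (hh N) N y + Pm N y * Tm - c2 N y * (Pm N y * L1) - S * (P N y * L3) - e * h3 / 4 * L1)
        + Pp N y * r1 N y + Pm N y * r2v - c2 N y * Pm N y * (Amv - L1) - da N y * Pm N y * Amv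
        - S * P N y * (A3v - L3) - S * r3c N y * (P N y - 1) * A3v
        - (e / 4 * h3) * (P2 N y - 1) * A2v - (e / 4 * h3) * (A2v - L1)"
      if "Amv = Tm + r2v" for Amv S A3v A2v h3 L1 L3 Tm r2v
      using that by (simp add: field_simps)
    from this[OF Am2, of "S0 e (hh N)" "A (u3 N y)" "hh N ^ 3" "A (u2 N y)" "A1 N y - hh N * B1 N y"
      "A1 N y - hh N ^ 3 / 6 * XX N y * B1 N y"]
    show "E N y = residual e N y"
      unfolding residual_def E_def F1 F2 F3 F4 al M Am3 A3 A4 by simp
  qed
  finally show ?thesis .
qed

end

section \<open>Perturbed solutions\<close>

text \<open>A square root of \<open>h\<close>, since the perturbations have half-integer exponents:
  \<open>h^(7/2) = r^7\<close> and \<open>h^(3/2) x = r^5 y\<close>.\<close>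

definition rr :: "nat \<Rightarrow> real" where "rr N = sqrt (hh N)"

lemma hh_nonneg: "hh N \<ge> 0" by (simp add: hh_def)

lemma rr_sq: "rr N ^ 2 = hh N" by (simp add: rr_def hh_nonneg)

lemma rr_powers: "hh N ^ n = rr N ^ (2 * n)" by (simp add: power_mult rr_sq)

lemma rr_facts:
  assumes "N \<ge> 16" shows "0 < rr N" "rr N \<le> 1"
  using hX_facts[OF assms, of 1] by (auto simp: rr_def)

text \<open>The ratio \<open>s\<close> of successive values is at most 1, so
  \<open>s^5 >= s^6\<close>, and \<open>s^6\<close> is the cube of \<open>hh (Suc N) / hh N\<close>,
  for which a bound is at hand.\<close>

lemma rr_Suc:
  assumes "N \<ge> 16"
  shows "rr N ^ 5 * (1 - hh N ^ 3) \<le> rr (Suc N) ^ 5" "rr (Suc N) \<le> rr N" "hh (Suc N) \<le> hh N"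
proof -
  define s where "s = rr (Suc N) / rr N"
  have r: "0 < rr N" using rr_facts[OF assms] by auto
  have s2: "s ^ 2 = hh (Suc N) / hh N" by (simp add: s_def power_divide rr_sq)
  have s: "0 \<le> s" by (simp add: s_def rr_def hh_nonneg)
  have "s ^ 2 \<le> 1" using hh_ratio_facts(2)[OF assms] s2 by simp
  then have s1: "s \<le> 1" using s by (simp add: power2_le_iff_abs_le abs_le_iff power_le_one_iff)
  have "s ^ 6 \<le> s ^ 5" using s s1 by (intro power_decreasing) auto
  moreover have "s ^ 6 = (hh (Suc N) / hh N) ^ 3" by (simp add: flip: s2 power_mult)
  moreover have "(hh (Suc N) / hh N) ^ 3 \<ge> 1 - hh N ^ 3" using hh_ratio_facts(6)[OF assms] by linarith
  ultimately have "1 - hh N ^ 3 \<le> s ^ 5" by linarith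
  then have "rr N ^ 5 * (1 - hh N ^ 3) \<le> rr N ^ 5 * s ^ 5" using r by (intro mult_left_mono) auto
  also have "\<dots> = rr (Suc N) ^ 5" using r by (simp add: s_def power_divide)
  finally show "rr N ^ 5 * (1 - hh N ^ 3) \<le> rr (Suc N) ^ 5" .
  show "rr (Suc N) \<le> rr N" using s1 r by (simp add: s_def field_simps)
  show "hh (Suc N) \<le> hh N" using assms by (intro hh_mono) auto
qed

lemma rr_minus2:
  assumes "N \<ge> 16"
  shows "rr (N - 2) ^ 5 \<le> 8 * rr N ^ 5" "hh (N - 2) \<le> 2 * hh N"
proof -
  define s where "s = rr (N - 2) / rr N"
  have r: "0 < rr N" "0 < hh N" using rr_facts[OF assms] hX_facts[OF assms, of 1] by auto
  have s2: "s ^ 2 = hh (N - 2) / hh N" by (simp add: s_def power_divide rr_sq)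
  have s: "0 \<le> s" by (simp add: s_def rr_def hh_nonneg)
  have "1 ^ 2 \<le> s ^ 2" using hh_ratio2_facts(1)[OF assms] s2 by simp
  then have s1: "1 \<le> s" using s by (rule power2_le_imp_le)
  have "s ^ 5 \<le> s ^ 6" using s s1 by (intro power_increasing) auto
  also have "s ^ 6 = (hh (N - 2) / hh N) ^ 3" by (simp add: flip: s2 power_mult)
  also have "\<dots> \<le> 2 ^ 3" using hh_ratio2_facts(1,2)[OF assms] by (intro power_mono) (auto intro: order_trans[OF zero_le_one])
  finally have "rr N ^ 5 * s ^ 5 \<le> rr N ^ 5 * 8" using r by (intro mult_left_mono) auto
  moreover have "rr N ^ 5 * s ^ 5 = rr (N - 2) ^ 5" using r by (simp add: s_def power_divide)
  ultimately show "rr (N - 2) ^ 5 \<le> 8 * rr N ^ 5" by simp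
  show "hh (N - 2) \<le> 2 * hh N" using hh_ratio2_facts(2)[OF assms] r by (simp add: field_simps)
qed

lemma hh_tendsto: "hh \<longlonglongrightarrow> 0"
proof -
  have "(\<lambda>N. (2 / real N) powr (1/3)) \<longlonglongrightarrow> 0 powr (1/3)"
    by (rule tendsto_powr2) (auto intro!: tendsto_divide_0[OF tendsto_const] filterlim_at_top_imp_at_infinity filterlim_real_sequentially)
  then show ?thesis by (simp add: hh_def[abs_def])
qed

lemma rr_eventually_small: "d > 0 \<Longrightarrow> eventually (\<lambda>N. rr N \<le> d) sequentially"
proof -
  assume d: "d > 0"
  have "rr \<longlonglongrightarrow> 0" using tendsto_real_sqrt[OF hh_tendsto] by (simp add: rr_def[abs_def])
  then have "eventually (\<lambda>N. rr N < d) sequentially" using d by (rule order_tendstoD(2))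
  then show ?thesis by (rule eventually_mono) simp
qed

lemma scale_identities:
  "rr N ^ 5 * real y = rr N ^ 3 * XX N y"
  "hh N ^ 4 * XX N y = rr N ^ 8 * XX N y"
  by (simp_all add: XX_def rr_powers flip: rr_sq)

lemma XX_shift:
  assumes "N \<ge> 16" "y \<ge> 1"
  shows "0 \<le> XX (N - 2) (y - 1)" "XX (N - 2) (y - 1) \<le> 2 * XX N y" "1 + XX N y \<le> 2 * (1 + XX (N - 2) (y - 1))"
    "XX (Suc N) y \<le> XX N y" "XX (Suc N) y \<ge> XX N y / 2"
proof -
  note b = hX_facts[OF assms]
  show "0 \<le> XX (N - 2) (y - 1)" by (simp add: XX_def hh_nonneg)
  have "XX (N - 2) (y - 1) \<le> real y * (2 * hh N)" unfolding XX_def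
    using rr_minus2(2)[OF assms(1)] by (intro mult_mono) (auto simp: hh_nonneg)
  then show "XX (N - 2) (y - 1) \<le> 2 * XX N y" by (simp add: XX_def)
  have "hh N \<le> hh (N - 2)" using assms by (intro hh_mono) auto
  then have "real (y - 1) * hh N \<le> XX (N - 2) (y - 1)" unfolding XX_def by (intro mult_left_mono) auto
  then have "XX N y - hh N \<le> XX (N - 2) (y - 1)" using assms by (simp add: XX_def of_nat_diff left_diff_distrib)
  then show "1 + XX N y \<le> 2 * (1 + XX (N - 2) (y - 1))" using b unfolding distrib_left by linarith
  show "XX (Suc N) y \<le> XX N y" unfolding XX_def using rr_Suc(3)[OF assms(1)] by (intro mult_left_mono) auto
  have "hh N / 2 \<le> hh (Suc N)" using hh_ratio_facts(3)[OF assms(1)] b by (simp add: field_simps)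
  then have "real y * (hh N / 2) \<le> real y * hh (Suc N)" by (intro mult_left_mono) auto
  then show "XX (Suc N) y \<ge> XX N y / 2" unfolding XX_def by simp
qed

text \<open>At time \<open>N = l + 2 * j + 1\<close> and height \<open>y = l + 1\<close> this is
  \<open>j / ((l + j + 1) * (l + j))\<close>, the weight of the excluded pairs divided by a quotient
  of factorials.\<close>

definition betaq :: "nat \<Rightarrow> nat \<Rightarrow> real" where
  "betaq N y = 2 * (real N - real y) / ((real N + real y) * (real N + real y - 2))"

lemma betaq_bound:
  assumes "N \<ge> 16" "y \<ge> 1"
  shows "\<bar>betaq N y - hh N ^ 3\<bar> \<le> 5 * hh N ^ 5 * XX N y"
proof -
  have h: "0 < hh N" using hX_facts[OF assms] by auto
  define n where "n = real N" define z where "z = real y"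
  have n: "n \<ge> 16" "z \<ge> 1" using assms by (auto simp: n_def z_def)
  define D where "D = n * ((n + z) * (n + z - 2))"
  have D: "D > 0" "n + z > 0" "n + z - 2 > 0" using n by (auto simp: D_def)
  have "betaq N y - hh N ^ 3 = 2 * (n - z) / ((n + z) * (n + z - 2)) - 2 / n"
    using hh_cube[of N] assms by (simp add: betaq_def n_def z_def)
  also have "\<dots> = (4 * (n + z) - 6 * (n * z) - 2 * (z * z)) / D"
    unfolding D_def using D n by (simp add: divide_simps) (simp add: algebra_simps)
  finally have e: "betaq N y - hh N ^ 3 = (4 * (n + z) - 6 * (n * z) - 2 * (z * z)) / D" .
  have "\<bar>4 * (n + z) - 6 * (n * z) - 2 * (z * z)\<bar> \<le> 10 * z * (n + z)"
  proof -
    have "0 \<le> n * z" "0 \<le> z * z" "n \<le> n * z" "z \<le> z * z" using n by auto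
    moreover have "10 * z * (n + z) = 10 * (n * z) + 10 * (z * z)" by (simp add: algebra_simps)
    ultimately show ?thesis unfolding abs_le_iff distrib_left using n by (intro conjI) linarith+
  qed
  then have "\<bar>betaq N y - hh N ^ 3\<bar> \<le> 10 * z * (n + z) / D"
    unfolding e using D by (simp add: divide_right_mono)
  also have "\<dots> = 10 * z / (n * (n + z - 2))" unfolding D_def using D n by (simp add: divide_simps)
  also have "\<dots> \<le> 10 * z / (n * (n / 2))" using n by (intro divide_left_mono mult_left_mono mult_pos_pos) auto
  also have "\<dots> = 5 * z * (2 / n) ^ 2" using n by (simp add: field_simps power2_eq_square)
  also have "\<dots> = 5 * hh N ^ 5 * XX N y"
  proof -
    have "2 / n = hh N ^ 3" using hh_cube[of N] assms by (simp add: n_def)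
    then have "(2 / n) ^ 2 = hh N ^ 6" by (simp flip: power_mult)
    then show ?thesis by (simp add: XX_def z_def eval_nat_numeral)
  qed
  finally show ?thesis .
qed

text \<open>For \<open>y <= N + 2\<close> the quantity \<open>h^3 y = 2y/N\<close> is at most 3, so
  the error \<open>5 h^5 x = 5 h^3 * h^3 y\<close> is at most \<open>15 h^3\<close>.\<close>

lemma betaq_le:
  assumes "N \<ge> 16" "1 \<le> y" "y \<le> N + 2"
  shows "\<bar>betaq N y\<bar> \<le> 16 * hh N ^ 3"
proof -
  define h where "h = hh N"
  have h: "0 < h" using hX_facts[OF assms(1), of 1] by (simp add: h_def)
  have bq: "\<bar>betaq N y - h ^ 3\<bar> \<le> 5 * h ^ 5 * XX N y" using betaq_bound[OF assms(1,2)] by (simp add: h_def)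
  have "h ^ 5 * XX N y = h ^ 3 * (h ^ 3 * real y)" by (simp add: XX_def h_def eval_nat_numeral)
  also have "h ^ 3 * real y \<le> 3" using assms hh_cube[of N] by (simp add: h_def divide_le_eq)
  finally have "h ^ 5 * XX N y \<le> h ^ 3 * 3" using h by simp
  then show ?thesis using bq h by (auto simp: abs_le_iff h_def)
qed

context airy_shift
begin

definition Sg :: "real \<Rightarrow> real \<Rightarrow> nat \<Rightarrow> real" where
  "Sg e t N = S0 e (hh N) + t * rr N ^ 7"

lemma profile_0: "profile e N 0 = 0" by (simp add: profile_def XX_def A_0)

text \<open>The profile is negative only where \<open>p = Pol\<close> is, and there
  \<open>- p <= (p - 1)^2\<close>. As \<open>p - 1\<close> is of order \<open>h x\<close>, squaring
  gains a second factor \<open>h\<close>; this makes the negative part small against the linear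
  weight \<open>h^(3/2) x\<close>.\<close>

lemma profile_neg: "\<exists>C\<ge>0. \<forall>N\<ge>16. \<forall>y. - profile e N y \<le> C * (hh N ^ 2 * XX N y)"
proof -
  note P1 = poly_bdd_Pol_minus_1[of e]
  have "rapid_bdd 2 3 (\<lambda>N y. (Pol e (hh N) (XX N y) - 1) * (Pol e (hh N) (XX N y) - 1) * A (XX N y))"
    using rapid_bdd_mult[OF poly_bdd_mult[OF P1 P1] rapid_bdd_A] by (simp add: eval_nat_numeral)
  then have rG: "rapid_bdd 2 1 (\<lambda>N y. (Pol e (hh N) (XX N y) - 1) * (Pol e (hh N) (XX N y) - 1) * A (XX N y))"
    by (rule rapid_bdd_weaken) auto
  obtain D where D: "D \<ge> 0" "\<And>N y. N \<ge> 16 \<Longrightarrow> y \<ge> 1 \<Longrightarrow>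
     \<bar>(Pol e (hh N) (XX N y) - 1) * (Pol e (hh N) (XX N y) - 1) * A (XX N y)\<bar> * (1 + XX N y) ^ 0 \<le> D * (hh N ^ 2 * XX N y ^ 1)"
    using rapid_bddD[OF rG] by metis
  have "- profile e N y \<le> D * (hh N ^ 2 * XX N y)" if "N \<ge> 16" for N y
  proof (cases "y = 0 \<or> profile e N y \<ge> 0")
    case True
    then have "profile e N y \<ge> 0" by (auto simp: profile_0)
    moreover have "0 \<le> D * (hh N ^ 2 * XX N y)" using D(1) by (auto simp: XX_def hh_nonneg)
    ultimately show ?thesis by linarith
  next
    case False
    then have y: "y \<ge> 1" by auto
    have A: "A (XX N y) > 0" using hX_facts[OF that y] A_pos by auto
    define p where "p = Pol e (hh N) (XX N y)"
    have p: "p < 0" using False A by (auto simp: profile_def p_def zero_le_mult_iff not_le)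
    have "(p - 1) * (p - 1) = p * p + 1 - 2 * p" by (simp add: algebra_simps)
    then have "- p \<le> (p - 1) * (p - 1)" using p zero_le_square[of p] by linarith
    then have "- p * A (XX N y) \<le> (p - 1) * (p - 1) * A (XX N y)" using A by (intro mult_right_mono) auto
    also have "\<dots> \<le> D * (hh N ^ 2 * XX N y)" using D(2)[OF that y] by (simp add: p_def)
    finally show ?thesis by (simp add: profile_def p_def)
  qed
  then show ?thesis using D(1) by blast
qed

lemma profile_bounds:
  "\<exists>C\<ge>0. \<forall>N\<ge>18. \<forall>y\<ge>1. \<bar>profile e N y\<bar> \<le> C * XX N y \<and> \<bar>profile e (N - 2) (y - 1)\<bar> * (1 + XX N y) \<le> C * XX N y
     \<and> - profile e (N - 2) (y - 1) \<le> C * (hh N * XX N y) \<and> - profile e (Suc N) y \<le> C * (hh N * XX N y)"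
proof -
  have P: "poly_bdd 0 0 (\<lambda>N y. Pol e (hh N) (XX N y))"
    unfolding Pol_def divide_inverse by (intro poly_bdd0_intros)
  have rF: "rapid_bdd 0 1 (profile e)" using rapid_bdd_mult[OF P rapid_bdd_A] by (simp add: profile_def[abs_def])
  obtain C where C: "C \<ge> 0" "\<And>N y. N \<ge> 16 \<Longrightarrow> y \<ge> 1 \<Longrightarrow> \<bar>profile e N y\<bar> * (1 + XX N y) ^ 1 \<le> C * (hh N ^ 0 * XX N y ^ 1)"
    using rapid_bddD[OF rF] by metis
  obtain D where D: "D \<ge> 0" "\<And>N y. N \<ge> 16 \<Longrightarrow> - profile e N y \<le> D * (hh N ^ 2 * XX N y)" using profile_neg[of e] by blast
  have neg: "- profile e N y \<le> D * (hh N * XX N y)" if N: "N \<ge> 16" for N y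
  proof -
    have "hh N ^ 2 \<le> hh N" using hX_facts[OF N, of 1] by (simp add: power2_eq_square mult_le_cancel_left1)
    then have "D * (hh N ^ 2 * XX N y) \<le> D * (hh N * XX N y)"
      using D(1) by (intro mult_left_mono mult_right_mono) (auto simp: XX_def hh_nonneg)
    then show ?thesis using D(2)[OF N, of y] by linarith
  qed
  have "\<bar>profile e N y\<bar> \<le> (4 * C + 4 * D) * XX N y \<and> \<bar>profile e (N - 2) (y - 1)\<bar> * (1 + XX N y) \<le> (4 * C + 4 * D) * XX N y
     \<and> - profile e (N - 2) (y - 1) \<le> (4 * C + 4 * D) * (hh N * XX N y) \<and> - profile e (Suc N) y \<le> (4 * C + 4 * D) * (hh N * XX N y)"
    if Ny: "N \<ge> 18" "y \<ge> 1" for N y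
  proof (intro conjI)
    have N16: "N \<ge> 16" "N - 2 \<ge> 16" "Suc N \<ge> 16" using Ny by auto
    note b = hX_facts[OF N16(1) Ny(2)]
    note s = XX_shift[OF N16(1) Ny(2)]
    have cx: "0 \<le> C * XX N y" "0 \<le> D * XX N y" "0 \<le> D * (hh N * XX N y)" "0 \<le> C * (hh N * XX N y)" using C(1) D(1) b by auto
    have "\<bar>profile e N y\<bar> * 1 \<le> \<bar>profile e N y\<bar> * (1 + XX N y)" using b by (intro mult_left_mono) auto
    then show "\<bar>profile e N y\<bar> \<le> (4 * C + 4 * D) * XX N y" using C(2)[OF N16(1) Ny(2)] cx by (simp add: distrib_right)
    show "\<bar>profile e (N - 2) (y - 1)\<bar> * (1 + XX N y) \<le> (4 * C + 4 * D) * XX N y"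
    proof (cases "y = 1")
      case True then show ?thesis using cx by (simp add: profile_0 distrib_right)
    next
      case False
      then have y1: "y - 1 \<ge> 1" using Ny by auto
      have "\<bar>profile e (N - 2) (y - 1)\<bar> * (1 + XX N y) \<le> \<bar>profile e (N - 2) (y - 1)\<bar> * (2 * (1 + XX (N - 2) (y - 1)))"
        using s by (intro mult_left_mono) auto
      also have "\<dots> = 2 * (\<bar>profile e (N - 2) (y - 1)\<bar> * (1 + XX (N - 2) (y - 1)) ^ 1)" by simp
      also have "\<dots> \<le> 2 * (C * (hh (N - 2) ^ 0 * XX (N - 2) (y - 1) ^ 1))"
        by (intro mult_left_mono C(2)[OF N16(2) y1]) auto
      also have "\<dots> \<le> 2 * (C * (1 * (2 * XX N y)))" using s C(1) unfolding power_0 power_one_right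
        by (intro mult_left_mono) auto
      finally show ?thesis using cx by (simp add: distrib_right)
    qed
    have "hh (N - 2) * XX (N - 2) (y - 1) \<le> (2 * hh N) * (2 * XX N y)"
      using rr_minus2(2)[OF N16(1)] s b by (intro mult_mono) auto
    then have "D * (hh (N - 2) * XX (N - 2) (y - 1)) \<le> D * (4 * (hh N * XX N y))" using D(1) by (intro mult_left_mono) auto
    then show "- profile e (N - 2) (y - 1) \<le> (4 * C + 4 * D) * (hh N * XX N y)"
      using neg[OF N16(2), of "y - 1"] cx by (simp add: distrib_right)
    have "hh (Suc N) * XX (Suc N) y \<le> hh N * XX N y"
      using rr_Suc(3)[OF N16(1)] s b by (intro mult_mono) (auto simp: XX_def hh_nonneg)
    then have "D * (hh (Suc N) * XX (Suc N) y) \<le> D * (hh N * XX N y)" using D(1) by (intro mult_left_mono) auto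
    then show "- profile e (Suc N) y \<le> (4 * C + 4 * D) * (hh N * XX N y)"
      using neg[OF N16(3), of y] cx by (simp add: distrib_right)
  qed
  then show ?thesis using C(1) D(1) by (intro exI[of _ "4 * C + 4 * D"]) auto
qed

text \<open>Near the origin the slope \<open>A' 0 > 0\<close> gives the bound; on the rest of the
  compact interval \<open>A\<close> has a positive minimum.\<close>

lemma A_linear_lower: "\<exists>c>0. \<forall>x. 0 < x \<longrightarrow> x \<le> x1 \<longrightarrow> c * x \<le> A x"
proof -
  have "isCont A' 0" using DA' by (rule DERIV_isCont)
  then have "A' \<midarrow>0\<rightarrow> A' 0" by (simp add: isCont_def)
  then have "eventually (\<lambda>x. A' x > A' 0 / 2) (at 0)" using A'_0 by (intro order_tendstoD(1)[where y = "A' 0"]) auto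
  then obtain d where d: "d > 0" "\<And>x. x \<noteq> 0 \<Longrightarrow> \<bar>x\<bar> < d \<Longrightarrow> A' x > A' 0 / 2"
    by (auto simp: eventually_at dist_real_def)
  have small: "A' 0 / 2 * x \<le> A x" if x: "0 < x" "x < d" for x
  proof -
    obtain z where z: "0 < z" "z < x" "A x - A 0 = (x - 0) * A' z" using MVT2[OF x(1), of A A'] DA by blast
    have "x * (A' 0 / 2) \<le> x * A' z" using d(2)[of z] z x by (intro mult_left_mono) auto
    then show ?thesis using z by (simp add: A_0 mult.commute)
  qed
  define x2 where "x2 = max x1 (d/2)"
  have "continuous_on {d/2..x2} A" using DA by (intro continuous_at_imp_continuous_on) (auto intro: DERIV_isCont)
  then obtain m where m: "m \<in> {d/2..x2}" "\<And>x. x \<in> {d/2..x2} \<Longrightarrow> A m \<le> A x"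
    using continuous_attains_inf[of "{d/2..x2}" A] by (auto simp: x2_def)
  have Am: "A m > 0" using A_pos m d by auto
  have x2: "x2 > 0" using d by (auto simp: x2_def)
  define c where "c = min (A' 0 / 2) (A m / x2)"
  have c: "c > 0" using Am x2 A'_0 by (auto simp: c_def)
  have "c * x \<le> A x" if x: "0 < x" "x \<le> x1" for x
  proof (cases "x < d")
    case True
    have "c \<le> A' 0 / 2" unfolding c_def by (rule min.cobounded1)
    then have "c * x \<le> A' 0 / 2 * x" using x by (intro mult_right_mono) auto
    then show ?thesis using small[OF x(1) True] by simp
  next
    case False
    have "c \<le> A m / x2" "x \<le> x2" unfolding c_def x2_def using x by auto
    then have "c * x \<le> (A m / x2) * x2" using x x2 Am c by (intro mult_mono) auto
    also have "\<dots> = A m" using x2 by simp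
    also have "\<dots> \<le> A x" using False x d by (intro m) (auto simp: x2_def)
    finally show ?thesis .
  qed
  then show ?thesis using c by blast
qed

text \<open>The term \<open>\<sigma> r\<^sup>7\<close> in the growth rate gives room for errors of order \<open>h\<^sup>4 x\<close> at bounded scaled
  heights \<open>x\<close>; at large \<open>x\<close>, where \<open>A\<close> is tiny, the room comes from the linear weight \<open>r\<^sup>5 y\<close>.\<close>
lemma slack:
  "\<exists>\<sigma>>0. \<forall>C. eventually (\<lambda>N. \<forall>y t. 1 \<le> y \<longrightarrow> y \<le> N + 2 \<longrightarrow> \<bar>t\<bar> \<le> \<sigma> \<longrightarrow>
     C * (hh N ^ 4 * XX N y) \<le> \<sigma> * rr N ^ 7 * profile e (Suc N) y
        + (Sg e t N * rr (Suc N) ^ 5 * real y - rr N ^ 5 * (alpha N y * (real y - 1) + (real y + 1)))) sequentially"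
proof -
  \<comment> \<open>Above \<open>x1\<close> the gain \<open>x h^2 / 8\<close> per unit of linear
    weight exceeds \<open>(|a| + 3) h^2\<close>.\<close>
  define x1 where "x1 = 8 * (\<bar>a\<bar> + 3)"
  obtain c0 where c0: "c0 > 0" "\<And>x. 0 < x \<Longrightarrow> x \<le> x1 \<Longrightarrow> c0 * x \<le> A x" using A_linear_lower by blast
  obtain CF where CF: "CF \<ge> 0" "\<And>N y. N \<ge> 18 \<Longrightarrow> y \<ge> 1 \<Longrightarrow> - profile e (Suc N) y \<le> CF * (hh N * XX N y)"
    using profile_bounds[of e] by blast
  \<comment> \<open>Chosen so that \<open>\<sigma> * (c0 / 4) = |a| + 2\<close>, which is one more
    than the loss \<open>|a| + 1\<close> in \<open>e7\<close>.\<close>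
  define \<sigma> where "\<sigma> = 4 * (\<bar>a\<bar> + 2) / c0"
  have \<sigma>: "\<sigma> > 0" using c0 by (auto simp: \<sigma>_def)
  \<comment> \<open>The summand 3 pays for replacing \<open>rr (Suc N) ^ 5\<close> by
    \<open>rr N ^ 5\<close>, which costs \<open>h^3\<close> times a growth rate of at most
    3.\<close>
  define K where "K = \<bar>4/3 - e/4\<bar> + \<sigma> + 3"
  have K: "K > 0" using \<sigma> by (auto simp: K_def)
  define L where "L = K + \<sigma> * CF + x1 ^ 2 + 2 * \<bar>11/12 - e/8\<bar> * x1 + \<bar>a\<bar> + 8"
  have L: "K \<le> L" "\<sigma> * CF \<le> L" "8 \<le> L" "x1 ^ 2 + 2 * \<bar>11/12 - e/8\<bar> * x1 \<le> L" "\<bar>a\<bar> + K \<le> L"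
    using \<sigma> CF K by (auto simp: L_def x1_def)
  have Lpos: "L > 0" using L(3) by linarith
  have "eventually (\<lambda>N. \<forall>y t. 1 \<le> y \<longrightarrow> y \<le> N + 2 \<longrightarrow> \<bar>t\<bar> \<le> \<sigma> \<longrightarrow>
     C * (hh N ^ 4 * XX N y) \<le> \<sigma> * rr N ^ 7 * profile e (Suc N) y
        + (Sg e t N * rr (Suc N) ^ 5 * real y - rr N ^ 5 * (alpha N y * (real y - 1) + (real y + 1)))) sequentially" for C
  proof -
    have "eventually (\<lambda>N. N \<ge> 18 \<and> rr N \<le> min (1 / L) (1 / (\<bar>C\<bar> + 1))) sequentially"
      by (intro eventually_conj eventually_ge_at_top rr_eventually_small) (use Lpos in auto)
    then show ?thesis
    proof (rule eventually_mono, intro allI impI)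
      fix N y :: nat and t :: real
      assume N: "N \<ge> 18 \<and> rr N \<le> min (1 / L) (1 / (\<bar>C\<bar> + 1))" and y: "1 \<le> y" "y \<le> N + 2" and t: "\<bar>t\<bar> \<le> \<sigma>"
      define h where "h = hh N" define r where "r = rr N" define X where "X = XX N y"
      have N16: "N \<ge> 16" using N by simp
      have b: "0 < h" "h \<le> 1" "h \<le> X" "0 < X" using hX_facts[OF N16 y(1)] by (auto simp: h_def X_def)
      have r: "0 < r" "r \<le> 1" using rr_facts[OF N16] by (auto simp: r_def)
      have hr: "h = r ^ 2" by (simp add: h_def r_def rr_sq)
      have "h \<le> r" unfolding hr using r by (simp add: power2_eq_square mult_le_cancel_left1)
      moreover have "L * r \<le> 1" "(\<bar>C\<bar> + 1) * r \<le> 1" using N Lpos by (auto simp: r_def field_simps)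
      ultimately have Lh: "L * h \<le> 1" and Cr: "\<bar>C\<bar> * r \<le> 1"
        using Lpos r mult_left_mono[of h r L] by (linarith, simp add: algebra_simps)
      have Kh: "K * h \<le> 1" "\<sigma> * CF * h \<le> 1" "(x1 ^ 2 + 2 * \<bar>11/12 - e/8\<bar> * x1) * h \<le> 1" "(\<bar>a\<bar> + K) * h \<le> 1"
        using L Lh b by (meson mult_right_mono order_trans less_imp_le)+
      define V where "V = Sg e t N * rr (Suc N) ^ 5 * real y - rr N ^ 5 * (alpha N y * (real y - 1) + (real y + 1))"
      \<comment> \<open>The linear function satisfies
        \<open>alpha N y * (y - 1) + (y + 1) = 2 * y - W\<close>. The defect \<open>W\<close> is of
        order \<open>y^2 / N\<close> for large \<open>y\<close>, and this is the gain at large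
        heights.\<close>
      define W where "W = (1 - alpha N y) * (real y - 1)"
      have Sg1: "Sg e t N \<ge> 2 + a * h ^ 2 - (K - 3) * h ^ 3"
      proof -
        have "r ^ 7 \<le> h ^ 3" unfolding hr using r by (simp add: power_decreasing flip: power_mult)
        then have "\<bar>t\<bar> * r ^ 7 \<le> \<sigma> * h ^ 3" using t \<sigma> r by (intro mult_mono) auto
        then have "\<bar>t * r ^ 7\<bar> \<le> \<sigma> * h ^ 3" using r by (simp add: abs_mult)
        moreover have "\<bar>(4/3 - e/4) * h ^ 3\<bar> \<le> \<bar>4/3 - e/4\<bar> * h ^ 3" using b by (simp add: abs_mult)
        ultimately show ?thesis unfolding Sg_def S0_def K_def h_def[symmetric] r_def[symmetric]
          by (simp add: algebra_simps)
      qed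
      have ah: "\<bar>a * h ^ 2\<bar> \<le> \<bar>a\<bar> * h" using b by (simp add: abs_mult power2_eq_square mult_left_mono mult_le_cancel_left1)
      have Sg3: "Sg e t N \<le> 3" "0 \<le> Sg e t N"
      proof -
        have 1: "h ^ 3 \<le> h" using b power_decreasing[of 1 3 h] by simp
        have "r ^ 7 \<le> r ^ 2" using r by (intro power_decreasing) auto
        then have "\<bar>t\<bar> * r ^ 7 \<le> \<sigma> * h" using t \<sigma> r by (intro mult_mono) (auto simp: hr)
        then have 2: "\<bar>t * r ^ 7\<bar> \<le> \<sigma> * h" using r by (simp add: abs_mult)
        have 3: "\<bar>(4/3 - e/4) * h ^ 3\<bar> \<le> \<bar>4/3 - e/4\<bar> * h" using b 1 by (simp add: abs_mult mult_left_mono)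
        have "\<bar>Sg e t N - 2\<bar> \<le> \<bar>a\<bar> * h + \<bar>4/3 - e/4\<bar> * h + \<sigma> * h"
          unfolding Sg_def S0_def h_def[symmetric] r_def[symmetric] using ah 2 3 by linarith
        also have "\<dots> \<le> (\<bar>a\<bar> + K) * h" using b by (simp add: K_def algebra_simps)
        finally show "Sg e t N \<le> 3" "0 \<le> Sg e t N" using Kh(4) by linarith+
      qed
      have V1: "V \<ge> r ^ 3 * X * (a * h ^ 2 - K * h ^ 3) + r ^ 5 * W"
      proof -
        have "Sg e t N * (r ^ 5 * (1 - h ^ 3)) \<le> Sg e t N * rr (Suc N) ^ 5"
          using rr_Suc(1)[OF N16] Sg3 by (intro mult_left_mono) (auto simp: r_def h_def)
        moreover have "r ^ 5 * (2 + a * h ^ 2 - K * h ^ 3) \<le> Sg e t N * (r ^ 5 * (1 - h ^ 3))"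
        proof -
          have "Sg e t N * h ^ 3 \<le> 3 * h ^ 3" using Sg3 b by (intro mult_right_mono) auto
          then have "2 + a * h ^ 2 - K * h ^ 3 \<le> Sg e t N * (1 - h ^ 3)" using Sg1 by (simp add: algebra_simps)
          then have "r ^ 5 * (2 + a * h ^ 2 - K * h ^ 3) \<le> r ^ 5 * (Sg e t N * (1 - h ^ 3))" using r by (intro mult_left_mono) auto
          then show ?thesis by (simp add: mult_ac)
        qed
        ultimately have "r ^ 5 * (2 + a * h ^ 2 - K * h ^ 3) * real y \<le> Sg e t N * rr (Suc N) ^ 5 * real y"
          by (intro mult_right_mono) auto
        then have "V \<ge> r ^ 5 * (2 + a * h ^ 2 - K * h ^ 3) * real y - r ^ 5 * (alpha N y * (real y - 1) + (real y + 1))"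
          by (simp add: V_def r_def)
        also have "r ^ 5 * (2 + a * h ^ 2 - K * h ^ 3) * real y - r ^ 5 * (alpha N y * (real y - 1) + (real y + 1))
           = (r ^ 5 * real y) * (a * h ^ 2 - K * h ^ 3) + r ^ 5 * W" by (simp add: W_def algebra_simps)
        also have "r ^ 5 * real y = r ^ 3 * X" unfolding r_def X_def by (rule scale_identities)
        finally show ?thesis .
      qed
      have N0: "real N + real y > 0" using N16 by simp
      have W: "W = (2 * real y - 4) * (real y - 1) / (real N + real y)"
        unfolding W_def alpha_def using N0 by (simp add: field_simps)
      have W0: "W \<ge> 0"
      proof (cases "y = 1")
        case False then show ?thesis unfolding W using y by (intro divide_nonneg_nonneg mult_nonneg_nonneg) auto
      qed (simp add: W)
      have e7: "r ^ 3 * X * (a * h ^ 2 - K * h ^ 3) \<ge> - (r ^ 7 * X * (\<bar>a\<bar> + 1))"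
      proof -
        have eq: "r ^ 3 * X * (a * h ^ 2 - K * h ^ 3) = r ^ 7 * X * (a - K * h)"
          unfolding hr by (simp add: algebra_simps eval_nat_numeral)
        have "a - K * h \<ge> - (\<bar>a\<bar> + 1)" using Kh by linarith
        then have "r ^ 7 * X * (a - K * h) \<ge> r ^ 7 * X * (- (\<bar>a\<bar> + 1))" using r b by (intro mult_left_mono) auto
        then show ?thesis unfolding eq by (simp only: mult_minus_right)
      qed
      \<comment> \<open>A surplus of \<open>r^7 * X\<close> is kept in both ranges of
        \<open>X\<close>; it absorbs \<open>C * h^4 * X = (C * r) * r^7 * X\<close> as soon as
        \<open>C * r <= 1\<close>.\<close>
      have "r ^ 7 * X \<le> \<sigma> * r ^ 7 * profile e (Suc N) y + V"
      proof (cases "X \<le> x1")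
        case True
        define X' where "X' = XX (Suc N) y" define h' where "h' = hh (Suc N)"
        have X': "X / 2 \<le> X'" "X' \<le> X" "0 < X'" using XX_shift(4,5)[OF N16 y(1)] b by (auto simp: X'_def X_def)
        have h': "0 \<le> h'" "h' \<le> h" using rr_Suc(3)[OF N16] by (auto simp: h'_def h_def hh_nonneg)
        have "Pol e h' X' \<ge> 1/2"
        proof -
          have "h' * X' ^ 2 \<le> h * x1 ^ 2" using h' X' True b by (intro mult_mono power_mono) auto
          moreover have "\<bar>(11/12 - e/8) * h' ^ 2 * X'\<bar> \<le> \<bar>11/12 - e/8\<bar> * h * x1"
          proof -
            have "h' ^ 2 \<le> h" using h' b mult_mono[of h' h h' 1] by (simp add: power2_eq_square)
            then have "h' ^ 2 * X' \<le> h * x1" using X' True b by (intro mult_mono) auto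
            then have "\<bar>11/12 - e/8\<bar> * (h' ^ 2 * X') \<le> \<bar>11/12 - e/8\<bar> * (h * x1)" by (rule mult_left_mono) auto
            then show ?thesis using h' X' by (simp add: abs_mult mult_ac)
          qed
          moreover have "h * x1 ^ 2 + 2 * (\<bar>11/12 - e/8\<bar> * h * x1) \<le> 1" using Kh(3) by (simp add: algebra_simps)
          moreover have "h * x1 ^ 2 \<ge> 0" using b by simp
          ultimately show ?thesis unfolding Pol_def by linarith
        qed
        moreover have "c0 * X' \<le> A X'" using X' True by (intro c0) auto
        ultimately have "(1/2) * (c0 * X') \<le> Pol e h' X' * A X'" using X' c0 by (intro mult_mono) auto
        moreover have "c0 / 4 * X \<le> (1/2) * (c0 * X')" using X' c0 by (simp add: field_simps)
        ultimately have "profile e (Suc N) y \<ge> c0 / 4 * X" unfolding profile_def X'_def[symmetric] h'_def[symmetric]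
          by linarith
        then have "\<sigma> * r ^ 7 * profile e (Suc N) y \<ge> \<sigma> * r ^ 7 * (c0 / 4 * X)" using \<sigma> r by (intro mult_left_mono) auto
        moreover have "\<sigma> * r ^ 7 * (c0 / 4 * X) = r ^ 7 * X * (\<bar>a\<bar> + 2)" using c0 by (simp add: \<sigma>_def)
        moreover have "r ^ 5 * W \<ge> 0" using r W0 by simp
        ultimately have "\<sigma> * r ^ 7 * profile e (Suc N) y + V \<ge> r ^ 7 * X * (\<bar>a\<bar> + 2) - r ^ 7 * X * (\<bar>a\<bar> + 1)"
          using V1 e7 by linarith
        then show ?thesis by (simp add: algebra_simps)
      next
        case False
        have "real y = X / h" using b by (simp add: X_def XX_def h_def)
        moreover have "X \<ge> 8" using False by (simp add: x1_def)
        moreover have "X \<le> X / h" using b by (simp add: field_simps mult_le_cancel_right1)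
        ultimately have y8: "real y \<ge> 8" by linarith
        have "(real y) ^ 2 / (4 * real N) \<le> W"
        proof -
          have "(real y) ^ 2 \<le> (2 * real y - 4) * (real y - 1)"
            using mult_right_mono[OF y8, of "real y"] by (simp add: algebra_simps power2_eq_square)
          moreover have "real N + real y \<le> 4 * real N" using y(2) N16 by simp
          ultimately show ?thesis unfolding W using N16 y8 by (intro frac_le) auto
        qed
        moreover have "(real y) ^ 2 / (4 * real N) = real y * (X * h ^ 2 / 8)"
          using hh_N[of N] N16 b by (simp add: X_def XX_def h_def field_simps power2_eq_square power3_eq_cube)
        moreover have "real y * ((\<bar>a\<bar> + 3) * h ^ 2) \<le> real y * (X * h ^ 2 / 8)"
          using False b by (intro mult_left_mono) (auto simp: x1_def)
        ultimately have "r ^ 5 * (real y * ((\<bar>a\<bar> + 3) * h ^ 2)) \<le> r ^ 5 * W" using r by (intro mult_left_mono) auto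
        moreover have "r ^ 5 * (real y * ((\<bar>a\<bar> + 3) * h ^ 2)) = (r ^ 5 * real y) * ((\<bar>a\<bar> + 3) * h ^ 2)" by simp
        moreover have "r ^ 5 * real y = r ^ 3 * X" unfolding r_def X_def by (rule scale_identities)
        moreover have "r ^ 3 * X * ((\<bar>a\<bar> + 3) * h ^ 2) = r ^ 7 * X * (\<bar>a\<bar> + 3)"
          unfolding hr by (simp add: algebra_simps eval_nat_numeral)
        ultimately have "r ^ 7 * X * (\<bar>a\<bar> + 3) \<le> r ^ 5 * W" by simp
        moreover have "\<sigma> * r ^ 7 * profile e (Suc N) y \<ge> - (r ^ 7 * X)"
        proof -
          have "\<sigma> * r ^ 7 * (- profile e (Suc N) y) \<le> \<sigma> * r ^ 7 * (CF * (h * X))"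
            using CF(2)[of N y] N y \<sigma> r unfolding h_def X_def by (intro mult_left_mono) auto
          also have "\<dots> = r ^ 7 * X * (\<sigma> * CF * h)" by simp
          also have "\<dots> \<le> r ^ 7 * X * 1" using Kh(2) r b by (intro mult_left_mono) auto
          finally show ?thesis by simp
        qed
        ultimately show ?thesis using V1 e7 by (simp add: algebra_simps)
      qed
      moreover have "C * (hh N ^ 4 * XX N y) \<le> r ^ 7 * X"
      proof -
        have "C * (hh N ^ 4 * XX N y) = (C * r) * (r ^ 7 * X)"
          unfolding scale_identities by (simp add: r_def X_def eval_nat_numeral)
        also have "\<dots> \<le> 1 * (r ^ 7 * X)"
        proof (intro mult_right_mono)
          have "C * r \<le> \<bar>C\<bar> * r" using r by (intro mult_right_mono) auto
          then show "C * r \<le> 1" using Cr by simp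
        qed (use r b in auto)
        finally show ?thesis by simp
      qed
      ultimately show "C * (hh N ^ 4 * XX N y) \<le> \<sigma> * rr N ^ 7 * profile e (Suc N) y
        + (Sg e t N * rr (Suc N) ^ 5 * real y - rr N ^ 5 * (alpha N y * (real y - 1) + (real y + 1)))"
        by (simp add: V_def r_def)
    qed
  qed
  then show ?thesis using \<sigma> by blast
qed

end

context airy_shift
begin

lemma Sg_near_2:
  assumes "N \<ge> 16" "\<bar>t\<bar> \<le> \<sigma>"
  shows "\<bar>Sg e t N - 2\<bar> \<le> (\<bar>a\<bar> + \<bar>4/3 - e/4\<bar> + \<sigma>) * hh N ^ 2"
proof -
  define h where "h = hh N" define r where "r = rr N"
  have b: "0 < h" "h \<le> 1" using hX_facts[OF assms(1), of 1] by (auto simp: h_def)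
  have r: "0 < r" "r \<le> 1" using rr_facts[OF assms(1)] by (auto simp: r_def)
  have hr: "h = r ^ 2" by (simp add: h_def r_def rr_sq)
  have "r ^ 7 \<le> r ^ 4" using r by (intro power_decreasing) auto
  then have "\<bar>t\<bar> * r ^ 7 \<le> \<sigma> * h ^ 2" using assms r by (intro mult_mono) (auto simp: hr simp flip: power_mult)
  then have 2: "\<bar>t * r ^ 7\<bar> \<le> \<sigma> * h ^ 2" using r by (simp add: abs_mult)
  have "h ^ 3 \<le> h ^ 2" using b by (intro power_decreasing) auto
  then have 3: "\<bar>(4/3 - e/4) * h ^ 3\<bar> \<le> \<bar>4/3 - e/4\<bar> * h ^ 2" using b by (simp add: abs_mult mult_left_mono)
  have 1: "\<bar>a * h ^ 2\<bar> \<le> \<bar>a\<bar> * h ^ 2" using b by (simp add: abs_mult)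
  show ?thesis
    unfolding Sg_def S0_def h_def[symmetric] r_def[symmetric] distrib_right using 1 2 3 by linarith
qed

lemma hh_pred:
  assumes "N \<ge> 18"
  shows "hh (N - 1) \<le> 2 * hh N" "hh (N - 2) \<le> 2 * hh N"
proof -
  have "hh (N - 1) \<le> hh (N - 2)" using assms by (intro hh_mono) auto
  then show "hh (N - 1) \<le> 2 * hh N" "hh (N - 2) \<le> 2 * hh N" using rr_minus2(2)[of N] assms by auto
qed

lemma Sg_eventually:
  "eventually (\<lambda>N. N \<ge> 18 \<and> (\<forall>t. \<bar>t\<bar> \<le> \<sigma> \<longrightarrow> 1 \<le> Sg e t N \<and> Sg e t N \<le> 3 \<and> 1 \<le> Sg e t (N - 1) * Sg e t (N - 2) \<and>
     \<bar>Sg e t (N - 1) * Sg e t (N - 2) - 4\<bar> \<le> 20 * (\<bar>a\<bar> + \<bar>4/3 - e/4\<bar> + \<bar>\<sigma>\<bar>) * hh N ^ 2)) sequentially"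
proof -
  define M where "M = \<bar>a\<bar> + \<bar>4/3 - e/4\<bar> + \<bar>\<sigma>\<bar>"
  have M: "M \<ge> 0" by (simp add: M_def)
  have "eventually (\<lambda>N. N \<ge> 18 \<and> rr N \<le> 1 / (4 * M + 1)) sequentially"
    by (intro eventually_conj eventually_ge_at_top rr_eventually_small) (use M in auto)
  then show ?thesis
  proof (rule eventually_mono, intro conjI allI impI)
    fix N t assume N: "N \<ge> 18 \<and> rr N \<le> 1 / (4 * M + 1)"
    then show "N \<ge> 18" by simp
    assume t: "\<bar>t\<bar> \<le> \<sigma>"
    have b: "0 < hh N" "hh N \<le> 1" using hX_facts[of N 1] N by auto
    have r: "0 < rr N" "rr N \<le> 1" using rr_facts[of N] N by auto
    have "hh N ^ 2 \<le> hh N" using b by (simp add: power2_eq_square mult_le_cancel_left1)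
    also have "hh N \<le> rr N" using r by (simp add: power2_eq_square mult_le_cancel_left1 flip: rr_sq)
    also have "\<dots> \<le> 1 / (4 * M + 1)" using N by simp
    finally have "hh N ^ 2 + 4 * M * hh N ^ 2 \<le> 1" using M b by (simp add: field_simps)
    then have h2: "4 * M * hh N ^ 2 \<le> 1" using zero_le_power2[of "hh N"] by linarith
    have near: "\<bar>Sg e t n - 2\<bar> \<le> 4 * M * hh N ^ 2" if n: "n \<ge> 16" "hh n \<le> 2 * hh N" for n
    proof -
      have "\<bar>Sg e t n - 2\<bar> \<le> M * hh n ^ 2"
        using Sg_near_2[OF n(1), of t "\<bar>\<sigma>\<bar>" e] t by (simp add: M_def)
      also have "\<dots> \<le> M * (2 * hh N) ^ 2" using n(2) M by (intro mult_left_mono power_mono) (auto simp: hh_nonneg)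
      finally show ?thesis by (simp add: power_mult_distrib)
    qed
    have n0: "\<bar>Sg e t N - 2\<bar> \<le> 4 * M * hh N ^ 2" using N b by (intro near) auto
    have n1: "\<bar>Sg e t (N - 1) - 2\<bar> \<le> 4 * M * hh N ^ 2" using N hh_pred[of N] by (intro near) auto
    have n2: "\<bar>Sg e t (N - 2) - 2\<bar> \<le> 4 * M * hh N ^ 2" using N hh_pred[of N] by (intro near) auto
    show "1 \<le> Sg e t N" "Sg e t N \<le> 3" using n0 h2 by linarith+
    define u where "u = Sg e t (N - 1) - 2" define v where "v = Sg e t (N - 2) - 2"
    have uv: "\<bar>u\<bar> \<le> 4 * M * hh N ^ 2" "\<bar>v\<bar> \<le> 4 * M * hh N ^ 2" "\<bar>u\<bar> \<le> 1" "\<bar>v\<bar> \<le> 1"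
      using n1 n2 h2 by (auto simp: u_def v_def)
    have e: "Sg e t (N - 1) * Sg e t (N - 2) = (2 + u) * (2 + v)" by (simp add: u_def v_def)
    have "1 * 1 \<le> (2 + u) * (2 + v)" using uv by (intro mult_mono) (auto simp: abs_le_iff)
    then show "1 \<le> Sg e t (N - 1) * Sg e t (N - 2)" unfolding e by simp
    have "\<bar>u * v\<bar> \<le> \<bar>v\<bar>" using uv mult_right_mono[of "\<bar>u\<bar>" 1 "\<bar>v\<bar>"] by (simp add: abs_mult)
    moreover have "(2 + u) * (2 + v) - 4 = u * v + 2 * u + 2 * v" by (simp add: algebra_simps)
    ultimately have "\<bar>(2 + u) * (2 + v) - 4\<bar> \<le> 5 * (4 * M * hh N ^ 2)" using uv by linarith
    then show "\<bar>Sg e t (N - 1) * Sg e t (N - 2) - 4\<bar> \<le> 20 * (\<bar>a\<bar> + \<bar>4/3 - e/4\<bar> + \<bar>\<sigma>\<bar>) * hh N ^ 2"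
      unfolding e M_def[symmetric] by simp
  qed
qed

section \<open>Super- and subsolutions\<close>

definition upper_weight :: "real \<Rightarrow> nat \<Rightarrow> nat \<Rightarrow> real" where
  "upper_weight e N y = profile e N y + rr N ^ 5 * real y"

definition lower_weight :: "real \<Rightarrow> nat \<Rightarrow> nat \<Rightarrow> real" where
  "lower_weight e N y = profile e N y - rr N ^ 5 * real y"

text \<open>Weights are normalised by the product of growth rates up to their time, so the term from
  time \<open>N - 2\<close> is divided by the two rates in between.\<close>

definition upper_step :: "real \<Rightarrow> real \<Rightarrow> nat \<Rightarrow> nat \<Rightarrow> bool" where
  "upper_step e \<sigma> N y \<longleftrightarrow> alpha N y * upper_weight e N (y - 1) + upper_weight e N (y + 1)
     - e * betaq N y / (Sg e \<sigma> (N - 1) * Sg e \<sigma> (N - 2)) * upper_weight e (N - 2) (y - 1)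
     \<le> Sg e \<sigma> N * upper_weight e (Suc N) y"

text \<open>The lower weight becomes negative at large heights and will be cut off at 0. As the
  cut-off can only increase the first two terms on the right, it has to be built into the subtracted
  term alone.\<close>

definition lower_step :: "real \<Rightarrow> real \<Rightarrow> nat \<Rightarrow> nat \<Rightarrow> bool" where
  "lower_step e \<sigma> N y \<longleftrightarrow> Sg e (- \<sigma>) N * lower_weight e (Suc N) y
     \<le> alpha N y * lower_weight e N (y - 1) + lower_weight e N (y + 1)
     - e * betaq N y / (Sg e (- \<sigma>) (N - 1) * Sg e (- \<sigma>) (N - 2)) * max (lower_weight e (N - 2) (y - 1)) 0"

text \<open>Since \<open>slack\<close> beats every multiple of \<open>h^4 x\<close>, it suffices
  that each deviation from the definition of \<open>residual\<close> is of that order.\<close>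

lemma step_ineqs:
  assumes e: "0 \<le> e"
  shows "\<exists>\<sigma>>0. eventually (\<lambda>N. (\<forall>t. \<bar>t\<bar> \<le> \<sigma> \<longrightarrow> 1 \<le> Sg e t N) \<and>
    (\<forall>y. 1 \<le> y \<longrightarrow> y \<le> N + 2 \<longrightarrow> upper_step e \<sigma> N y \<and> (y \<le> N \<longrightarrow> lower_step e \<sigma> N y))) sequentially"
proof -
  obtain \<sigma> where \<sigma>: "\<sigma> > 0" and sl: "\<And>C. eventually (\<lambda>N. \<forall>y t. 1 \<le> y \<longrightarrow> y \<le> N + 2 \<longrightarrow> \<bar>t\<bar> \<le> \<sigma> \<longrightarrow>
     C * (hh N ^ 4 * XX N y) \<le> \<sigma> * rr N ^ 7 * profile e (Suc N) y
        + (Sg e t N * rr (Suc N) ^ 5 * real y - rr N ^ 5 * (alpha N y * (real y - 1) + (real y + 1)))) sequentially"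
    using slack[of e] by blast
  obtain CR where CR: "CR \<ge> 0" "\<And>N y. N \<ge> 16 \<Longrightarrow> y \<ge> 1 \<Longrightarrow> \<bar>residual e N y\<bar> * (1 + XX N y) ^ 0 \<le> CR * (hh N ^ 4 * XX N y ^ 1)"
    using rapid_bddD[OF residual_bound] by metis
  obtain CF where CF: "CF \<ge> 0" "\<And>N y. N \<ge> 18 \<Longrightarrow> y \<ge> 1 \<Longrightarrow> \<bar>profile e (N - 2) (y - 1)\<bar> * (1 + XX N y) \<le> CF * XX N y"
     "\<And>N y. N \<ge> 18 \<Longrightarrow> y \<ge> 1 \<Longrightarrow> - profile e (N - 2) (y - 1) \<le> CF * (hh N * XX N y)"
    using profile_bounds[of e] by blast
  define M where "M = \<bar>a\<bar> + \<bar>4/3 - e/4\<bar> + \<bar>\<sigma>\<bar>"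
  have M: "M \<ge> 0" by (simp add: M_def)
  define CB where "CB = e * (5 + 5 * M)"
  have CB: "CB \<ge> 0" using e M by (simp add: CB_def)
  \<comment> \<open>The four summands pay for the residual, for replacing \<open>betaq\<close> over
    two growth rates by \<open>h^3 / 4\<close>, for the cut-off at 0, and for the linear weight two
    steps back.\<close>
  define C where "C = CR + CB * CF + 16 * e * CF + 128 * e"
  have "eventually (\<lambda>N. (N \<ge> 18 \<and> (\<forall>t. \<bar>t\<bar> \<le> \<sigma> \<longrightarrow> 1 \<le> Sg e t N \<and> Sg e t N \<le> 3 \<and> 1 \<le> Sg e t (N - 1) * Sg e t (N - 2) \<and>
       \<bar>Sg e t (N - 1) * Sg e t (N - 2) - 4\<bar> \<le> 20 * (\<bar>a\<bar> + \<bar>4/3 - e/4\<bar> + \<bar>\<sigma>\<bar>) * hh N ^ 2)) \<and>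
     (\<forall>y t. 1 \<le> y \<longrightarrow> y \<le> N + 2 \<longrightarrow> \<bar>t\<bar> \<le> \<sigma> \<longrightarrow>
     C * (hh N ^ 4 * XX N y) \<le> \<sigma> * rr N ^ 7 * profile e (Suc N) y
        + (Sg e t N * rr (Suc N) ^ 5 * real y - rr N ^ 5 * (alpha N y * (real y - 1) + (real y + 1))))) sequentially"
    by (intro eventually_conj sl Sg_eventually)
  then have "eventually (\<lambda>N. (\<forall>t. \<bar>t\<bar> \<le> \<sigma> \<longrightarrow> 1 \<le> Sg e t N) \<and>
    (\<forall>y. 1 \<le> y \<longrightarrow> y \<le> N + 2 \<longrightarrow> upper_step e \<sigma> N y \<and> (y \<le> N \<longrightarrow> lower_step e \<sigma> N y))) sequentially"
  proof (rule eventually_mono)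
    fix N
    assume asm: "(N \<ge> 18 \<and> (\<forall>t. \<bar>t\<bar> \<le> \<sigma> \<longrightarrow> 1 \<le> Sg e t N \<and> Sg e t N \<le> 3 \<and> 1 \<le> Sg e t (N - 1) * Sg e t (N - 2) \<and>
       \<bar>Sg e t (N - 1) * Sg e t (N - 2) - 4\<bar> \<le> 20 * (\<bar>a\<bar> + \<bar>4/3 - e/4\<bar> + \<bar>\<sigma>\<bar>) * hh N ^ 2)) \<and>
     (\<forall>y t. 1 \<le> y \<longrightarrow> y \<le> N + 2 \<longrightarrow> \<bar>t\<bar> \<le> \<sigma> \<longrightarrow>
     C * (hh N ^ 4 * XX N y) \<le> \<sigma> * rr N ^ 7 * profile e (Suc N) y
        + (Sg e t N * rr (Suc N) ^ 5 * real y - rr N ^ 5 * (alpha N y * (real y - 1) + (real y + 1))))"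
    then have N: "N \<ge> 18" "N \<ge> 16" by auto
    have S: "1 \<le> Sg e t N" "1 \<le> Sg e t (N - 1) * Sg e t (N - 2)" "\<bar>Sg e t (N - 1) * Sg e t (N - 2) - 4\<bar> \<le> 20 * M * hh N ^ 2"
      if "\<bar>t\<bar> \<le> \<sigma>" for t using asm that by (auto simp: M_def)
    have slk: "C * (hh N ^ 4 * XX N y) \<le> \<sigma> * rr N ^ 7 * profile e (Suc N) y
        + (Sg e t N * rr (Suc N) ^ 5 * real y - rr N ^ 5 * (alpha N y * (real y - 1) + (real y + 1)))"
      if "1 \<le> y" "y \<le> N + 2" "\<bar>t\<bar> \<le> \<sigma>" for y t using asm that by blast
    define h where "h = hh N"
    have h: "0 < h" "h \<le> 1" using hX_facts[OF N(2), of 1] by (auto simp: h_def)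
    define bt where "bt = (\<lambda>t y. e * betaq N y / (Sg e t (N - 1) * Sg e t (N - 2)))"
    have bt: "\<bar>bt t y - e * h ^ 3 / 4\<bar> \<le> CB * (h ^ 5 * (1 + XX N y))" "\<bar>bt t y\<bar> \<le> 16 * e * h ^ 3"
      if y: "1 \<le> y" "y \<le> N + 2" and t: "\<bar>t\<bar> \<le> \<sigma>" for y t
    proof -
      define D where "D = Sg e t (N - 1) * Sg e t (N - 2)"
      define X where "X = XX N y"
      have X: "X > 0" using hX_facts[OF N(2) y(1)] by (simp add: X_def)
      have D: "1 \<le> D" "\<bar>D - 4\<bar> \<le> 20 * M * h ^ 2" using S[OF t] by (auto simp: D_def h_def)
      have bq: "\<bar>betaq N y - h ^ 3\<bar> \<le> 5 * h ^ 5 * X" using betaq_bound[OF N(2) y(1)] by (simp add: h_def X_def)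
      have "bt t y - e * h ^ 3 / 4 = e * ((betaq N y - h ^ 3) / D + h ^ 3 * ((4 - D) / (4 * D)))"
        using D unfolding bt_def D_def[symmetric] by (simp add: field_simps)
      moreover have "\<bar>(betaq N y - h ^ 3) / D\<bar> \<le> 5 * h ^ 5 * X"
      proof -
        have "\<bar>betaq N y - h ^ 3\<bar> / D \<le> \<bar>betaq N y - h ^ 3\<bar> / 1" using D by (intro divide_left_mono) auto
        then show ?thesis using bq D by simp
      qed
      moreover have "\<bar>h ^ 3 * ((4 - D) / (4 * D))\<bar> \<le> 5 * M * h ^ 5"
      proof -
        have "\<bar>4 - D\<bar> / (4 * D) \<le> (20 * M * h ^ 2) / (4 * 1)" using D by (intro frac_le) auto
        then have "h ^ 3 * (\<bar>4 - D\<bar> / (4 * D)) \<le> h ^ 3 * (5 * M * h ^ 2)" using h by (intro mult_left_mono) auto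
        also have "\<dots> = 5 * M * h ^ 5" by (simp add: eval_nat_numeral)
        finally show ?thesis using h D by (simp add: abs_mult)
      qed
      ultimately have "\<bar>bt t y - e * h ^ 3 / 4\<bar> \<le> e * (5 * h ^ 5 * X + 5 * M * h ^ 5)"
        using e by (simp add: abs_mult mult_left_mono order_trans[OF abs_triangle_ineq] add_mono)
      also have "\<dots> \<le> CB * (h ^ 5 * (1 + X))"
      proof -
        have "5 * h ^ 5 * X + 5 * M * h ^ 5 \<le> (5 + 5 * M) * (h ^ 5 * (1 + X))"
          using M X h by (simp add: algebra_simps)
        then show ?thesis using e unfolding CB_def by (simp add: mult_left_mono mult.assoc)
      qed
      finally show "\<bar>bt t y - e * h ^ 3 / 4\<bar> \<le> CB * (h ^ 5 * (1 + XX N y))" by (simp add: X_def)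
      have "\<bar>betaq N y\<bar> \<le> 16 * h ^ 3" using betaq_le[OF N(2) y] by (simp add: h_def)
      then have "e * \<bar>betaq N y\<bar> / D \<le> e * (16 * h ^ 3) / 1" using D e h by (intro frac_le mult_left_mono) auto
      then show "\<bar>bt t y\<bar> \<le> 16 * e * h ^ 3" using D e unfolding bt_def D_def[symmetric] by (simp add: abs_mult)
    qed
    show "(\<forall>t. \<bar>t\<bar> \<le> \<sigma> \<longrightarrow> 1 \<le> Sg e t N) \<and>
      (\<forall>y. 1 \<le> y \<longrightarrow> y \<le> N + 2 \<longrightarrow> upper_step e \<sigma> N y \<and> (y \<le> N \<longrightarrow> lower_step e \<sigma> N y))"
    proof (intro conjI allI impI)
      fix y assume y: "1 \<le> y" "y \<le> N + 2"
      define X where "X = XX N y"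
      have X: "X > 0" using hX_facts[OF N(2) y(1)] by (simp add: X_def)
      define F2 where "F2 = profile e (N - 2) (y - 1)"
      define w2 where "w2 = rr (N - 2) ^ 5 * (real y - 1)"
      have ry: "real (y - 1) = real y - 1" "real (y + 1) = real y + 1" using y by simp_all
      have R: "\<bar>residual e N y\<bar> \<le> CR * (h ^ 4 * X)" using CR(2)[OF N(2) y(1)] by (simp add: h_def X_def)
      have bF: "\<bar>(bt t y - e * h ^ 3 / 4) * F2\<bar> \<le> CB * CF * (h ^ 4 * X)" if "\<bar>t\<bar> \<le> \<sigma>" for t
      proof -
        have "\<bar>(bt t y - e * h ^ 3 / 4) * F2\<bar> \<le> CB * (h ^ 5 * (1 + X)) * \<bar>F2\<bar>"
          unfolding abs_mult using bt(1)[OF y that] by (intro mult_right_mono) (auto simp: X_def)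
        also have "\<dots> = CB * h ^ 5 * (\<bar>F2\<bar> * (1 + X))" by simp
        also have "\<dots> \<le> CB * h ^ 5 * (CF * X)"
          using CF(2)[OF N(1) y(1)] CB h by (intro mult_left_mono) (auto simp: F2_def X_def)
        also have "\<dots> = CB * CF * X * h ^ 5" by simp
        also have "\<dots> \<le> CB * CF * X * h ^ 4" using CB CF(1) X h by (intro mult_left_mono power_decreasing) auto
        finally show ?thesis by (simp add: mult_ac)
      qed
      have w2: "0 \<le> w2" "w2 \<le> 8 * (rr N ^ 3 * X)"
      proof -
        show "0 \<le> w2" using y by (simp add: w2_def rr_def hh_nonneg)
        have "w2 \<le> (8 * rr N ^ 5) * real y" unfolding w2_def
          using rr_minus2(1)[OF N(2)] y rr_facts[OF N(2)] by (intro mult_mono) auto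
        also have "\<dots> = 8 * (rr N ^ 5 * real y)" by simp
        finally show "w2 \<le> 8 * (rr N ^ 3 * X)" unfolding scale_identities X_def .
      qed
      have bw: "\<bar>bt t y * w2\<bar> \<le> 128 * e * (h ^ 4 * X)" if "\<bar>t\<bar> \<le> \<sigma>" for t
      proof -
        have "\<bar>bt t y * w2\<bar> \<le> (16 * e * h ^ 3) * (8 * (rr N ^ 3 * X))"
          unfolding abs_mult using bt(2)[OF y that] w2 e h by (intro mult_mono) auto
        also have "\<dots> = 128 * e * X * (h ^ 3 * rr N ^ 3)" by simp
        also have "\<dots> \<le> 128 * e * X * (h ^ 3 * h)"
        proof (intro mult_left_mono)
          show "rr N ^ 3 \<le> h" unfolding h_def rr_sq[symmetric] using rr_facts[OF N(2)] by (intro power_decreasing) auto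
        qed (use e X h in auto)
        finally show ?thesis by (simp add: eval_nat_numeral mult_ac)
      qed
      have ex: "C * (h ^ 4 * X) = CR * (h ^ 4 * X) + CB * CF * (h ^ 4 * X) + 16 * e * CF * (h ^ 4 * X) + 128 * e * (h ^ 4 * X)"
        by (simp add: C_def algebra_simps)
      have c16: "0 \<le> 16 * e * CF * (h ^ 4 * X)" using e CF(1) h X by simp
      {
        have st: "\<bar>\<sigma>\<bar> \<le> \<sigma>" using \<sigma> by simp
        have "Sg e \<sigma> N * (profile e (Suc N) y + rr (Suc N) ^ 5 * real y)
          - (alpha N y * (profile e N (y - 1) + rr N ^ 5 * (real y - 1)) + (profile e N (y + 1) + rr N ^ 5 * (real y + 1))
              - bt \<sigma> y * (F2 + w2))
          = (\<sigma> * rr N ^ 7 * profile e (Suc N) y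
              + (Sg e \<sigma> N * rr (Suc N) ^ 5 * real y - rr N ^ 5 * (alpha N y * (real y - 1) + (real y + 1))))
            - residual e N y + (bt \<sigma> y - e * h ^ 3 / 4) * F2 + bt \<sigma> y * w2"
          unfolding residual_def Sg_def F2_def h_def by (simp add: algebra_simps)
        also have "\<dots> \<ge> 0"
          using slk[OF y st] R bF[OF st] bw[OF st] ex c16 unfolding h_def[symmetric] X_def[symmetric] by linarith
        finally show "upper_step e \<sigma> N y"
          unfolding upper_step_def upper_weight_def bt_def F2_def w2_def ry by linarith
      }
      {
        assume yN: "y \<le> N"
        have st: "\<bar>-\<sigma>\<bar> \<le> \<sigma>" using \<sigma> by simp
        \<comment> \<open>Here \<open>y <= N\<close> is used: \<open>betaq\<close> changes sign at
          \<open>y = N\<close>.\<close>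
        have b0: "bt (-\<sigma>) y \<ge> 0"
          unfolding bt_def
        proof (rule divide_nonneg_nonneg)
          show "0 \<le> e * betaq N y"
            unfolding betaq_def using e yN N y by (intro mult_nonneg_nonneg divide_nonneg_nonneg) auto
        qed (use S(2)[OF st] in linarith)
        \<comment> \<open>The profile lies above \<open>- CF * h * X\<close>, so the cut-off costs
          at most that much; with the coefficient, which is at most \<open>16 e h^3\<close>, the
          cost is of order \<open>h^4 X\<close>.\<close>
        have mx: "bt (-\<sigma>) y * max (F2 - w2) 0 \<le> bt (-\<sigma>) y * F2 + 16 * e * CF * (h ^ 4 * X)"
        proof -
          have neg: "- F2 \<le> CF * (h * X)" using CF(3)[OF N(1) y(1)] by (simp add: F2_def h_def X_def)
          have "0 \<le> CF * (h * X)" using CF(1) h X by simp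
          then have "max (F2 - w2) 0 \<le> F2 + CF * (h * X)" using neg w2 by linarith
          then have "bt (-\<sigma>) y * max (F2 - w2) 0 \<le> bt (-\<sigma>) y * (F2 + CF * (h * X))" using b0 by (intro mult_left_mono)
          moreover have "bt (-\<sigma>) y * (CF * (h * X)) \<le> (16 * e * h ^ 3) * (CF * (h * X))"
            using bt(2)[OF y st] CF(1) h X by (intro mult_right_mono) auto
          then have "bt (-\<sigma>) y * (F2 + CF * (h * X)) \<le> bt (-\<sigma>) y * F2 + 16 * e * CF * (h ^ 4 * X)"
            by (simp add: distrib_left eval_nat_numeral mult_ac)
          ultimately show ?thesis by linarith
        qed
        have "alpha N y * (profile e N (y - 1) - rr N ^ 5 * (real y - 1)) + (profile e N (y + 1) - rr N ^ 5 * (real y + 1))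
            - bt (-\<sigma>) y * max (F2 - w2) 0 - Sg e (-\<sigma>) N * (profile e (Suc N) y - rr (Suc N) ^ 5 * real y)
          = (\<sigma> * rr N ^ 7 * profile e (Suc N) y
              + (Sg e (-\<sigma>) N * rr (Suc N) ^ 5 * real y - rr N ^ 5 * (alpha N y * (real y - 1) + (real y + 1))))
            + residual e N y - (bt (-\<sigma>) y - e * h ^ 3 / 4) * F2 + (bt (-\<sigma>) y * F2 - bt (-\<sigma>) y * max (F2 - w2) 0)"
          unfolding residual_def Sg_def F2_def h_def by (simp add: algebra_simps)
        also have "\<dots> \<ge> 0"
        proof -
          have "0 \<le> 128 * e * (h ^ 4 * X)" using e h X by simp
          then show ?thesis
            using slk[OF y st] R bF[OF st] ex mx unfolding h_def[symmetric] X_def[symmetric] by linarith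
        qed
        finally show "lower_step e \<sigma> N y"
          unfolding lower_step_def lower_weight_def bt_def F2_def w2_def ry by linarith
      }
    qed (use S in auto)
  qed
  then show ?thesis using \<sigma> by blast
qed

end

section \<open>Comparison principle\<close>

text \<open>\<open>G l j\<close> is the weighted number of forests of \<open>l\<close> trees with \<open>j\<close> internal nodes;
  \<open>e = 0\<close> for relaxed and \<open>e = 1\<close> for compacted trees.\<close>
locale signed_recurrence =
  fixes e :: real and G :: "nat \<Rightarrow> nat \<Rightarrow> real"
  assumes e: "0 \<le> e" "e \<le> 1"
    and G_0: "\<And>j. G 0 j = (if j = 0 then 1 else 0)"
    and G_Suc_0: "\<And>l. G (Suc l) 0 = G l 0"
    and G_Suc_Suc: "\<And>l j. G (Suc l) (Suc j) = (real j + 2) * G l (Suc j) + G (Suc (Suc l)) j - e * real j * G l j"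
begin

text \<open>For forest sums this is the weight of the forests with \<open>l + 1\<close> trees whose
  last tree is not a leaf.\<close>

definition b :: "nat \<Rightarrow> nat \<Rightarrow> real" where
  "b l j = G (Suc l) j - (real j + 1) * G l j"

lemma G_col_0: "G l 0 = 1"
  by (induction l) (auto simp: G_0 G_Suc_0)

lemma b_0: "b l 0 = 0"
  by (simp add: b_def G_col_0)

text \<open>The root of a last tree that is not a leaf joins two trees: the right one is no leaf, or
  only the left one is no leaf, or both are leaves and form a cherry. All three coefficients are
  nonnegative, in contrast to the recurrence for \<open>G\<close> alone.\<close>

lemma b_Suc: "b l (Suc j) = b (Suc l) j + (real j + 1) * b l j + ((real j + 1) ^ 2 - e * real j) * G l j"
  by (simp add: b_def G_Suc_Suc algebra_simps power2_eq_square)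

lemma G_Suc: "G (Suc l) j = (real j + 1) * G l j + b l j"
  by (simp add: b_def)

lemma cherry_coeff: "(real j + 1) ^ 2 - e * real j > 0"
proof -
  have "e * real j \<le> 1 * real j" using e by (intro mult_right_mono) auto
  moreover have "(real j + 1) ^ 2 = real j * real j + 2 * real j + 1" by (simp add: power2_eq_square algebra_simps)
  moreover have "0 \<le> real j * real j" by simp
  ultimately show ?thesis by linarith
qed

text \<open>Positivity of \<open>b\<close> at \<open>j + 1\<close> rests on \<open>G\<close> and
  \<open>b\<close> at \<open>j\<close>, and positivity of \<open>G\<close> at fixed \<open>j\<close>
  follows from that of \<open>b\<close> by induction on \<open>l\<close>; hence the joint induction
  on \<open>j\<close>.\<close>

lemma G_pos_aux: "(l > 0 \<longrightarrow> G l j > 0) \<and> (j > 0 \<longrightarrow> b l j > 0)"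
proof -
  have "\<forall>l. (\<forall>l. G (Suc l) j > 0) \<and> b l (Suc j) > 0" for j
  proof (induction j)
    case 0
    then show ?case by (auto simp: G_col_0 b_Suc b_0)
  next
    case (Suc j)
    have G1: "G (Suc l) (Suc j) > 0" for l
    proof (induction l)
      case 0 then show ?case using Suc by (simp add: G_Suc G_0)
    next
      case (Suc l)
      have "b (Suc l) (Suc j) > 0" using \<open>\<forall>l. (\<forall>l. G (Suc l) j > 0) \<and> b l (Suc j) > 0\<close> by blast
      moreover have "(real (Suc j) + 1) * G (Suc l) (Suc j) > 0" using Suc by simp
      ultimately show ?case unfolding G_Suc[of "Suc l"] by linarith
    qed
    have "b l (Suc (Suc j)) > 0" for l
    proof -
      have "G l (Suc j) \<ge> 0" using G1 by (cases l) (auto simp: G_0 less_imp_le)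
      then have "((real (Suc j) + 1) ^ 2 - e * real (Suc j)) * G l (Suc j) \<ge> 0"
        using cherry_coeff[of "Suc j"] by (intro mult_nonneg_nonneg) auto
      moreover have "b (Suc l) (Suc j) > 0" "(real (Suc j) + 1) * b l (Suc j) > 0" using Suc by (auto intro!: mult_pos_pos)
      ultimately show ?thesis unfolding b_Suc[of l "Suc j"] by linarith
    qed
    then show ?case using G1 by blast
  qed
  then show ?thesis by (metis gr0_implies_Suc)
qed

lemma G_pos: "l > 0 \<Longrightarrow> G l j > 0" using G_pos_aux by blast
lemma b_pos: "j > 0 \<Longrightarrow> b l j > 0" using G_pos_aux by blast
lemma G_nonneg: "G l j \<ge> 0" using G_pos[of l j] by (cases l) (auto simp: G_0 less_imp_le)
lemma b_nonneg: "b l j \<ge> 0" using b_pos[of j l] by (cases j) (auto simp: b_0 less_imp_le)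

lemma finite_layers: "finite {(l, j). l + 2 * j < (n::nat)}"
  by (rule finite_subset[of _ "{..n} \<times> {..n}"]) auto

text \<open>The signed recurrence for \<open>G\<close> is a recurrence with nonnegative coefficients for the pair \<open>(G, b)\<close>;
  with \<open>B\<close> built from \<open>Q\<close> as \<open>b\<close> is from \<open>G\<close>, the pair \<open>(Q, B)\<close> satisfies the same recurrence
  with the inequality assumed of \<open>Q\<close>, so that it can be compared with \<open>(G, b)\<close>.\<close>
lemma upper_comparison:
  fixes Q :: "nat \<Rightarrow> nat \<Rightarrow> real"
  assumes n1: "n1 > 0" and Q0: "\<And>j. Q 0 j = 0"
    and U1: "\<And>l j. l + 2 * j + 2 \<ge> n1 \<Longrightarrow> (real j + 2) * Q l (Suc j) + Q (Suc (Suc l)) j - e * real j * Q l j \<le> Q (Suc l) (Suc j)"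
    and U0: "\<And>l. l \<ge> n1 \<Longrightarrow> Q l 0 \<le> Q (Suc l) 0"
    and pos: "\<And>l j. l + 2 * j \<ge> n1 \<Longrightarrow> Q (Suc l) j > 0"
    and Bpos: "\<And>l j. l + 2 * j + 2 \<ge> n1 \<Longrightarrow> e * real j * Q l j < Q (Suc (Suc l)) j"
  shows "\<exists>K>0. \<forall>l j. l + 2 * j \<ge> n1 \<longrightarrow> G (Suc l) j \<le> K * Q (Suc l) j"
proof -
  define B where "B = (\<lambda>l j. Q (Suc l) j - (real j + 1) * Q l j)"
  have B0: "B l 0 \<ge> 0" if "l \<ge> n1" for l using U0[OF that] by (simp add: B_def)
  have B1: "Q (Suc (Suc l)) j - e * real j * Q l j \<le> B l (Suc j)" if "l + 2 * j + 2 \<ge> n1" for l j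
    using U1[OF that] by (simp add: B_def algebra_simps)
  have B1p: "B l (Suc j) > 0" if "l + 2 * j + 2 \<ge> n1" for l j
    using B1[OF that] Bpos[OF that] by linarith
  \<comment> \<open>The recurrence for the pair reaches back at most three layers of constant
    \<open>l + 2 * j\<close>, so \<open>K\<close> is fixed on the layers below
    \<open>n1 + 3\<close>. The maxima run over all of \<open>T\<close> but are applied only from
    layer \<open>n1\<close> on, where the denominators are positive.\<close>
  define T where "T = {(l, j). l + 2 * j < n1 + 3}"
  define K where "K = 1 + Max ((\<lambda>(l, j). \<bar>G (Suc l) j / Q (Suc l) j\<bar>) ` T) + Max ((\<lambda>(l, j). \<bar>b l j / B l j\<bar>) ` T)"
  have fin: "finite T" unfolding T_def by (rule finite_layers)
  have ne: "(0, 0) \<in> T" by (simp add: T_def)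
  have M1: "\<bar>G (Suc l) j / Q (Suc l) j\<bar> \<le> Max ((\<lambda>(l, j). \<bar>G (Suc l) j / Q (Suc l) j\<bar>) ` T)" if "(l, j) \<in> T" for l j
    using that fin by (intro Max_ge) auto
  have M2: "\<bar>b l j / B l j\<bar> \<le> Max ((\<lambda>(l, j). \<bar>b l j / B l j\<bar>) ` T)" if "(l, j) \<in> T" for l j
    using that fin by (intro Max_ge) auto
  have m0: "0 \<le> Max ((\<lambda>(l, j). \<bar>G (Suc l) j / Q (Suc l) j\<bar>) ` T)" "0 \<le> Max ((\<lambda>(l, j). \<bar>b l j / B l j\<bar>) ` T)"
    by (rule order_trans[OF abs_ge_zero M1[OF ne]], rule order_trans[OF abs_ge_zero M2[OF ne]])
  have K: "K > 0" using m0 by (simp add: K_def)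
  have K1: "G (Suc l) j \<le> K * Q (Suc l) j" if "(l, j) \<in> T" "l + 2 * j \<ge> n1" for l j
  proof -
    have "G (Suc l) j / Q (Suc l) j \<le> K" using M1[OF that(1)] m0 unfolding K_def by linarith
    then show ?thesis using pos[OF that(2)] by (simp add: field_simps)
  qed
  have K2: "b l j \<le> K * B l j" if "(l, j) \<in> T" "l + 2 * j \<ge> n1" for l j
  proof (cases j)
    case 0 then show ?thesis using B0[of l] K that by (simp add: b_0)
  next
    case (Suc k)
    have "b l j / B l j \<le> K" using M2[OF that(1)] m0 unfolding K_def by linarith
    then show ?thesis using B1p[of l k] that Suc by (simp add: field_simps)
  qed
  have "l + 2 * j = n \<longrightarrow> n \<ge> n1 \<longrightarrow> G (Suc l) j \<le> K * Q (Suc l) j \<and> b l j \<le> K * B l j" for n l j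
  proof (induction n arbitrary: l j rule: less_induct)
    case (less n)
    show ?case
    proof (intro impI)
      assume n: "l + 2 * j = n" "n \<ge> n1"
      show "G (Suc l) j \<le> K * Q (Suc l) j \<and> b l j \<le> K * B l j"
      proof (cases "n < n1 + 3")
        case True then show ?thesis using K1[of l j] K2[of l j] n by (auto simp: T_def)
      next
        case False
        have Gl: "G l j \<le> K * Q l j"
        proof (cases l)
          case 0 then show ?thesis using False n by (auto simp: G_0 Q0)
        next
          case (Suc l') then show ?thesis using less.IH[of "n - 1" l' j] n False by auto
        qed
        have bl: "b l j \<le> K * B l j"
        proof (cases j)
          case 0 then show ?thesis using B0[of l] K n by (simp add: b_0)
        next
          case (Suc k)
          have Gk: "G l k \<le> K * Q l k"
          proof (cases l)
            case 0 then show ?thesis using False n Suc by (auto simp: G_0 Q0)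
          next
            case (Suc l') then show ?thesis using less.IH[of "n - 3" l' k] n False \<open>j = Suc k\<close> by auto
          qed
          have b1: "b (Suc l) k \<le> K * B (Suc l) k" using less.IH[of "n - 1" "Suc l" k] n False Suc by auto
          have b2: "b l k \<le> K * B l k" using less.IH[of "n - 2" l k] n False Suc by auto
          \<comment> \<open>With the induction hypotheses inserted, the right side of
            \<open>b_Suc\<close> regroups to \<open>K\<close> times the left side of
            \<open>B1\<close>.\<close>
          have "b l j \<le> K * B (Suc l) k + (real k + 1) * (K * B l k) + ((real k + 1) ^ 2 - e * real k) * (K * Q l k)"
            unfolding Suc b_Suc using cherry_coeff[of k] b1 b2 Gk by (intro add_mono mult_left_mono) auto
          also have "\<dots> = K * (Q (Suc (Suc l)) k - e * real k * Q l k)"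
            by (simp add: B_def algebra_simps power2_eq_square)
          also have "\<dots> \<le> K * B l j" unfolding Suc using K n Suc by (intro mult_left_mono B1) auto
          finally show ?thesis .
        qed
        have "G (Suc l) j \<le> (real j + 1) * (K * Q l j) + K * B l j"
          unfolding G_Suc using Gl bl by (intro add_mono mult_left_mono) auto
        also have "\<dots> = K * Q (Suc l) j" by (simp add: B_def algebra_simps)
        finally show ?thesis using bl by simp
      qed
    qed
  qed
  then show ?thesis using K by blast
qed

text \<open>A subsolution cut off at 0 satisfies its inequality only where it is positive. Where
  \<open>Q (Suc l) j = 0\<close>, also \<open>B l j <= 0\<close>, and both claims hold because
  \<open>G\<close> and \<open>b\<close> are nonnegative.\<close>

lemma lower_comparison:
  fixes Q :: "nat \<Rightarrow> nat \<Rightarrow> real"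
  assumes n1: "n1 > 0" and Q0: "\<And>j. Q 0 j = 0" and Qnn: "\<And>l j. Q l j \<ge> 0"
    and L1: "\<And>l j. l + 2 * j + 2 \<ge> n1 \<Longrightarrow> Q (Suc l) (Suc j) > 0 \<Longrightarrow>
       Q (Suc l) (Suc j) \<le> (real j + 2) * Q l (Suc j) + Q (Suc (Suc l)) j - e * real j * Q l j"
    and L0: "\<And>l. l \<ge> n1 \<Longrightarrow> Q (Suc l) 0 = 0"
  shows "\<exists>K>0. \<forall>l j. l + 2 * j \<ge> n1 \<longrightarrow> K * Q (Suc l) j \<le> G (Suc l) j"
proof -
  define B where "B = (\<lambda>l j. Q (Suc l) j - (real j + 1) * Q l j)"
  have Bz: "B l j \<le> 0" if "Q (Suc l) j = 0" for l j using that Qnn[of l j] by (simp add: B_def)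
  define T where "T = {(l, j). l + 2 * j < n1 + 3}"
  define M where "M = 1 + Max ((\<lambda>(l, j). \<bar>Q (Suc l) j / G (Suc l) j\<bar>) ` T) + Max ((\<lambda>(l, j). \<bar>B l j / b l j\<bar>) ` T)"
  define K where "K = 1 / M"
  have fin: "finite T" unfolding T_def by (rule finite_layers)
  have ne: "(0, 0) \<in> T" by (simp add: T_def)
  have M1: "\<bar>Q (Suc l) j / G (Suc l) j\<bar> \<le> Max ((\<lambda>(l, j). \<bar>Q (Suc l) j / G (Suc l) j\<bar>) ` T)" if "(l, j) \<in> T" for l j
    using that fin by (intro Max_ge) auto
  have M2: "\<bar>B l j / b l j\<bar> \<le> Max ((\<lambda>(l, j). \<bar>B l j / b l j\<bar>) ` T)" if "(l, j) \<in> T" for l j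
    using that fin by (intro Max_ge) auto
  have m0: "0 \<le> Max ((\<lambda>(l, j). \<bar>Q (Suc l) j / G (Suc l) j\<bar>) ` T)" "0 \<le> Max ((\<lambda>(l, j). \<bar>B l j / b l j\<bar>) ` T)"
    by (rule order_trans[OF abs_ge_zero M1[OF ne]], rule order_trans[OF abs_ge_zero M2[OF ne]])
  have M: "M > 0" using m0 by (simp add: M_def)
  then have K: "K > 0" by (simp add: K_def)
  have K1: "K * Q (Suc l) j \<le> G (Suc l) j" if "(l, j) \<in> T" for l j
  proof -
    have "Q (Suc l) j / G (Suc l) j \<le> M" using M1[OF that(1)] m0 unfolding M_def by linarith
    then show ?thesis using G_pos[of "Suc l" j] M by (simp add: K_def field_simps)
  qed
  have K2: "K * B l j \<le> b l j" if "(l, j) \<in> T" "l + 2 * j \<ge> n1" for l j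
  proof (cases j)
    case 0 then show ?thesis using Bz[of l j] L0[of l] K that by (simp add: b_0 mult_nonneg_nonpos)
  next
    case (Suc k)
    have "B l j / b l j \<le> M" using M2[OF that(1)] m0 unfolding M_def by linarith
    then show ?thesis using b_pos[of j l] M Suc by (simp add: K_def field_simps)
  qed
  have "l + 2 * j = n \<longrightarrow> n \<ge> n1 \<longrightarrow> K * Q (Suc l) j \<le> G (Suc l) j \<and> K * B l j \<le> b l j" for n l j
  proof (induction n arbitrary: l j rule: less_induct)
    case (less n)
    show ?case
    proof (intro impI)
      assume n: "l + 2 * j = n" "n \<ge> n1"
      show "K * Q (Suc l) j \<le> G (Suc l) j \<and> K * B l j \<le> b l j"
      proof (cases "n < n1 + 3")
        case True then show ?thesis using K1[of l j] K2[of l j] n by (auto simp: T_def)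
      next
        case big: False
        show ?thesis
        proof (cases "Q (Suc l) j = 0")
          case True
          then have "K * B l j \<le> 0" using Bz[OF True] K by (simp add: mult_nonneg_nonpos)
          then show ?thesis using True G_nonneg[of "Suc l" j] b_nonneg[of l j] by simp
        next
          case False
          then have Qp: "Q (Suc l) j > 0" using Qnn[of "Suc l" j] by simp
          have "j \<noteq> 0" using L0[of l] n False by (cases j) auto
          then obtain k where k: "j = Suc k" by (cases j) auto
          have Gl: "K * Q l j \<le> G l j"
          proof (cases l)
            case 0 then show ?thesis by (simp add: Q0 G_nonneg)
          next
            case (Suc l') then show ?thesis using less.IH[of "n - 1" l' j] n big by auto
          qed
          have Gk: "K * Q l k \<le> G l k"
          proof (cases l)
            case 0 then show ?thesis by (simp add: Q0 G_nonneg)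
          next
            case (Suc l') then show ?thesis using less.IH[of "n - 3" l' k] n big k by auto
          qed
          have b1: "K * B (Suc l) k \<le> b (Suc l) k" using less.IH[of "n - 1" "Suc l" k] n big k by auto
          have b2: "K * B l k \<le> b l k" using less.IH[of "n - 2" l k] n big k by auto
          have "K * B l j \<le> K * (Q (Suc (Suc l)) k - e * real k * Q l k)"
            using L1[of l k] n k Qp K by (intro mult_left_mono) (auto simp: B_def algebra_simps)
          also have "\<dots> = K * B (Suc l) k + (real k + 1) * (K * B l k) + ((real k + 1) ^ 2 - e * real k) * (K * Q l k)"
            by (simp add: B_def algebra_simps power2_eq_square)
          also have "\<dots> \<le> b l j"
            unfolding k b_Suc using cherry_coeff[of k] b1 b2 Gk by (intro add_mono mult_left_mono) auto
          finally have bl: "K * B l j \<le> b l j" .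
          have "K * Q (Suc l) j = (real j + 1) * (K * Q l j) + K * B l j" by (simp add: B_def algebra_simps)
          also have "\<dots> \<le> G (Suc l) j"
            unfolding G_Suc using Gl bl by (intro add_mono mult_left_mono) auto
          finally show ?thesis using bl by simp
        qed
      qed
    qed
  qed
  then show ?thesis using K by blast
qed

end

section \<open>Asymptotics of the recurrence\<close>

text \<open>The forest with \<open>l\<close> trees and \<open>j\<close> internal nodes is reached at time \<open>l + 2j - 1\<close> and height \<open>l\<close>.\<close>
lemma scaled_recurrence:
  fixes S :: "nat \<Rightarrow> real" and X :: "nat \<Rightarrow> nat \<Rightarrow> real"
  assumes N: "N = l + 2 * j + 1" "N \<ge> n0 + 2" and Sall: "\<forall>k\<ge>n0. S k > 0" and lj: "l + j \<ge> 1"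
    and Hn_def: "Hn = (\<lambda>N. \<Prod>k\<in>{n0..<N}. S k)"
    and Q_def: "Q = (\<lambda>l j. fact (l + j - 1) * Hn (l + 2 * j - 1) * X (l + 2 * j - 1) l)"
    and c_def: "c = fact (l + j + 1) * Hn N"
  shows "c > 0" "Q (Suc l) (Suc j) = c * (S N * X (Suc N) (Suc l))"
    "(real j + 2) * Q l (Suc j) = c * (alpha N (Suc l) * X N l)"
    "Q (Suc (Suc l)) j = c * X N (Suc (Suc l))"
    "e * real j * Q l j = c * (e * betaq N (Suc l) / (S (N - 1) * S (N - 2)) * X (N - 2) l)"
proof -
  have S: "S k > 0" if "k \<ge> n0" for k using Sall that by blast
  have Hpos: "Hn N > 0" unfolding Hn_def using S by (intro prod_pos) auto
  then show "c > 0" by (simp add: c_def)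
  have HS: "Hn (Suc M) = Hn M * S M" if "M \<ge> n0" for M
    unfolding Hn_def using that by (simp add: prod.atLeastLessThan_Suc)
  show "Q (Suc l) (Suc j) = c * (S N * X (Suc N) (Suc l))"
    using HS[of N] N by (simp add: Q_def c_def)
  have al: "alpha N (Suc l) = (real j + 2) / (real l + real j + 1)"
    unfolding alpha_def N by (simp add: field_simps)
  have f1: "fact (l + j + 1) = (real l + real j + 1) * fact (l + j)" by simp
  show "(real j + 2) * Q l (Suc j) = c * (alpha N (Suc l) * X N l)"
    unfolding al c_def f1 using N by (simp add: Q_def add_pos_nonneg)
  show "Q (Suc (Suc l)) j = c * X N (Suc (Suc l))"
    using N by (simp add: Q_def c_def)
  \<comment> \<open>The hypothesis \<open>l + j >= 1\<close> keeps the subtraction in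
    \<open>fact (l + j - 1)\<close> exact.\<close>
  obtain m where m: "l + j = Suc m" using lj by (cases "l + j") auto
  have f2: "fact (l + j) = (real l + real j) * fact (l + j - 1)"
    using m by (simp add: m flip: of_nat_add)
  have be: "betaq N (Suc l) = real j / ((real l + real j + 1) * (real l + real j))"
  proof -
    have f: "real N - real (Suc l) = 2 * real j" "real N + real (Suc l) = 2 * (real l + real j + 1)"
      "real N + real (Suc l) - 2 = 2 * (real l + real j)" by (simp_all add: N)
    have "2 * (2 * x) / (2 * u * (2 * v)) = x / (u * v)" for x u v :: real by simp
    then show ?thesis unfolding betaq_def f(3) unfolding f(1,2) .
  qed
  have N2: "Suc (N - 2) = N - 1" "Suc (N - 1) = N" using N by auto
  have "Hn N = Hn (N - 1) * S (N - 1)" using HS[of "N - 1"] N N2 by simp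
  also have "Hn (N - 1) = Hn (N - 2) * S (N - 2)" using HS[of "N - 2"] N N2 by simp
  finally have HN: "Hn N = Hn (N - 2) * S (N - 2) * S (N - 1)" .
  have "N - 1 \<ge> n0" "N - 2 \<ge> n0" using N by auto
  then have S0: "S (N - 1) \<noteq> 0" "S (N - 2) \<noteq> 0" using S by (metis less_irrefl)+
  have N3: "N - 2 = l + 2 * j - 1" using N by auto
  have nz: "real l + real j > 0" 
  proof -
    have "real (l + j) > 0" using lj by simp
    then show ?thesis by simp
  qed
  have "c * (e * betaq N (Suc l) / (S (N - 1) * S (N - 2)) * X (N - 2) l)
     = e * real j * (fact (l + j - 1) * Hn (N - 2) * X (N - 2) l)"
    unfolding c_def f1 f2 be HN using S0 nz by (simp add: divide_simps add_pos_pos)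
  then show "e * real j * Q l j = c * (e * betaq N (Suc l) / (S (N - 1) * S (N - 2)) * X (N - 2) l)"
    unfolding Q_def N3 by simp
qed

text \<open>The exponent \<open>7/6\<close> is that of the perturbation
  \<open>r^7 = (2/N)^(7/6)\<close>, the slowest of the remainder terms in the logarithm of the
  growth rate. It exceeds 1, so the telescoping sum converges.\<close>

lemma increments_summable_imp_bounded:
  fixes d :: "nat \<Rightarrow> real"
  assumes "(\<lambda>n. d (Suc n) - d n) \<in> O(\<lambda>n. real n powr (-7/6))"
  shows "\<exists>M. \<forall>n. \<bar>d n\<bar> \<le> M"
proof -
  have "summable (\<lambda>n. norm (real n powr (-7/6)))" by (simp add: summable_real_powr_iff)
  then have "summable (\<lambda>n. d (Suc n) - d n)" using assms by (rule summable_comparison_test_bigo)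
  then have "convergent (\<lambda>n. \<Sum>k<n. d (Suc k) - d k)" by (simp add: summable_iff_convergent)
  then have "Bseq (\<lambda>n. \<Sum>k<n. d (Suc k) - d k)" by (rule convergent_imp_Bseq)
  then obtain M where M: "\<And>n. norm (\<Sum>k<n. d (Suc k) - d k) \<le> M" by (auto simp: Bseq_def)
  have "\<bar>d n\<bar> \<le> M + \<bar>d 0\<bar>" for n
    using M[of n] by (simp add: sum_lessThan_telescope)
  then show ?thesis by blast
qed

section \<open>The product of the growth rates\<close>

lemma rr_powr: "N > 0 \<Longrightarrow> rr N ^ 7 = (2 / real N) powr (7/6)"
proof -
  assume N: "N > 0"
  have "rr N = hh N powr (1/2)" by (simp add: rr_def powr_half_sqrt hh_nonneg)
  also have "\<dots> = (2 / real N) powr (1/6)" by (simp add: hh_def powr_powr)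
  finally have e: "rr N = (2 / real N) powr (1/6)" .
  have "rr N ^ 7 = rr N powr real 7" using e N by (subst powr_realpow) auto
  then show ?thesis by (simp add: e powr_powr)
qed

lemma hh_sq_powr: "N > 0 \<Longrightarrow> hh N ^ 2 = (2 / real N) powr (2/3)"
  by (simp add: hh_def powr_powr flip: powr_realpow)

lemma cube_root_increment: "(\<lambda>n. (real n + 1) powr (1/3) - real n powr (1/3) - 1/3 * real n powr (-2/3)) \<in> O(\<lambda>n. real n powr (-7/6))"
  by real_asymp

lemma ln_increment: "(\<lambda>n. ln (real n + 1) - ln (real n) - 1 / real n) \<in> O(\<lambda>n. real n powr (-7/6))"
  by real_asymp

lemma bigo_cmult: "f \<in> O[F](g) \<Longrightarrow> (\<lambda>x. c * f x) \<in> O[F](g)" for c :: real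
  by (cases "c = 0") simp_all

context airy_shift
begin

definition growth :: "real \<Rightarrow> nat \<Rightarrow> real" where
  "growth e N = 2 ^ N * exp (3 * a * 2 powr (-1/3) * real N powr (1/3)) * real N powr (4/3 - e/4)"

text \<open>After taking logarithms, the two main terms of the rate agree with the increments of
  \<open>3 a 2^(-1/3) N^(1/3)\<close> and \<open>(4/3 - e/4) ln N\<close>. The remaining increments
  are summable, those of the perturbation \<open>t\<close> included, so every \<open>t\<close> leads
  to the same order of growth.\<close>

lemma product_asymptotics:
  assumes S: "\<And>k. k \<ge> n0 \<Longrightarrow> Sg e t k > 0"
  shows "\<exists>c C. 0 < c \<and> 0 < C \<and> eventually (\<lambda>N. c * growth e N \<le> (\<Prod>k\<in>{n0..<N}. Sg e t k) \<and> (\<Prod>k\<in>{n0..<N}. Sg e t k) \<le> C * growth e N) sequentially"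
proof -
  define Hn where "Hn = (\<lambda>N. \<Prod>k\<in>{n0..<N}. Sg e t k)"
  define w where "w = (\<lambda>N. real N * ln 2 + 3 * a * 2 powr (-1/3) * real N powr (1/3) + (4/3 - e/4) * ln (real N))"
  define d where "d = (\<lambda>N. ln (Hn N) - w N)"
  define u where "u = (\<lambda>N. Sg e t N / 2 - 1)"
  have Hpos: "Hn N > 0" for N unfolding Hn_def using S by (intro prod_pos) auto
  have incr: "d (Suc N) - d N = (ln (1 + u N) - u N) + t / 2 * (2 / real N) powr (7/6)
      - 3 * a * 2 powr (-1/3) * ((real N + 1) powr (1/3) - real N powr (1/3) - 1/3 * real N powr (-2/3))
      - (4/3 - e/4) * (ln (real N + 1) - ln (real N) - 1 / real N)" if N: "N \<ge> max n0 1" for N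
  proof -
    have Hs: "ln (Hn (Suc N)) = ln (Hn N) + ln (Sg e t N)"
    proof -
      have "Hn (Suc N) = Hn N * Sg e t N" using N by (simp add: Hn_def prod.atLeastLessThan_Suc)
      then show ?thesis using ln_mult[of "Hn N" "Sg e t N"] Hpos[of N] S[of N] N by simp
    qed
    have "Sg e t N = 2 * (1 + u N)" by (simp add: u_def)
    then have Sl: "ln (Sg e t N) = ln 2 + ln (1 + u N)" using S[of N] N ln_mult[of 2 "1 + u N"] by simp
    have h2: "hh N ^ 2 / 2 = 2 powr (-1/3) * real N powr (-2/3)"
    proof -
      have "hh N ^ 2 = 2 powr (2/3) * real N powr (-2/3)"
        using hh_sq_powr[of N] N by (simp add: powr_divide powr_minus_divide)
      also have "(2::real) powr (2/3) = 2 powr (-1/3 + 1)" by simp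
      also have "\<dots> = 2 powr (-1/3) * 2" by (subst powr_add) simp
      finally show ?thesis by simp
    qed
    have "u N = a * (hh N ^ 2 / 2) + (4/3 - e/4) * (hh N ^ 3 / 2) + t / 2 * rr N ^ 7"
      by (simp add: u_def Sg_def S0_def field_simps)
    also have "hh N ^ 3 / 2 = 1 / real N" using hh_cube[of N] N by simp
    also have "rr N ^ 7 = (2 / real N) powr (7/6)" using rr_powr[of N] N by simp
    finally have uN: "u N = a * (2 powr (-1/3) * real N powr (-2/3)) + (4/3 - e/4) * (1 / real N) + t / 2 * (2 / real N) powr (7/6)"
      unfolding h2 .
    show ?thesis unfolding d_def w_def Hs Sl using uN by (simp add: algebra_simps add_divide_distrib diff_divide_distrib)
  qed
  have ln_part: "(\<lambda>N. ln (1 + u N) - u N) \<in> O(\<lambda>n. real n powr (-7/6))"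
  proof -
    define M where "M = \<bar>a\<bar> + \<bar>4/3 - e/4\<bar> + \<bar>t\<bar>"
    have "(\<lambda>N. ln (1 + u N) - u N) \<in> O(\<lambda>N. (2 / real N) powr (4/3))"
    proof (rule landau_o.big_mono[THEN landau_o.big_trans])
      show "eventually (\<lambda>N. norm (ln (1 + u N) - u N) \<le> norm (2 * (M / 2) ^ 2 * (2 / real N) powr (4/3))) sequentially"
      proof -
        have "((\<lambda>N. M / 2 * hh N ^ 2) \<longlongrightarrow> M / 2 * 0 ^ 2) sequentially" by (intro tendsto_intros hh_tendsto)
        then have "eventually (\<lambda>N. M / 2 * hh N ^ 2 < 1/2) sequentially" by (rule order_tendstoD) auto
        then have "eventually (\<lambda>N. M / 2 * hh N ^ 2 < 1/2 \<and> N \<ge> 16) sequentially"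
          using eventually_ge_at_top by (rule eventually_conj)
        then show ?thesis
        proof (rule eventually_mono)
          fix N assume N: "M / 2 * hh N ^ 2 < 1/2 \<and> N \<ge> 16"
          have "\<bar>u N\<bar> = \<bar>Sg e t N - 2\<bar> / 2" by (simp add: u_def abs_if)
          then have un: "\<bar>u N\<bar> \<le> M / 2 * hh N ^ 2"
            using Sg_near_2[of N t "\<bar>t\<bar>" e] N by (simp add: M_def)
          have "\<bar>ln (1 + u N) - u N\<bar> \<le> 2 * (u N) ^ 2"
            using un N by (intro abs_ln_one_plus_x_minus_x_bound) auto
          also have "(u N) ^ 2 \<le> (M / 2 * hh N ^ 2) ^ 2" using un by (subst abs_le_square_iff[symmetric]) auto
          also have "(M / 2 * hh N ^ 2) ^ 2 = (M / 2) ^ 2 * ((2 / real N) powr (2/3)) ^ 2"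
            using hh_sq_powr[of N] N by (simp add: power_mult_distrib power_divide)
          also have "((2 / real N) powr (2/3)) ^ 2 = (2 / real N) powr (4/3)"
            using N by (simp add: powr_powr flip: powr_realpow)
          finally show "norm (ln (1 + u N) - u N) \<le> norm (2 * (M / 2) ^ 2 * (2 / real N) powr (4/3))" by simp
        qed
      qed
      show "(\<lambda>N. 2 * (M / 2) ^ 2 * (2 / real N) powr (4/3)) \<in> O(\<lambda>N. (2 / real N) powr (4/3))" by simp
    qed
    also have "(\<lambda>N. (2 / real N) powr (4/3)) \<in> O(\<lambda>n. real n powr (-7/6))" by real_asymp
    finally show ?thesis .
  qed
  have "(\<lambda>N. (ln (1 + u N) - u N) + t / 2 * (2 / real N) powr (7/6)
      - 3 * a * 2 powr (-1/3) * ((real N + 1) powr (1/3) - real N powr (1/3) - 1/3 * real N powr (-2/3))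
      - (4/3 - e/4) * (ln (real N + 1) - ln (real N) - 1 / real N)) \<in> O(\<lambda>n. real n powr (-7/6))"
  proof (rule sum_in_bigo(2)[OF sum_in_bigo(2)[OF sum_in_bigo(1)[OF ln_part]]])
    have "(\<lambda>N. (2 / real N) powr (7/6)) \<in> O(\<lambda>n. real n powr (-7/6))" by real_asymp
    then show "(\<lambda>N. t / 2 * (2 / real N) powr (7/6)) \<in> O(\<lambda>n. real n powr (-7/6))"
      by (rule bigo_cmult)
    show "(\<lambda>N. 3 * a * 2 powr (-1/3) * ((real N + 1) powr (1/3) - real N powr (1/3) - 1/3 * real N powr (-2/3))) \<in> O(\<lambda>n. real n powr (-7/6))"
      by (rule bigo_cmult[OF cube_root_increment])
    show "(\<lambda>N. (4/3 - e/4) * (ln (real N + 1) - ln (real N) - 1 / real N)) \<in> O(\<lambda>n. real n powr (-7/6))"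
      by (rule bigo_cmult[OF ln_increment])
  qed
  then have "(\<lambda>N. d (Suc N) - d N) \<in> O(\<lambda>n. real n powr (-7/6))"
    by (rule landau_o.big.in_cong[THEN iffD2, rotated])
       (use incr eventually_ge_at_top[of "max n0 1"] in \<open>auto elim: eventually_mono\<close>)
  then obtain M where M: "\<And>N. \<bar>d N\<bar> \<le> M" using increments_summable_imp_bounded by blast
  have eq: "Hn N = exp (d N) * growth e N" if "N \<ge> 1" for N
  proof -
    have "exp (w N) = growth e N" using that by (simp add: w_def growth_def exp_add powr_def exp_of_nat_mult)
    moreover have "Hn N = exp (d N + w N)" using Hpos[of N] by (simp add: d_def)
    ultimately show ?thesis by (simp add: exp_add)
  qed
  have gp: "growth e N \<ge> 0" for N by (simp add: growth_def)
  have "exp (- M) * growth e N \<le> Hn N \<and> Hn N \<le> exp M * growth e N" if "N \<ge> 1" for N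
    unfolding eq[OF that] using M[of N] gp[of N] by (intro conjI mult_right_mono) auto
  then have "eventually (\<lambda>N. exp (- M) * growth e N \<le> Hn N \<and> Hn N \<le> exp M * growth e N) sequentially"
    unfolding eventually_sequentially by blast
  then show ?thesis unfolding Hn_def by (intro exI[of _ "exp (- M)"] exI[of _ "exp M"]) auto
qed

text \<open>At height 1 the scaled height is \<open>h\<close> itself. There \<open>A h\<close> is
  comparable to \<open>h\<close>, whereas the perturbation \<open>r^5 = r^3 h\<close> is of smaller
  order, so the upper and the lower weight are of the same order.\<close>

lemma profile_first_bounds:
  "\<exists>c>0. \<exists>C>0. eventually (\<lambda>N. c * hh N \<le> profile e N 1 - rr N ^ 5 \<and> profile e N 1 + rr N ^ 5 \<le> C * hh N) sequentially"
proof -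
  obtain C where C: "C \<ge> 0" "\<And>N y. N \<ge> 18 \<Longrightarrow> y \<ge> 1 \<Longrightarrow> \<bar>profile e N y\<bar> \<le> C * XX N y" using profile_bounds[of e] by blast
  obtain c0 where c0: "c0 > 0" "\<And>x. 0 < x \<Longrightarrow> x \<le> 1 \<Longrightarrow> c0 * x \<le> A x" using A_linear_lower by blast
  have "((\<lambda>N. Pol e (hh N) (hh N)) \<longlonglongrightarrow> Pol e 0 0)" unfolding Pol_def by (intro tendsto_intros hh_tendsto) auto
  then have "eventually (\<lambda>N. Pol e (hh N) (hh N) > 1/2) sequentially" by (rule order_tendstoD) (simp add: Pol_def)
  moreover have "eventually (\<lambda>N. rr N \<le> min 1 (c0 / 4)) sequentially" using c0 by (intro rr_eventually_small) auto
  ultimately have "eventually (\<lambda>N. (Pol e (hh N) (hh N) > 1/2 \<and> rr N \<le> min 1 (c0 / 4)) \<and> N \<ge> 18) sequentially"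
    by (intro eventually_conj eventually_ge_at_top)
  then have "eventually (\<lambda>N. c0 / 4 * hh N \<le> profile e N 1 - rr N ^ 5 \<and> profile e N 1 + rr N ^ 5 \<le> (C + 1) * hh N) sequentially"
  proof (rule eventually_mono)
    fix N assume N: "(Pol e (hh N) (hh N) > 1/2 \<and> rr N \<le> min 1 (c0 / 4)) \<and> N \<ge> 18"
    then have N16: "N \<ge> 16" by simp
    have h: "0 < hh N" "hh N \<le> 1" using hX_facts[OF N16, of 1] by auto
    have r: "0 < rr N" "rr N \<le> 1" using rr_facts[OF N16] by auto
    have X1: "XX N 1 = hh N" by (simp add: XX_def)
    have "rr N ^ 5 = rr N ^ 3 * hh N" unfolding rr_sq[symmetric] by (simp flip: power_add)
    moreover have "rr N ^ 3 \<le> rr N ^ 1" using r by (intro power_decreasing) auto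
    then have "rr N ^ 3 \<le> min 1 (c0 / 4)" using N by simp
    ultimately have r5: "rr N ^ 5 \<le> min 1 (c0 / 4) * hh N" using h by (simp add: mult_right_mono)
    have r5a: "rr N ^ 5 \<le> c0 / 4 * hh N" "rr N ^ 5 \<le> 1 * hh N"
    proof -
      have "min 1 (c0 / 4) * hh N \<le> c0 / 4 * hh N" "min 1 (c0 / 4) * hh N \<le> 1 * hh N"
        using h by (intro mult_right_mono; simp)+
      then show "rr N ^ 5 \<le> c0 / 4 * hh N" "rr N ^ 5 \<le> 1 * hh N" using r5 by linarith+
    qed
    have "(1/2) * (c0 * hh N) \<le> Pol e (hh N) (hh N) * A (hh N)" using N c0 h by (intro mult_mono) auto
    then have "c0 / 4 * hh N \<le> profile e N 1 - rr N ^ 5" unfolding profile_def X1 using r5a(1) by linarith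
    moreover have "profile e N 1 + rr N ^ 5 \<le> (C + 1) * hh N"
      using C(2)[of N 1, unfolded X1] N r5a(2) unfolding distrib_right by linarith
    ultimately show "c0 / 4 * hh N \<le> profile e N 1 - rr N ^ 5 \<and> profile e N 1 + rr N ^ 5 \<le> (C + 1) * hh N" by blast
  qed
  then show ?thesis using c0 C by (intro exI[of _ "c0/4"] exI[of _ "C + 1"] conjI) auto
qed

text \<open>A single tree with \<open>n\<close> nodes is read off at time \<open>2 * n\<close>. The
  powers of 2 cancel in the exponent and in \<open>hh (2 * n) = n powr (-1/3)\<close>, and only a
  constant is left.\<close>

lemma growth_even:
  assumes "n > 0"
  shows "growth e (2 * n) * hh (2 * n) = 2 powr (4/3 - e/4) * (4 ^ n * exp (3 * a * real n powr (1/3)) * real n powr (1 - e/4))"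
proof -
  have h: "hh (2 * n) = real n powr (-1/3)"
    using assms by (simp add: hh_def powr_minus_divide powr_divide)
  have e: "2 powr (-1/3) * real (2 * n) powr (1/3) = real n powr (1/3)"
  proof -
    have "real (2 * n) powr (1/3) = 2 powr (1/3) * real n powr (1/3)" by (simp add: powr_mult)
    moreover have "2 powr (-1/3) * 2 powr (1/3) = (1::real)" by (simp flip: powr_add)
    ultimately show ?thesis by (simp flip: mult.assoc)
  qed
  have p: "real (2 * n) powr (4/3 - e/4) = 2 powr (4/3 - e/4) * real n powr (4/3 - e/4)" by (simp add: powr_mult)
  have q: "real n powr (4/3 - e/4) * real n powr (-1/3) = real n powr (1 - e/4)" by (simp flip: powr_add)
  have f: "(2::real) ^ (2 * n) = 4 ^ n" by (simp add: power_mult)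
  have g: "3 * a * 2 powr (-1/3) * real (2 * n) powr (1/3) = 3 * a * real n powr (1/3)"
    using e by (simp add: mult.assoc)
  have "growth e (2 * n) * hh (2 * n) = 2 powr (4/3 - e/4) * (4 ^ n * exp (3 * a * real n powr (1/3)) * (real n powr (4/3 - e/4) * real n powr (-1/3)))"
    unfolding growth_def h p f g by (simp add: mult_ac)
  then show ?thesis unfolding q .
qed

text \<open>Forests without internal nodes sit at time \<open>l\<close> and height
  \<open>l + 1\<close>. There \<open>h x^2 = (l + 1)^2 h^3 >= 2 l\<close>, so the quadratic term of
  \<open>Pol\<close> dominates; the cut-off subsolution therefore vanishes on this layer.\<close>

lemma profile_diagonal_nonpos:
  assumes e: "0 \<le> e" and l: "l \<ge> 16"
  shows "profile e l (Suc l) \<le> 0"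
proof -
  define h where "h = hh l" define x where "x = XX l (Suc l)"
  have h: "0 < h" using hX_facts[of l 1] l by (simp add: h_def)
  have x: "x = (real l + 1) * h" by (simp add: x_def XX_def h_def)
  have x0: "x > 0" using h by (simp add: x)
  have h3: "h ^ 3 = 2 / real l" using hh_cube[of l] l by (simp add: h_def)
  have "h * x ^ 2 = (real l + 1) ^ 2 * h ^ 3" unfolding x by (simp add: power_mult_distrib eval_nat_numeral)
  also have "\<dots> \<ge> 2 * real l" unfolding h3 using l by (simp add: field_simps power2_eq_square)
  finally have 1: "h * x ^ 2 \<ge> 2 * real l" .
  have "h ^ 2 * x = (real l + 1) * h ^ 3" unfolding x by (simp add: eval_nat_numeral)
  also have "\<dots> \<le> 3" unfolding h3 using l by (simp add: field_simps)
  finally have 2: "h ^ 2 * x \<le> 3" .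
  have "(11/12 - e/8) * (h ^ 2 * x) \<le> 1 * (h ^ 2 * x)" using e h x0 by (intro mult_right_mono) auto
  then have "(11/12 - e/8) * h ^ 2 * x \<le> 3" using 2 by (simp add: mult.assoc)
  moreover have "real l \<ge> 16" using l by simp
  ultimately have "Pol e h x \<le> 0" unfolding Pol_def using 1 by linarith
  moreover have "A x > 0" using x0 by (rule A_pos)
  ultimately show ?thesis by (simp add: profile_def h_def x_def mult_nonpos_nonneg less_imp_le)
qed

text \<open>The linear weight is \<open>r^3 x\<close>, while the negative part of the profile is of
  order \<open>r^4 x\<close> and the term two steps back of order \<open>r^6 x\<close>; so the
  linear weight wins for small \<open>r\<close>.\<close>

lemma upper_weight_bounds:
  assumes e: "0 \<le> e" "e \<le> 1"
  defines "X \<equiv> upper_weight e"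
  shows "eventually (\<lambda>N. \<forall>y. 1 \<le> y \<longrightarrow> X N y > 0 \<and> (y \<le> N + 2 \<longrightarrow>
    (\<forall>D\<ge>1. e * betaq N y / D * X (N - 2) (y - 1) < X N (y + 1)))) sequentially"
proof -
  obtain Cn where Cn: "Cn \<ge> 0" "\<And>N y. N \<ge> 16 \<Longrightarrow> - profile e N y \<le> Cn * (hh N ^ 2 * XX N y)" using profile_neg[of e] by blast
  obtain C where C: "C \<ge> 0" "\<And>N y. N \<ge> 18 \<Longrightarrow> y \<ge> 1 \<Longrightarrow> \<bar>profile e (N - 2) (y - 1)\<bar> * (1 + XX N y) \<le> C * XX N y"
    using profile_bounds[of e] by blast
  define L where "L = Cn + 16 * (C + 8) + 1"
  have L: "L > 0" using Cn C by (simp add: L_def)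
  have "eventually (\<lambda>N. N \<ge> 18 \<and> rr N \<le> 1 / (2 * L)) sequentially"
    by (intro eventually_conj eventually_ge_at_top rr_eventually_small) (use L in auto)
  then show ?thesis
  proof (rule eventually_mono, intro allI impI)
    fix N y :: nat assume N: "N \<ge> 18 \<and> rr N \<le> 1 / (2 * L)" and y: "1 \<le> y"
    have N16: "N \<ge> 16" using N by simp
    define r where "r = rr N"
    have r: "0 < r" "r \<le> 1" using rr_facts[OF N16] by (auto simp: r_def)
    have "r * L \<le> 1/2" using N L by (simp add: r_def field_simps)
    then have rL: "r * Cn + r * (16 * (C + 8)) < 1" using r by (simp add: L_def algebra_simps)
    have low: "X N z \<ge> XX N z * (r ^ 3 * (1 - r * Cn))" for z
    proof -
      have "rr N ^ 5 * real z = r ^ 3 * XX N z" unfolding r_def by (rule scale_identities)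
      moreover have "hh N ^ 2 = r ^ 4" by (simp add: r_def rr_powers)
      then have "- profile e N z \<le> Cn * (r ^ 4 * XX N z)" using Cn(2)[OF N16, of z] by simp
      ultimately have "X N z \<ge> r ^ 3 * XX N z - Cn * (r ^ 4 * XX N z)" unfolding X_def upper_weight_def by linarith
      also have "r ^ 3 * XX N z - Cn * (r ^ 4 * XX N z) = XX N z * (r ^ 3 * (1 - r * Cn))"
        by (simp add: eval_nat_numeral algebra_simps)
      finally show ?thesis .
    qed
    have "0 \<le> r * (16 * (C + 8))" using r C by simp
    then have rC: "r * Cn < 1" using rL by linarith
    have Xy: "XX N y > 0" using hX_facts[OF N16 y] by simp
    have "0 < XX N y * (r ^ 3 * (1 - r * Cn))" using Xy r rC by simp
    then have pos: "X N y > 0" using low[of y] by linarith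
    have "\<forall>D\<ge>1. e * betaq N y / D * X (N - 2) (y - 1) < X N (y + 1)" if y2: "y \<le> N + 2"
    proof (intro allI impI)
      fix D :: real assume D: "D \<ge> 1"
      have h3: "hh N ^ 3 = r ^ 6" by (simp add: r_def rr_powers)
      have "\<bar>e * betaq N y / D\<bar> \<le> 16 * r ^ 6"
      proof -
        have "\<bar>e * betaq N y\<bar> \<le> 1 * (16 * r ^ 6)"
          unfolding abs_mult using e betaq_le[OF N16 y y2] by (intro mult_mono) (auto simp: h3)
        then have "\<bar>e * betaq N y\<bar> / D \<le> (16 * r ^ 6) / 1" using D by (intro frac_le) auto
        then show ?thesis using D by simp
      qed
      moreover have "\<bar>X (N - 2) (y - 1)\<bar> \<le> (C + 8) * XX N (y + 1)"
      proof -
        have "XX N y \<le> XX N (y + 1)" unfolding XX_def by (intro mult_right_mono) (auto simp: hh_nonneg)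
        moreover have "\<bar>profile e (N - 2) (y - 1)\<bar> \<le> C * XX N y"
        proof -
          have "\<bar>profile e (N - 2) (y - 1)\<bar> * 1 \<le> \<bar>profile e (N - 2) (y - 1)\<bar> * (1 + XX N y)" using Xy by (intro mult_left_mono) auto
          then show ?thesis using C(2)[of N y] N y by simp
        qed
        moreover have "rr (N - 2) ^ 5 * real (y - 1) \<le> 8 * XX N y"
        proof -
          have "rr (N - 2) ^ 5 * real (y - 1) \<le> (8 * rr N ^ 5) * real y"
            using rr_minus2(1)[OF N16] by (intro mult_mono) (auto simp: rr_def hh_nonneg)
          also have "\<dots> = 8 * (rr N ^ 3 * XX N y)" using scale_identities(1)[of N y] by simp
          also have "\<dots> \<le> 8 * (1 * XX N y)" using r Xy by (intro mult_left_mono mult_right_mono) (auto simp: r_def power_le_one)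
          finally show ?thesis by simp
        qed
        moreover have "0 \<le> rr (N - 2) ^ 5 * real (y - 1)" by (simp add: rr_def hh_nonneg)
        ultimately have "\<bar>X (N - 2) (y - 1)\<bar> \<le> C * XX N y + 8 * XX N y" unfolding X_def upper_weight_def by linarith
        also have "\<dots> \<le> C * XX N (y + 1) + 8 * XX N (y + 1)" using \<open>XX N y \<le> XX N (y + 1)\<close> C by (intro add_mono mult_left_mono) auto
        finally show ?thesis by (simp add: distrib_right)
      qed
      ultimately have "\<bar>e * betaq N y / D * X (N - 2) (y - 1)\<bar> \<le> 16 * r ^ 6 * ((C + 8) * XX N (y + 1))"
        unfolding abs_mult[of "e * betaq N y / D"] using r by (intro mult_mono) auto
      also have "\<dots> < XX N (y + 1) * (r ^ 3 * (1 - r * Cn))"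
      proof -
        have "r ^ 3 \<le> r ^ 1" using r by (intro power_decreasing) auto
        then have "r ^ 3 * (16 * (C + 8)) \<le> r * (16 * (C + 8))" using C by (intro mult_right_mono) auto
        then have "r ^ 3 * (16 * (C + 8)) < 1 - r * Cn" using rL by linarith
        moreover have "XX N (y + 1) * r ^ 3 > 0" using hX_facts[of N "y + 1"] N16 r by simp
        ultimately have "(XX N (y + 1) * r ^ 3) * (r ^ 3 * (16 * (C + 8))) < (XX N (y + 1) * r ^ 3) * (1 - r * Cn)"
          by (rule mult_strict_left_mono)
        then show ?thesis by (simp add: eval_nat_numeral mult_ac)
      qed
      also have "\<dots> \<le> X N (y + 1)" by (rule low)
      finally show "e * betaq N y / D * X (N - 2) (y - 1) < X N (y + 1)" by linarith
    qed
    then show "X N y > 0 \<and> (y \<le> N + 2 \<longrightarrow> (\<forall>D\<ge>1. e * betaq N y / D * X (N - 2) (y - 1) < X N (y + 1)))"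
      using pos by blast
  qed
qed

text \<open>A factorial and the product of growth rates turn \<open>upper_step\<close> and
  \<open>lower_step\<close> into the hypotheses of the two comparison lemmas. The resulting bounds
  at \<open>l = 1\<close> have the same order, by \<open>product_asymptotics\<close> and
  \<open>profile_first_bounds\<close>.\<close>

lemma signed_recurrence_asymptotics:
  assumes "signed_recurrence e G"
  shows "(\<lambda>n. G 1 n) \<in> \<Theta>(\<lambda>n. fact n * 4 ^ n * exp (3 * a * real n powr (1/3)) * real n powr (1 - e/4))"
proof -
  interpret signed_recurrence e G by fact
  define Xp where "Xp = upper_weight e"
  define Xm where "Xm = lower_weight e"
  obtain \<sigma> where \<sigma>: "\<sigma> > 0" and ev: "eventually (\<lambda>N. (\<forall>t. \<bar>t\<bar> \<le> \<sigma> \<longrightarrow> 1 \<le> Sg e t N) \<and>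
      (\<forall>y. 1 \<le> y \<longrightarrow> y \<le> N + 2 \<longrightarrow> upper_step e \<sigma> N y \<and> (y \<le> N \<longrightarrow> lower_step e \<sigma> N y))) sequentially"
    using step_ineqs[OF e(1)] by blast
  have ev2: "eventually (\<lambda>N. \<forall>y. 1 \<le> y \<longrightarrow> Xp N y > 0 \<and> (y \<le> N + 2 \<longrightarrow>
    (\<forall>D\<ge>1. e * betaq N y / D * Xp (N - 2) (y - 1) < Xp N (y + 1)))) sequentially"
    unfolding Xp_def by (rule upper_weight_bounds[OF e])
  obtain n0 where n0: "n0 \<ge> 16" and all: "\<And>N. N \<ge> n0 \<Longrightarrow> (\<forall>t. \<bar>t\<bar> \<le> \<sigma> \<longrightarrow> 1 \<le> Sg e t N) \<and>
      (\<forall>y. 1 \<le> y \<longrightarrow> y \<le> N + 2 \<longrightarrow> upper_step e \<sigma> N y \<and> (y \<le> N \<longrightarrow> lower_step e \<sigma> N y))"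
     and all2: "\<And>N y. N \<ge> n0 \<Longrightarrow> 1 \<le> y \<Longrightarrow> Xp N y > 0 \<and> (y \<le> N + 2 \<longrightarrow>
        (\<forall>D\<ge>1. e * betaq N y / D * Xp (N - 2) (y - 1) < Xp N (y + 1)))"
    using eventually_conj[OF eventually_conj[OF ev ev2] eventually_ge_at_top[of 16]]
    unfolding eventually_sequentially by (metis (no_types, lifting) order_refl)
  define Sp where "Sp = Sg e \<sigma>" define Sm where "Sm = Sg e (-\<sigma>)"
  have S1: "Sp N \<ge> 1" "Sm N \<ge> 1" if "N \<ge> n0" for N using all[OF that] \<sigma> by (auto simp: Sp_def Sm_def)
  then have Spos: "Sp N > 0" "Sm N > 0" if "N \<ge> n0" for N using that by (auto intro: less_le_trans[OF zero_less_one])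
  have Sall: "\<forall>k\<ge>n0. Sp k > 0" "\<forall>k\<ge>n0. Sm k > 0" using Spos by auto
  have up: "alpha N y * Xp N (y - 1) + Xp N (y + 1) - e * betaq N y / (Sp (N - 1) * Sp (N - 2)) * Xp (N - 2) (y - 1)
      \<le> Sp N * Xp (Suc N) y" if "N \<ge> n0" "1 \<le> y" "y \<le> N + 2" for N y
    using all[OF that(1)] that(2,3) unfolding upper_step_def Xp_def Sp_def by blast
  have lo: "Sm N * Xm (Suc N) y \<le> alpha N y * Xm N (y - 1) + Xm N (y + 1)
       - e * betaq N y / (Sm (N - 1) * Sm (N - 2)) * max (Xm (N - 2) (y - 1)) 0" if "N \<ge> n0" "1 \<le> y" "y \<le> N" for N y
    using all[OF that(1)] that(2,3) unfolding lower_step_def Xm_def Sm_def by (meson le_add1 order_trans)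
  \<comment> \<open>The offset keeps times two steps back at or above \<open>n0\<close>, where the
    growth rates are known to be at least 1.\<close>
  define n1 where "n1 = n0 + 4"
  have n1: "n1 > 0" by (simp add: n1_def)

  define Hp where "Hp = (\<lambda>N. \<Prod>k\<in>{n0..<N}. Sp k)"
  define Qp where "Qp = (\<lambda>l j. fact (l + j - 1) * Hp (l + 2 * j - 1) * Xp (l + 2 * j - 1) l)"
  have Hpp: "Hp N > 0" for N unfolding Hp_def using Spos by (intro prod_pos) auto
  have "\<exists>K>0. \<forall>l j. l + 2 * j \<ge> n1 \<longrightarrow> G (Suc l) j \<le> K * Qp (Suc l) j"
  proof (rule upper_comparison[OF n1])
    show "Qp 0 j = 0" for j by (simp add: Qp_def Xp_def upper_weight_def profile_0)
    show "Qp (Suc l) j > 0" if "l + 2 * j \<ge> n1" for l j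
    proof -
      have "Xp (l + 2 * j) (Suc l) > 0" using all2[of "l + 2 * j" "Suc l"] that by (simp add: n1_def)
      then show ?thesis using Hpp by (simp add: Qp_def)
    qed
    fix l j assume lj: "l + 2 * j + 2 \<ge> n1"
    define N where "N = l + 2 * j + 1"
    have N: "N \<ge> n0 + 2" "N \<ge> n0" "Suc l \<le> N + 2" "l + j \<ge> 1" "N - 1 \<ge> n0" "N - 2 \<ge> n0" using lj n0 by (auto simp: N_def n1_def)
    note sr = scaled_recurrence[where X = Xp, OF N_def N(1) Sall(1) N(4) Hp_def Qp_def refl]
    have D: "1 \<le> Sp (N - 1) * Sp (N - 2)" using mult_mono[OF S1(1)[OF N(5)] S1(1)[OF N(6)]] S1(1)[OF N(5)] by simp
    show "(real j + 2) * Qp l (Suc j) + Qp (Suc (Suc l)) j - e * real j * Qp l j \<le> Qp (Suc l) (Suc j)"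
    proof -
      have "(fact (l + j + 1) * Hp N) * (alpha N (Suc l) * Xp N l + Xp N (Suc (Suc l)) - e * betaq N (Suc l) / (Sp (N - 1) * Sp (N - 2)) * Xp (N - 2) l)
         \<le> (fact (l + j + 1) * Hp N) * (Sp N * Xp (Suc N) (Suc l))"
        using up[OF N(2) _ N(3)] Hpp[of N] by (intro mult_left_mono) auto
      then show ?thesis unfolding sr(2-5) by (simp only: distrib_left right_diff_distrib)
    qed
    show "e * real j * Qp l j < Qp (Suc (Suc l)) j"
    proof -
      have "e * betaq N (Suc l) / (Sp (N - 1) * Sp (N - 2)) * Xp (N - 2) l < Xp N (Suc (Suc l))"
        using all2[OF N(2), of "Suc l"] N(3) D by simp
      then show ?thesis unfolding sr(4,5) using sr(1) by (intro mult_strict_left_mono)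
    qed
  next
    \<comment> \<open>The layer \<open>j = 0\<close> uses \<open>up\<close> at height
      \<open>N + 2\<close>, which lies beyond every actual forest at time \<open>N\<close>: there
      \<open>alpha\<close> is \<open>1 / l\<close>, and the term two steps back is outweighed by
      \<open>Xp N (Suc (Suc l))\<close>.\<close>
    fix l assume l: "l \<ge> n1"
    define N where "N = l - 1"
    have N: "N \<ge> n0" "l = Suc N" "N - 2 \<ge> n0" "N - 1 \<ge> n0" using l by (auto simp: N_def n1_def)
    have D: "1 \<le> Sp (N - 1) * Sp (N - 2)" using mult_mono[OF S1(1)[OF N(4)] S1(1)[OF N(3)]] S1(1)[OF N(4)] by simp
    have al: "alpha N (Suc l) = 1 / real l" using N by (simp add: alpha_def field_simps)
    have "e * betaq N (Suc l) / (Sp (N - 1) * Sp (N - 2)) * Xp (N - 2) l < Xp N (Suc (Suc l))"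
      using all2[OF N(1), of "Suc l"] N D by simp
    moreover have "alpha N (Suc l) * Xp N l + Xp N (Suc (Suc l)) - e * betaq N (Suc l) / (Sp (N - 1) * Sp (N - 2)) * Xp (N - 2) l
      \<le> Sp N * Xp (Suc N) (Suc l)" using up[OF N(1), of "Suc l"] N by simp
    ultimately have "1 / real l * Xp N l \<le> Sp N * Xp l (Suc l)" using al N by simp
    then have "(fact l * Hp N) * (1 / real l * Xp N l) \<le> (fact l * Hp N) * (Sp N * Xp l (Suc l))"
      using Hpp[of N] by (intro mult_left_mono) auto
    moreover have HpS: "Hp l = Hp N * Sp N" unfolding Hp_def N(2) using N(1) by (simp add: prod.atLeastLessThan_Suc)
    moreover have "(fact l :: real) = real l * fact N" unfolding N(2) by simp
    then have "(fact l * Hp N) * (1 / real l * Xp N l) = fact N * Hp N * Xp N l" using l n1 by simp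
    moreover have "Qp l 0 = fact N * Hp N * Xp N l" "Qp (Suc l) 0 = fact l * Hp l * Xp l (Suc l)"
      by (simp_all add: Qp_def N_def)
    ultimately show "Qp l 0 \<le> Qp (Suc l) 0" by (simp only: mult.assoc)
  qed
  then obtain Ku where Ku: "Ku > 0" "\<And>n. 2 * n \<ge> n1 \<Longrightarrow> G 1 n \<le> Ku * Qp 1 n" by (metis One_nat_def add_0)

  \<comment> \<open>The lower weight is cut off at 0, as \<open>lower_comparison\<close> asks for
    nonnegative values.\<close>
  define Xl where "Xl = (\<lambda>N y. max (Xm N y) 0)"
  define Hm where "Hm = (\<lambda>N. \<Prod>k\<in>{n0..<N}. Sm k)"
  define Qm where "Qm = (\<lambda>l j. fact (l + j - 1) * Hm (l + 2 * j - 1) * Xl (l + 2 * j - 1) l)"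
  have Hmp: "Hm N > 0" for N unfolding Hm_def using Spos by (intro prod_pos) auto
  have "\<exists>K>0. \<forall>l j. l + 2 * j \<ge> n1 \<longrightarrow> K * Qm (Suc l) j \<le> G (Suc l) j"
  proof (rule lower_comparison[OF n1])
    show "Qm 0 j = 0" for j by (simp add: Qm_def Xl_def Xm_def lower_weight_def profile_0)
    show "Qm l j \<ge> 0" for l j using Hmp by (simp add: Qm_def Xl_def less_imp_le)
    show "Qm (Suc l) 0 = 0" if "l \<ge> n1" for l
    proof -
      have "profile e l (Suc l) \<le> 0" using that n0 by (intro profile_diagonal_nonpos[OF e(1)]) (auto simp: n1_def)
      moreover have "0 \<le> rr l ^ 5 * real (Suc l)" by (simp add: rr_def hh_nonneg)
      ultimately have "Xm l (Suc l) \<le> 0" unfolding Xm_def lower_weight_def by linarith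
      then show ?thesis by (simp add: Qm_def Xl_def)
    qed
    fix l j assume lj: "l + 2 * j + 2 \<ge> n1" and Qpos: "Qm (Suc l) (Suc j) > 0"
    define N where "N = l + 2 * j + 1"
    have N: "N \<ge> n0 + 2" "N \<ge> n0" "Suc l \<le> N" "l + j \<ge> 1" using lj n0 by (auto simp: N_def n1_def)
    note sr = scaled_recurrence[where X = Xl, OF N_def N(1) Sall(2) N(4) Hm_def Qm_def refl]
    \<comment> \<open>A positive value means that the cut-off is inactive on the left side, while on
      the right it can only help.\<close>
    have "Xl (Suc N) (Suc l) \<noteq> 0" using Qpos unfolding sr(2) by auto
    then have X1: "Xl (Suc N) (Suc l) = Xm (Suc N) (Suc l)" unfolding Xl_def by linarith
    have al: "alpha N (Suc l) \<ge> 0" unfolding alpha_def N_def by simp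
    have "alpha N (Suc l) * Xm N l \<le> alpha N (Suc l) * Xl N l" using al by (intro mult_left_mono) (auto simp: Xl_def)
    moreover have "Xm N (Suc (Suc l)) \<le> Xl N (Suc (Suc l))" by (simp add: Xl_def)
    moreover have "Sm N * Xm (Suc N) (Suc l) \<le> alpha N (Suc l) * Xm N l + Xm N (Suc (Suc l))
       - e * betaq N (Suc l) / (Sm (N - 1) * Sm (N - 2)) * Xl (N - 2) l" using lo[OF N(2) _ N(3)] by (simp add: Xl_def)
    ultimately have ineq: "Sm N * Xl (Suc N) (Suc l) \<le> alpha N (Suc l) * Xl N l + Xl N (Suc (Suc l))
       - e * betaq N (Suc l) / (Sm (N - 1) * Sm (N - 2)) * Xl (N - 2) l" unfolding X1 by linarith
    have "(fact (l + j + 1) * Hm N) * (Sm N * Xl (Suc N) (Suc l)) \<le>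
        (fact (l + j + 1) * Hm N) * (alpha N (Suc l) * Xl N l + Xl N (Suc (Suc l)) - e * betaq N (Suc l) / (Sm (N - 1) * Sm (N - 2)) * Xl (N - 2) l)"
      using ineq Hmp[of N] by (intro mult_left_mono) auto
    then show "Qm (Suc l) (Suc j) \<le> (real j + 2) * Qm l (Suc j) + Qm (Suc (Suc l)) j - e * real j * Qm l j"
      unfolding sr(2-5) by (simp only: distrib_left right_diff_distrib)
  qed
  then obtain Kl where Kl: "Kl > 0" "\<And>n. 2 * n \<ge> n1 \<Longrightarrow> Kl * Qm 1 n \<le> G 1 n" by (metis One_nat_def add_0)

  obtain c1 C1 where p1: "0 < C1" "eventually (\<lambda>N. c1 * growth e N \<le> Hp N \<and> Hp N \<le> C1 * growth e N) sequentially"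
    using product_asymptotics[of n0 e \<sigma>] Spos(1) unfolding Hp_def Sp_def by blast
  obtain c2 C2 where p2: "0 < c2" "eventually (\<lambda>N. c2 * growth e N \<le> Hm N \<and> Hm N \<le> C2 * growth e N) sequentially"
    using product_asymptotics[of n0 e "-\<sigma>"] Spos(2) unfolding Hm_def Sm_def by blast
  obtain c3 C3 where p3: "0 < c3" "0 < C3" "eventually (\<lambda>N. c3 * hh N \<le> profile e N 1 - rr N ^ 5 \<and> profile e N 1 + rr N ^ 5 \<le> C3 * hh N) sequentially"
    using profile_first_bounds[of e] by blast
  define target where "target = (\<lambda>n. fact n * 4 ^ n * exp (3 * a * real n powr (1/3)) * real n powr (1 - e/4))"
  define \<kappa> :: real where "\<kappa> = 2 powr (4/3 - e/4)"
  have \<kappa>: "\<kappa> > 0" by (simp add: \<kappa>_def)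
  have tp: "target n \<ge> 0" for n by (simp add: target_def)
  have tgt: "fact n * (growth e (2 * n) * hh (2 * n)) = \<kappa> * target n" if "n > 0" for n
    unfolding growth_even[OF that] target_def \<kappa>_def by (simp add: mult_ac)
  have gn: "growth e N \<ge> 0" for N by (simp add: growth_def)
  have dbl: "filterlim (\<lambda>n. 2 * n :: nat) sequentially sequentially"
    by (intro filterlim_subseq) (auto simp: strict_mono_def)
  have fin: "eventually (\<lambda>n. (Kl * c2 * c3 * \<kappa>) * target n \<le> G 1 n \<and> G 1 n \<le> (Ku * C1 * C3 * \<kappa>) * target n) sequentially"
    using eventually_compose_filterlim[OF p1(2) dbl] eventually_compose_filterlim[OF p2(2) dbl]
      eventually_compose_filterlim[OF p3(3) dbl] eventually_ge_at_top[of n1]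
  proof eventually_elim
    case (elim n)
    have n: "n > 0" "2 * n \<ge> n1" using elim(4) n1 by auto
    have Q1: "Qp 1 n = fact n * (Hp (2 * n) * Xp (2 * n) 1)" "Qm 1 n = fact n * (Hm (2 * n) * Xl (2 * n) 1)"
      by (simp_all add: Qp_def Qm_def)
    have "G 1 n \<le> Ku * (fact n * (Hp (2 * n) * Xp (2 * n) 1))" using Ku(2)[OF n(2)] unfolding Q1 .
    also have "\<dots> \<le> Ku * (fact n * ((C1 * growth e (2 * n)) * (C3 * hh (2 * n))))"
    proof (intro mult_left_mono mult_mono)
      show "Xp (2 * n) 1 \<le> C3 * hh (2 * n)" using elim(3) by (simp add: Xp_def upper_weight_def)
      show "0 \<le> Xp (2 * n) 1" using all2[of "2 * n" 1] n by (simp add: n1_def less_imp_le)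
    qed (use elim Ku p1 gn Hpp in \<open>auto simp: less_imp_le\<close>)
    also have "\<dots> = (Ku * C1 * C3) * (fact n * (growth e (2 * n) * hh (2 * n)))" by (simp add: mult_ac)
    also have "\<dots> = (Ku * C1 * C3 * \<kappa>) * target n" unfolding tgt[OF n(1)] by simp
    finally have u: "G 1 n \<le> (Ku * C1 * C3 * \<kappa>) * target n" .
    have "(Kl * c2 * c3 * \<kappa>) * target n = (Kl * c2 * c3) * (fact n * (growth e (2 * n) * hh (2 * n)))"
      unfolding tgt[OF n(1)] by simp
    also have "\<dots> = Kl * (fact n * ((c2 * growth e (2 * n)) * (c3 * hh (2 * n))))" by (simp add: mult_ac)
    also have "\<dots> \<le> Kl * (fact n * (Hm (2 * n) * Xl (2 * n) 1))"
    proof (intro mult_left_mono mult_mono)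
      show "c3 * hh (2 * n) \<le> Xl (2 * n) 1" using elim(3) by (simp add: Xl_def Xm_def lower_weight_def le_max_iff_disj)
      show "0 \<le> c3 * hh (2 * n)" using p3 hh_nonneg by simp
    qed (use elim Kl p2 gn Hmp in \<open>auto simp: less_imp_le\<close>)
    also have "\<dots> \<le> G 1 n" using Kl(2)[OF n(2)] unfolding Q1 .
    finally show ?case using u by blast
  qed
  have "(\<lambda>n. G 1 n) \<in> \<Theta>(target)"
  proof (rule bigthetaI)
    show "(\<lambda>n. G 1 n) \<in> O(target)"
    proof (rule landau_o.bigI[of "Ku * C1 * C3 * \<kappa>"])
      show "Ku * C1 * C3 * \<kappa> > 0" using Ku p1 p3 \<kappa> by simp
      show "eventually (\<lambda>n. norm (G 1 n) \<le> Ku * C1 * C3 * \<kappa> * norm (target n)) sequentially"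
        using fin by eventually_elim (use tp G_nonneg in auto)
    qed
    show "(\<lambda>n. G 1 n) \<in> \<Omega>(target)"
    proof (rule landau_omega.bigI[of "Kl * c2 * c3 * \<kappa>"])
      show "Kl * c2 * c3 * \<kappa> > 0" using Kl p2 p3 \<kappa> by simp
      show "eventually (\<lambda>n. norm (G 1 n) \<ge> Kl * c2 * c3 * \<kappa> * norm (target n)) sequentially"
        using fin by eventually_elim (use tp G_nonneg in auto)
    qed
  qed
  then show ?thesis unfolding target_def .
qed

end

section \<open>Weighted forests\<close>

text \<open>\<open>wt e k t\<close> counts the pointer choices in a subtree \<open>t\<close> whose traversal starts after \<open>k\<close> internal nodes.
  A cherry reached after \<open>k\<close> internal nodes has \<open>(k + 1)\<^sup>2\<close> pairs of targets, of which the \<open>k\<close> pairs used by the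
  earlier nodes are excluded in a compacted tree.\<close>
fun wt :: "real \<Rightarrow> nat \<Rightarrow> bt \<Rightarrow> real" where
  "wt e k Lf = real k + 1"
| "wt e k (Nd l r) = (if l = Lf \<and> r = Lf then (real k + 1) ^ 2 - e * real k else wt e k l * wt e (k + bt_size l) r)"

fun wts :: "real \<Rightarrow> nat \<Rightarrow> bt list \<Rightarrow> real" where
  "wts e k [] = 1"
| "wts e k (t # ts) = wt e k t * wts e (k + bt_size t) ts"

abbreviation fsize :: "bt list \<Rightarrow> nat" where "fsize ts \<equiv> sum_list (map bt_size ts)"

definition forests :: "nat \<Rightarrow> nat \<Rightarrow> bt list set" where
  "forests l j = {ts. length ts = l \<and> fsize ts = j}"

definition forest_sum :: "real \<Rightarrow> nat \<Rightarrow> nat \<Rightarrow> real" where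
  "forest_sum e l j = (\<Sum>ts\<in>forests l j. wts e 0 ts)"

lemma wts_append: "wts e k (ts @ us) = wts e k ts * wts e (k + fsize ts) us"
  by (induction ts arbitrary: k) (auto simp: add.assoc)

lemma finite_bt_size_le: "finite {t. bt_size t \<le> n}"
proof (induction n)
  case 0
  have "{t. bt_size t \<le> 0} \<subseteq> {Lf}" by (auto elim: bt_size.elims)
  then show ?case by (rule finite_subset) simp
next
  case (Suc n)
  have "{t. bt_size t \<le> Suc n} \<subseteq> insert Lf ((\<lambda>(l, r). Nd l r) ` ({t. bt_size t \<le> n} \<times> {t. bt_size t \<le> n}))"
  proof
    fix t assume "t \<in> {t. bt_size t \<le> Suc n}"
    then show "t \<in> insert Lf ((\<lambda>(l, r). Nd l r) ` ({t. bt_size t \<le> n} \<times> {t. bt_size t \<le> n}))"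
      by (cases t) auto
  qed
  then show ?case by (rule finite_subset) (use Suc in auto)
qed

lemma finite_bt_size: "finite {t. bt_size t = n}"
  by (rule finite_subset[OF _ finite_bt_size_le[of n]]) auto

lemma finite_forests: "finite (forests l j)"
proof (rule finite_subset)
  show "forests l j \<subseteq> {ts. set ts \<subseteq> {t. bt_size t \<le> j} \<and> length ts = l}"
    by (auto simp: forests_def member_le_sum_list)
  show "finite {ts. set ts \<subseteq> {t. bt_size t \<le> j} \<and> length ts = l}"
    by (rule finite_lists_length_eq[OF finite_bt_size_le])
qed

lemma bt_size_0: "bt_size t = 0 \<longleftrightarrow> t = Lf" by (cases t) auto

lemma forests_0: "forests l 0 = {replicate l Lf}"
proof -
  have "ts = replicate (length ts) Lf" if "fsize ts = 0" for ts
    using that by (induction ts) (auto simp: bt_size_0)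
  moreover have "fsize (replicate l Lf) = 0" by (induction l) auto
  ultimately show ?thesis by (auto simp: forests_def)
qed

lemma forest_sum_Suc_0: "forest_sum e (Suc l) 0 = forest_sum e l 0"
proof -
  have "wts e 0 (replicate m Lf) = 1" for m by (induction m) auto
  then show ?thesis by (simp add: forest_sum_def forests_0 del: replicate.simps)
qed

lemma forest_sum_0: "forest_sum e 0 j = (if j = 0 then 1 else 0)"
proof -
  have "forests 0 j = (if j = 0 then {[]} else {})" by (auto simp: forests_def)
  then show ?thesis by (simp add: forest_sum_def)
qed

lemma forest_sum_1: "forest_sum e 1 n = (\<Sum>t | bt_size t = n. wt e 0 t)"
proof -
  have "forests 1 n = (\<lambda>t. [t]) ` {t. bt_size t = n}" by (auto simp: forests_def length_Suc_conv)
  then show ?thesis unfolding forest_sum_def by (simp add: sum.reindex inj_on_def)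
qed

text \<open>Undoing the last step of the postorder traversal: the last tree of a forest is either a leaf,
  or its root joins the last two trees of a forest with one tree more.\<close>
lemma forest_sum_Suc_Suc:
  "forest_sum e (Suc l) (Suc j) = (real j + 2) * forest_sum e l (Suc j) + forest_sum e (Suc (Suc l)) j - e * real j * forest_sum e l j"
proof -
  define P where "P = (\<lambda>ts. ts @ [Lf]) ` forests l (Suc j)"
  define join where "join = (\<lambda>us. butlast (butlast us) @ [Nd (last (butlast us)) (last us)])"
  have split2: "\<exists>ts a b. us = ts @ [a, b] \<and> length ts = l \<and> fsize ts + bt_size a + bt_size b = j" if "us \<in> forests (Suc (Suc l)) j" for us
  proof -
    from that have len: "length us = Suc (Suc l)" and sz: "fsize us = j" by (auto simp: forests_def)
    then obtain vs b where vs: "us = vs @ [b]" by (metis length_Suc_conv_rev)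
    with len have "length vs = Suc l" by simp
    then obtain ts a where "vs = ts @ [a]" by (metis length_Suc_conv_rev)
    with vs len sz show ?thesis by auto
  qed
  have join_eq: "join (ts @ [a, b]) = ts @ [Nd a b]" for ts a b by (simp add: join_def butlast_append)
  have injj: "inj_on join (forests (Suc (Suc l)) j)"
    by (rule inj_onI) (metis join_eq split2 append1_eq_conv bt.inject)
  have un: "forests (Suc l) (Suc j) = P \<union> join ` forests (Suc (Suc l)) j"
  proof (intro equalityI subsetI)
    fix ts assume "ts \<in> forests (Suc l) (Suc j)"
    then have len: "length ts = Suc l" and sz: "fsize ts = Suc j" by (auto simp: forests_def)
    then obtain vs t where vs: "ts = vs @ [t]" by (metis length_Suc_conv_rev)
    show "ts \<in> P \<union> join ` forests (Suc (Suc l)) j"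
    proof (cases t)
      case Lf then show ?thesis using vs len sz by (auto simp: P_def forests_def)
    next
      case (Nd a b)
      then have "ts = join (vs @ [a, b])" "vs @ [a, b] \<in> forests (Suc (Suc l)) j"
        using vs len sz by (auto simp: join_eq forests_def)
      then show ?thesis by blast
    qed
  next
    fix ts assume "ts \<in> P \<union> join ` forests (Suc (Suc l)) j"
    then show "ts \<in> forests (Suc l) (Suc j)"
    proof
      assume "ts \<in> P" then show ?thesis by (auto simp: P_def forests_def)
    next
      assume "ts \<in> join ` forests (Suc (Suc l)) j"
      then obtain us where us: "us \<in> forests (Suc (Suc l)) j" "ts = join us" by blast
      obtain vs a b where "us = vs @ [a, b]" "length vs = l" "fsize vs + bt_size a + bt_size b = j" using split2[OF us(1)] by blast
      then show ?thesis using us(2) by (simp add: join_eq forests_def)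
    qed
  qed
  have disj: "P \<inter> join ` forests (Suc (Suc l)) j = {}"
    by (auto simp: P_def join_def)
  have "forest_sum e (Suc l) (Suc j) = (\<Sum>ts\<in>P. wts e 0 ts) + (\<Sum>ts\<in>join ` forests (Suc (Suc l)) j. wts e 0 ts)"
    unfolding forest_sum_def un by (rule sum.union_disjoint) (use disj finite_forests in \<open>auto simp: P_def\<close>)
  also have "(\<Sum>ts\<in>P. wts e 0 ts) = (\<Sum>ts\<in>forests l (Suc j). wts e 0 (ts @ [Lf]))"
    unfolding P_def by (subst sum.reindex) (auto simp: inj_on_def)
  \<comment> \<open>The appended leaf comes after \<open>j + 1\<close> internal nodes, hence has
    \<open>j + 2\<close> targets.\<close>
  also have "\<dots> = (\<Sum>ts\<in>forests l (Suc j). (real j + 2) * wts e 0 ts)"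
    by (rule sum.cong) (auto simp: wts_append forests_def)
  also have "\<dots> = (real j + 2) * forest_sum e l (Suc j)"
    by (simp add: forest_sum_def sum_distrib_left)
  also have "(\<Sum>ts\<in>join ` forests (Suc (Suc l)) j. wts e 0 ts) = (\<Sum>us\<in>forests (Suc (Suc l)) j. wts e 0 (join us))"
    by (subst sum.reindex[OF injj]) simp
  \<comment> \<open>Joining changes the weight only if both trees are leaves: then
    \<open>(j + 1)^2\<close> becomes \<open>(j + 1)^2 - e j\<close>.\<close>
  also have "\<dots> = (\<Sum>us\<in>forests (Suc (Suc l)) j. wts e 0 us
      - (if us \<in> (\<lambda>ts. ts @ [Lf, Lf]) ` forests l j then e * real j * wts e 0 (butlast (butlast us)) else 0))"
  proof (rule sum.cong[OF refl])
    fix us assume us: "us \<in> forests (Suc (Suc l)) j"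
    obtain vs a b where v: "us = vs @ [a, b]" "length vs = l" "fsize vs + bt_size a + bt_size b = j" using split2[OF us] by blast
    have i: "us \<in> (\<lambda>ts. ts @ [Lf, Lf]) ` forests l j \<longleftrightarrow> a = Lf \<and> b = Lf" using v by (auto simp: forests_def)
    show "wts e 0 (join us) = wts e 0 us
      - (if us \<in> (\<lambda>ts. ts @ [Lf, Lf]) ` forests l j then e * real j * wts e 0 (butlast (butlast us)) else 0)"
    proof (cases "a = Lf \<and> b = Lf")
      case True
      then show ?thesis unfolding i using v
        by (simp add: join_eq wts_append butlast_append algebra_simps power2_eq_square)
    next
      case False
      then show ?thesis unfolding i using v by (auto simp: join_eq wts_append)
    qed
  qed
  also have "\<dots> = forest_sum e (Suc (Suc l)) j
      - (\<Sum>us\<in>forests (Suc (Suc l)) j. if us \<in> (\<lambda>ts. ts @ [Lf, Lf]) ` forests l j then e * real j * wts e 0 (butlast (butlast us)) else 0)"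
    by (simp add: sum_subtractf forest_sum_def)
  also have "(\<Sum>us\<in>forests (Suc (Suc l)) j. if us \<in> (\<lambda>ts. ts @ [Lf, Lf]) ` forests l j then e * real j * wts e 0 (butlast (butlast us)) else 0)
     = (\<Sum>us\<in>(\<lambda>ts. ts @ [Lf, Lf]) ` forests l j. e * real j * wts e 0 (butlast (butlast us)))"
    by (subst sum.inter_restrict[symmetric, OF finite_forests], rule sum.cong) (auto simp: forests_def)
  also have "\<dots> = (\<Sum>ts\<in>forests l j. e * real j * wts e 0 ts)"
    by (subst sum.reindex) (auto simp: inj_on_def butlast_append)
  also have "\<dots> = e * real j * forest_sum e l j" by (simp add: forest_sum_def sum_distrib_left)
  finally show ?thesis by simp
qed

lemma forest_sum_recurrence:
  assumes "0 \<le> e" "e \<le> 1" shows "signed_recurrence e (forest_sum e)"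
  using assms by unfold_locales (simp_all add: forest_sum_0 forest_sum_Suc_0 forest_sum_Suc_Suc)

section \<open>Counting lists of target pairs\<close>

lemma listset_iff: "ps \<in> listset Ls \<longleftrightarrow> length ps = length Ls \<and> (\<forall>i<length Ls. ps ! i \<in> Ls ! i)"
proof (induction Ls arbitrary: ps)
  case Nil then show ?case by auto
next
  case (Cons A Ls)
  show ?case
  proof (cases ps)
    case Nil then show ?thesis by (auto simp: set_Cons_def)
  next
    case [simp]: (Cons p qs)
    have "ps \<in> listset (A # Ls) \<longleftrightarrow> p \<in> A \<and> qs \<in> listset Ls" by (auto simp: set_Cons_def)
    also have "\<dots> \<longleftrightarrow> length ps = length (A # Ls) \<and> (\<forall>i<length (A # Ls). ps ! i \<in> (A # Ls) ! i)"
      using Cons.IH[of qs] by (auto simp: less_Suc_eq_0_disj nth_Cons')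
    finally show ?thesis .
  qed
qed

lemma listset_snoc: "listset (Ls @ [A]) = (\<lambda>(ps, p). ps @ [p]) ` (listset Ls \<times> A)"
proof (intro equalityI subsetI)
  fix ps assume ps: "ps \<in> listset (Ls @ [A])"
  then have "length ps = Suc (length Ls)" by (simp add: listset_iff)
  then obtain qs q where q: "ps = qs @ [q]" "length qs = length Ls" by (metis length_Suc_conv_rev)
  have "qs \<in> listset Ls"
    unfolding listset_iff
  proof (intro conjI allI impI)
    fix i assume "i < length Ls"
    then show "qs ! i \<in> Ls ! i" using ps q unfolding listset_iff by (auto dest!: conjunct2 spec[of _ i] simp: nth_append)
  qed (use q in auto)
  moreover have "q \<in> A" using ps q unfolding listset_iff by (auto dest!: conjunct2 spec[of _ "length Ls"] simp: nth_append)
  ultimately show "ps \<in> (\<lambda>(ps, p). ps @ [p]) ` (listset Ls \<times> A)" using q by auto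
next
  fix ps assume "ps \<in> (\<lambda>(ps, p). ps @ [p]) ` (listset Ls \<times> A)"
  then show "ps \<in> listset (Ls @ [A])" by (auto simp: listset_iff nth_append less_Suc_eq)
qed

text \<open>Here \<open>k\<close> is the number of entries already chosen; for \<open>e = 1\<close>
  a flagged entry has to avoid all of them. The parameter \<open>e\<close> lets one product serve
  for both counts.\<close>

fun choices :: "nat \<Rightarrow> nat \<Rightarrow> 'a set list \<Rightarrow> bool list \<Rightarrow> nat" where
  "choices e k (S # Ss) (c # cs) = (card S - (if c then e * k else 0)) * choices e (Suc k) Ss cs"
| "choices e k _ _ = 1"

lemma choices_append:
  "length Ls = length cs \<Longrightarrow> choices e k (Ls @ Ls') (cs @ cs') = choices e k Ls cs * choices e (k + length Ls) Ls' cs'"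
  by (induction Ls cs arbitrary: k rule: list_induct2) auto

lemma finite_listset: "(\<And>S. S \<in> set Ls \<Longrightarrow> finite S) \<Longrightarrow> finite (listset Ls)"
  by (induction Ls rule: rev_induct) (auto simp: listset_snoc)

lemma card_listset:
  assumes "length Ls = length cs"
  shows "card (listset Ls) = choices 0 0 Ls cs"
  using assms
proof (induction Ls arbitrary: cs rule: rev_induct)
  case Nil then show ?case by simp
next
  case (snoc A Ls)
  then obtain cs' c where cs: "cs = cs' @ [c]" "length cs' = length Ls" by (metis length_append_singleton length_Suc_conv_rev)
  have "card (listset (Ls @ [A])) = card (listset Ls \<times> A)"
    unfolding listset_snoc by (rule card_image) (auto simp: inj_on_def)
  also have "\<dots> = card (listset Ls) * card A" by (rule card_cartesian_product)
  also have "\<dots> = choices 0 0 (Ls @ [A]) cs" using snoc.IH[of cs'] cs by (simp add: choices_append)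
  finally show ?case .
qed

text \<open>A flagged set contains all earlier sets, so a list without repetitions excludes exactly
  as many elements as have been chosen; a set without flag is disjoint from the earlier ones and
  loses nothing.\<close>

lemma card_distinct_listset:
  assumes "length Ls = length cs" "\<And>S. S \<in> set Ls \<Longrightarrow> finite S"
    and "\<And>i k. i < k \<Longrightarrow> k < length Ls \<Longrightarrow> cs ! k \<Longrightarrow> Ls ! i \<subseteq> Ls ! k"
    and "\<And>i k. i < k \<Longrightarrow> k < length Ls \<Longrightarrow> \<not> cs ! k \<Longrightarrow> Ls ! i \<inter> Ls ! k = {}"
  shows "card {ps \<in> listset Ls. distinct ps} = choices 1 0 Ls cs"
  using assms
proof (induction Ls arbitrary: cs rule: rev_induct)
  case Nil
  have e: "{ps \<in> listset []. distinct ps} = {[]}" by auto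
  show ?case unfolding e by simp
next
  case (snoc A Ls)
  then obtain cs' c where cs: "cs = cs' @ [c]" "length cs' = length Ls" by (metis length_append_singleton length_Suc_conv_rev)
  define D where "D = {ps \<in> listset Ls. distinct ps}"
  have IH: "card D = choices 1 0 Ls cs'" unfolding D_def
  proof (rule snoc.IH)
    show "Ls ! i \<subseteq> Ls ! k" if "i < k" "k < length Ls" "cs' ! k" for i k
      using snoc.prems(3)[of i k] that cs by (simp add: nth_append)
    show "Ls ! i \<inter> Ls ! k = {}" if "i < k" "k < length Ls" "\<not> cs' ! k" for i k
      using snoc.prems(4)[of i k] that cs by (simp add: nth_append)
  qed (use cs snoc.prems(2) in auto)
  have fA: "finite A" using snoc.prems(2) by simp
  have fD: "finite D" unfolding D_def using finite_listset[of Ls] snoc.prems(2) by simp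
  have cardA: "card (A - set ps) = card A - (if c then length Ls else 0)" if "ps \<in> D" for ps
  proof -
    have ps: "length ps = length Ls" "distinct ps" "\<And>i. i < length Ls \<Longrightarrow> ps ! i \<in> Ls ! i"
      using that by (auto simp: D_def listset_iff)
    show ?thesis
    proof (cases c)
      case True
      have "set ps \<subseteq> A"
      proof
        fix x assume "x \<in> set ps"
        then obtain i where i: "i < length Ls" "x = ps ! i" using ps by (auto simp: in_set_conv_nth)
        have "Ls ! i \<subseteq> A" using snoc.prems(3)[of i "length Ls"] i cs True by (simp add: nth_append)
        then show "x \<in> A" using ps(3) i by auto
      qed
      then show ?thesis using True ps by (simp add: card_Diff_subset distinct_card)
    next
      case False
      have "A \<inter> set ps = {}"
      proof (rule ccontr)
        assume "\<not> ?thesis"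
        then obtain i where i: "i < length Ls" "ps ! i \<in> A" using ps by (auto simp: in_set_conv_nth)
        have "Ls ! i \<inter> A = {}" using snoc.prems(4)[of i "length Ls"] i cs False by (simp add: nth_append)
        then show False using ps(3) i by auto
      qed
      then have "A - set ps = A" by auto
      then show ?thesis using False by simp
    qed
  qed
  have "{ps \<in> listset (Ls @ [A]). distinct ps} = (\<lambda>(ps, p). ps @ [p]) ` (SIGMA ps:D. A - set ps)"
    unfolding listset_snoc D_def by (auto simp: image_iff)
  then have "card {ps \<in> listset (Ls @ [A]). distinct ps} = card (SIGMA ps:D. A - set ps)"
    by (simp add: card_image inj_on_def)
  also have "\<dots> = (\<Sum>ps\<in>D. card (A - set ps))" using fA fD by (subst card_SigmaI) auto
  also have "\<dots> = (\<Sum>ps\<in>D. card A - (if c then length Ls else 0))" by (rule sum.cong) (use cardA in auto)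
  also have "\<dots> = choices 1 0 (Ls @ [A]) cs" using IH cs by (simp add: choices_append)
  finally show ?case .
qed

text \<open>Vertices are numbered in postorder, the left-most leaf being 0. For a subtree whose traversal starts
  after \<open>k\<close> internal nodes, \<open>edge_targets\<close> is the set of possible targets of the edge to its root;
  since the left-most leaf has \<open>k = 0\<close>, it needs no special treatment.\<close>
fun edge_targets :: "nat \<Rightarrow> bt \<Rightarrow> nat set" where
  "edge_targets k Lf = {..k}"
| "edge_targets k (Nd l r) = {k + bt_size (Nd l r)}"

fun pair_choices :: "nat \<Rightarrow> bt \<Rightarrow> (nat \<times> nat) set list" where
  "pair_choices k Lf = []"
| "pair_choices k (Nd l r) = pair_choices k l @ pair_choices (k + bt_size l) r
     @ [edge_targets k l \<times> edge_targets (k + bt_size l) r]"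

fun cherries :: "bt \<Rightarrow> bool list" where
  "cherries Lf = []"
| "cherries (Nd l r) = cherries l @ cherries r @ [l = Lf \<and> r = Lf]"

lemma length_pair_choices: "length (pair_choices k t) = bt_size t"
  by (induction t arbitrary: k) auto

lemma length_cherries: "length (cherries t) = bt_size t"
  by (induction t) auto

text \<open>The factor \<open>card (edge_targets k t)\<close> accounts for the edge into the root of
  \<open>t\<close>; with it, the counts for the two subtrees multiply to the count for the
  whole.\<close>

lemma choices_wt:
  assumes "e \<le> 1"
  shows "real (choices e k (pair_choices k t) (cherries t)) * real (card (edge_targets k t)) = wt (real e) k t"
proof (induction t arbitrary: k)
  case Lf then show ?case by simp
next
  case (Nd l r)
  show ?case
  proof (cases "l = Lf \<and> r = Lf")
    case True
    have "e * k \<le> 1 * k" using assms by (rule mult_right_mono) simp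
    also have "1 * k \<le> Suc k * Suc k" by simp
    finally have "e * k \<le> Suc k * Suc k" .
    then have "real (Suc k * Suc k - e * k) = (real k + 1) ^ 2 - real e * real k"
      by (simp add: of_nat_diff power2_eq_square algebra_simps)
    then show ?thesis using True by simp
  next
    case False
    have c: "choices e k (pair_choices k (Nd l r)) (cherries (Nd l r)) =
      choices e k (pair_choices k l) (cherries l) * choices e (k + bt_size l) (pair_choices (k + bt_size l) r) (cherries r)
       * (card (edge_targets k l) * card (edge_targets (k + bt_size l) r))"
      using False by (auto simp: choices_append length_pair_choices length_cherries card_cartesian_product)
    have w: "wt (real e) k (Nd l r) = wt (real e) k l * wt (real e) (k + bt_size l) r" using False by auto
    show ?thesis unfolding c w Nd.IH[symmetric] of_nat_mult by (simp add: mult_ac)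
  qed
qed

lemma edge_targets_le: "edge_targets k t \<subseteq> {..k + bt_size t}"
  by (cases t) auto

text \<open>The internal node at postorder index \<open>i\<close> can only point to numbers up to
  \<open>k + i\<close>. If it is not a cherry, one of its children is the internal node just before
  it, which has number exactly \<open>k + i\<close>; so its pair differs from all earlier ones.
  Hence only cherries can repeat an earlier pair.\<close>

lemma pair_choices_nth:
  assumes "i < bt_size t"
  shows "pair_choices k t ! i \<subseteq> {..k + i} \<times> {..k + i}
    \<and> (cherries t ! i \<longrightarrow> pair_choices k t ! i = {..k + i} \<times> {..k + i})
    \<and> (\<not> cherries t ! i \<longrightarrow> (\<forall>(x, y)\<in>pair_choices k t ! i. x = k + i \<or> y = k + i))"
  using assms
proof (induction t arbitrary: k i)
  case Lf then show ?case by simp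
next
  case (Nd l r)
  consider "i < bt_size l" | "bt_size l \<le> i" "i < bt_size l + bt_size r" | "i = bt_size l + bt_size r"
    using Nd.prems by fastforce
  then show ?case
  proof cases
    case 1
    then show ?thesis using Nd.IH(1)[OF 1, of k] by (simp add: nth_append length_pair_choices length_cherries)
  next
    case 2
    then have i: "i - bt_size l < bt_size r" by simp
    from Nd.IH(2)[OF i, of "k + bt_size l"] 2 i show ?thesis
      by (simp add: nth_append length_pair_choices length_cherries)
  next
    case 3
    have s: "edge_targets k l \<subseteq> {..k + i}" "edge_targets (k + bt_size l) r \<subseteq> {..k + i}"
      using edge_targets_le[of k l] edge_targets_le[of "k + bt_size l" r] 3 by auto
    have n: "pair_choices k (Nd l r) ! i = edge_targets k l \<times> edge_targets (k + bt_size l) r"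
      "cherries (Nd l r) ! i \<longleftrightarrow> l = Lf \<and> r = Lf"
      using 3 by (simp_all add: nth_append length_pair_choices length_cherries)
    show ?thesis unfolding n using s 3 by (cases l; cases r) auto
  qed
qed

lemma card_distinct_pair_choices:
  "real (card {ps \<in> listset (pair_choices 0 T). distinct ps}) = wt 1 0 T"
proof -
  have "card {ps \<in> listset (pair_choices 0 T). distinct ps} = choices 1 0 (pair_choices 0 T) (cherries T)"
  proof (rule card_distinct_listset)
    show "length (pair_choices 0 T) = length (cherries T)" by (simp add: length_pair_choices length_cherries)
    show "finite S" if S: "S \<in> set (pair_choices 0 T)" for S
    proof -
      obtain i where "i < bt_size T" "S = pair_choices 0 T ! i"
        using S by (auto simp: in_set_conv_nth length_pair_choices)
      then have "S \<subseteq> {..i} \<times> {..i}" using pair_choices_nth[of i T 0] by simp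
      then show ?thesis by (rule finite_subset) simp
    qed
    fix i k assume ik: "i < k" "k < length (pair_choices 0 T)"
    then have k: "k < bt_size T" "i < bt_size T" by (auto simp: length_pair_choices)
    have i: "pair_choices 0 T ! i \<subseteq> {..i} \<times> {..i}" using pair_choices_nth[OF k(2), of 0] by simp
    show "pair_choices 0 T ! i \<subseteq> pair_choices 0 T ! k" if "cherries T ! k"
      using pair_choices_nth[OF k(1), of 0] that i ik by fastforce
    show "pair_choices 0 T ! i \<inter> pair_choices 0 T ! k = {}" if "\<not> cherries T ! k"
      using pair_choices_nth[OF k(1), of 0] that i ik by fastforce
  qed
  \<comment> \<open>\<open>choices_wt\<close> also counts an edge into the root of the whole tree,
    which has a single target.\<close>
  moreover have "card (edge_targets 0 T) = 1" by (cases T) auto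
  ultimately show ?thesis using choices_wt[of 1 0 T] by simp
qed

lemma card_pair_choices: "real (card (listset (pair_choices 0 T))) = wt 0 0 T"
proof -
  have "card (listset (pair_choices 0 T)) = choices 0 0 (pair_choices 0 T) (cherries T)"
    by (rule card_listset) (simp add: length_pair_choices length_cherries)
  moreover have "card (edge_targets 0 T) = 1" by (cases T) auto
  ultimately show ?thesis using choices_wt[of 0 0 T] by simp
qed

section \<open>Pointer structures\<close>

lemma internal_leaf_disjoint: "p \<in> internal_pos T \<Longrightarrow> p \<notin> leaf_pos T"
  by (induction T arbitrary: p) auto

lemma set_post: "set (post T) = internal_pos T \<union> leaf_pos T"
  by (induction T) auto

lemma distinct_post: "distinct (post T)"
  by (induction T) (auto simp: distinct_map)

lemma post_nonempty: "post T \<noteq> []"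
  by (cases T) auto

lemma hd_post: "hd (post T) = lml T"
  by (induction T) (auto simp: hd_append hd_map post_nonempty)

lemma lml_leaf: "lml T \<in> leaf_pos T"
  by (induction T) auto

lemma lml_not_internal: "lml T \<notin> internal_pos T"
  using lml_leaf internal_leaf_disjoint by blast

lemma root_in_post: "[] \<in> set (post T)"
  by (cases T) auto

lemma finite_leaf_pos: "finite (leaf_pos T)"
  by (induction T) auto

lemma finite_verts: "finite (verts T)"
proof -
  have "finite (internal_pos T)" by (induction T) auto
  then show ?thesis by (simp add: verts_def)
qed

lemma position_simps:
  "c # q \<in> internal_pos (Nd l r) \<longleftrightarrow> q \<in> internal_pos (if c then r else l)"
  "c # q \<in> leaf_pos (Nd l r) \<longleftrightarrow> q \<in> leaf_pos (if c then r else l)"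
  by (cases c; auto)+

lemma child_position: "u \<in> internal_pos T \<Longrightarrow> u @ [b] \<in> internal_pos T \<union> leaf_pos T"
proof (induction T arbitrary: u)
  case (Nd l r)
  have root: "[] \<in> internal_pos t \<union> leaf_pos t" for t by (cases t) auto
  show ?case
  proof (cases u)
    case Nil
    have "[b] \<in> internal_pos (Nd l r) \<union> leaf_pos (Nd l r)"
      using root[of l] root[of r] unfolding Un_iff position_simps by auto
    then show ?thesis by (simp add: Nil)
  next
    case (Cons c q)
    then have "q \<in> internal_pos (if c then r else l)" using Nd.prems by (simp only: position_simps)
    then have "q @ [b] \<in> internal_pos (if c then r else l) \<union> leaf_pos (if c then r else l)"
      using Nd.IH by (cases c) auto
    then show ?thesis unfolding Cons append_Cons Un_iff position_simps .
  qed
qed simp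

lemma leaf_parent: "l \<in> leaf_pos T \<Longrightarrow> T \<noteq> Lf \<Longrightarrow> l \<noteq> [] \<and> butlast l \<in> internal_pos T"
proof (induction T arbitrary: l)
  case (Nd L R)
  obtain c q where l: "l = c # q" using Nd.prems by (cases l) auto
  then have q: "q \<in> leaf_pos (if c then R else L)" using Nd.prems by (simp only: position_simps)
  show ?case
  proof (cases "(if c then R else L) = Lf")
    case True
    then show ?thesis using q l by auto
  next
    case False
    then have "q \<noteq> [] \<and> butlast q \<in> internal_pos (if c then R else L)" using q Nd.IH by (cases c) auto
    moreover from this have "c # butlast q \<in> internal_pos (Nd L R)" unfolding position_simps by blast
    ultimately show ?thesis by (simp add: l)
  qed
qed simp

lemma precedes_iff_split: "precedes T p q \<longleftrightarrow> (\<exists>xs ys zs. post T = xs @ p # ys @ q # zs)"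
proof
  assume "precedes T p q"
  then obtain i j where ij: "i < j" "j < length (post T)" "post T ! i = p" "post T ! j = q" by (auto simp: precedes_def)
  define us where "us = take j (post T)"
  have 1: "post T = us @ q # drop (Suc j) (post T)" using ij id_take_nth_drop[of j "post T"] by (simp add: us_def)
  have "us = take i us @ p # drop (Suc i) us" using ij id_take_nth_drop[of i us] by (simp add: us_def)
  then show "\<exists>xs ys zs. post T = xs @ p # ys @ q # zs" using 1 by (metis append.assoc append_Cons)
next
  assume "\<exists>xs ys zs. post T = xs @ p # ys @ q # zs"
  then obtain xs ys zs where "post T = xs @ p # ys @ q # zs" by blast
  then show "precedes T p q" unfolding precedes_def
    by (intro exI[of _ "length xs"] exI[of _ "length xs + Suc (length ys)"]) (auto simp: nth_append)
qed

text \<open>Positions do not repeat in postorder, so the splitting of the list at \<open>q\<close>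
  is unique.\<close>

lemma precedes_split:
  assumes "post T = xs @ q # ys"
  shows "precedes T p q \<longleftrightarrow> p \<in> set xs"
proof
  assume "precedes T p q"
  then obtain us vs ws where "post T = us @ p # vs @ q # ws" using precedes_iff_split by blast
  then have eq: "(us @ p # vs) @ q # ws = xs @ q # ys" and d: "distinct ((us @ p # vs) @ q # ws)"
    using assms distinct_post[of T] by simp_all
  have "q \<notin> set (us @ p # vs)" "q \<notin> set ws" using d by auto
  then have "us @ p # vs = xs" using append_Cons_eq_iff[of q "us @ p # vs" ws xs ys] eq by blast
  then show "p \<in> set xs" by auto
next
  assume "p \<in> set xs"
  then obtain us vs where "xs = us @ p # vs" by (meson split_list)
  then show "precedes T p q" using assms precedes_iff_split by fastforce
qed

lemma precedes_child: "u \<in> internal_pos T \<Longrightarrow> precedes T (u @ [b]) u"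
proof (induction T arbitrary: u)
  case (Nd l r)
  consider "u = []" | v where "u = False # v" "v \<in> internal_pos l" | v where "u = True # v" "v \<in> internal_pos r"
    using Nd.prems by auto
  then show ?case
  proof cases
    case 1
    have "post (Nd l r) = (map (Cons False) (post l) @ map (Cons True) (post r)) @ [] # []" by simp
    from precedes_split[OF this] show ?thesis using 1 root_in_post[of l] root_in_post[of r] by (cases b) auto
  next
    case 2
    then obtain xs ys zs where "post l = xs @ (v @ [b]) # ys @ v # zs" using Nd.IH(1) precedes_iff_split by blast
    then have "post (Nd l r) = map (Cons False) xs @ (u @ [b]) # map (Cons False) ys @ u # (map (Cons False) zs @ map (Cons True) (post r) @ [[]])"
      using 2 by simp
    then show ?thesis using precedes_iff_split by blast
  next
    case 3
    then obtain xs ys zs where "post r = xs @ (v @ [b]) # ys @ v # zs" using Nd.IH(2) precedes_iff_split by blast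
    then have "post (Nd l r) = (map (Cons False) (post l) @ map (Cons True) xs) @ (u @ [b]) # map (Cons True) ys @ u # (map (Cons True) zs @ [[]])"
      using 3 by simp
    then show ?thesis using precedes_iff_split by blast
  qed
qed simp

lemma precedes_trans: "precedes T p q \<Longrightarrow> precedes T q s \<Longrightarrow> precedes T p s"
proof -
  assume "precedes T p q" "precedes T q s"
  then obtain i j i' j' where "i < j" "j < length (post T)" "post T ! i = p" "post T ! j = q"
    "i' < j'" "j' < length (post T)" "post T ! i' = q" "post T ! j' = s" unfolding precedes_def by blast
  note ij = this
  have "j = i'" using nth_eq_iff_index_eq[OF distinct_post, of j T i'] ij by auto
  with ij show "precedes T p s" unfolding precedes_def by (intro exI[of _ i] exI[of _ j']) simp
qed

section \<open>Out-neighbours and the trees \<open>B(u)\<close> over a fixed spine\<close>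

definition ptr_space :: "bt \<Rightarrow> (bool list \<Rightarrow> bool list) set" where
  "ptr_space T = PiE (ptr_leaves T) (\<lambda>l. {v \<in> verts T. precedes T v l})"

lemma outn_props:
  assumes ptr: "ptr \<in> ptr_space T" and u: "u \<in> internal_pos T"
  shows "outn T ptr u b \<in> verts T" "precedes T (outn T ptr u b) u"
proof -
  have c: "u @ [b] \<in> internal_pos T \<union> leaf_pos T" using u by (rule child_position)
  have pc: "precedes T (u @ [b]) u" using u by (rule precedes_child)
  show "outn T ptr u b \<in> verts T"
  proof (cases "u @ [b] \<in> verts T")
    case False
    then have "u @ [b] \<in> ptr_leaves T" using c by (auto simp: ptr_leaves_def verts_def)
    then show ?thesis using ptr False by (auto simp: ptr_space_def outn_def)
  qed (simp add: outn_def)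
  show "precedes T (outn T ptr u b) u"
  proof (cases "u @ [b] \<in> verts T")
    case False
    then have "u @ [b] \<in> ptr_leaves T" using c by (auto simp: ptr_leaves_def verts_def)
    then have "precedes T (ptr (u @ [b])) (u @ [b])" using ptr by (auto simp: ptr_space_def)
    then show ?thesis using pc False by (auto simp: outn_def intro: precedes_trans)
  qed (use pc in \<open>simp add: outn_def\<close>)
qed

definition out_pair :: "bt \<Rightarrow> (bool list \<Rightarrow> bool list) \<Rightarrow> bool list \<Rightarrow> bool list \<times> bool list" where
  "out_pair T ptr u = (outn T ptr u False, outn T ptr u True)"

lemma precedes_nth:
  assumes "precedes T p (post T ! i)" "i < length (post T)"
  obtains j where "j < i" "post T ! j = p"
proof -
  from assms(1) obtain j k where jk: "j < k" "k < length (post T)" "post T ! j = p" "post T ! k = post T ! i"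
    by (auto simp: precedes_def)
  then have "k = i" using distinct_post[of T] assms(2) by (simp add: nth_eq_iff_index_eq)
  with jk that show ?thesis by blast
qed

text \<open>Every edge leads to a smaller postorder index, and index 0 is the left-most leaf, so
  fuel equal to the index of the vertex is already enough.\<close>

lemma Bf_fuel:
  assumes "ptr \<in> ptr_space T" "i < length (post T)" "post T ! i \<in> verts T" "i \<le> f" "i \<le> f'"
  shows "Bf T ptr f (post T ! i) = Bf T ptr f' (post T ! i)"
  using assms(2-)
proof (induction i arbitrary: f f' rule: less_induct)
  case (less i)
  show ?case
  proof (cases "post T ! i = lml T")
    case True then show ?thesis by (cases f; cases f') auto
  next
    case False
    have "post T ! 0 = lml T" using hd_post[of T] post_nonempty[of T] by (simp add: hd_conv_nth)
    then have "i \<noteq> 0" using False by metis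
    then obtain g g' where g: "f = Suc g" "f' = Suc g'" "i \<le> Suc g" "i \<le> Suc g'" using less.prems by (metis not0_implies_Suc le_zero_eq)
    have u: "post T ! i \<in> internal_pos T" using False less.prems(2) by (simp add: verts_def)
    have "Bf T ptr g (outn T ptr (post T ! i) b) = Bf T ptr g' (outn T ptr (post T ! i) b)" for b
    proof -
      obtain j where j: "j < i" "post T ! j = outn T ptr (post T ! i) b"
        using precedes_nth[OF outn_props(2)[OF assms(1) u] less.prems(1)] by blast
      have "Bf T ptr g (post T ! j) = Bf T ptr g' (post T ! j)"
        by (rule less.IH) (use j g less.prems outn_props(1)[OF assms(1) u] in auto)
      then show ?thesis by (simp add: j)
    qed
    then show ?thesis by (simp add: g)
  qed
qed

lemma BB_lml: "BB T ptr (lml T) = Lf"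
  by (cases "length (post T)") (auto simp: BB_def)

lemma BB_internal:
  assumes ptr: "ptr \<in> ptr_space T" and u: "u \<in> internal_pos T"
  shows "BB T ptr u = Nd (BB T ptr (outn T ptr u False)) (BB T ptr (outn T ptr u True))"
proof -
  obtain g where g: "length (post T) = Suc g" using post_nonempty[of T] by (cases "length (post T)") auto
  have "u \<in> set (post T)" using u by (simp add: set_post)
  then obtain i where i: "i < length (post T)" "post T ! i = u" by (auto simp: in_set_conv_nth)
  have "Bf T ptr g (outn T ptr u b) = BB T ptr (outn T ptr u b)" for b
  proof -
    have "precedes T (outn T ptr u b) (post T ! i)" using outn_props(2)[OF ptr u] i by simp
    then obtain j where j: "j < i" "post T ! j = outn T ptr u b" using precedes_nth i by blast
    have "Bf T ptr g (post T ! j) = Bf T ptr (length (post T)) (post T ! j)"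
      by (rule Bf_fuel[OF ptr]) (use j i g outn_props(1)[OF ptr u] in auto)
    then show ?thesis by (simp add: BB_def j)
  qed
  moreover have "u \<noteq> lml T" using u lml_not_internal by auto
  ultimately show ?thesis by (simp add: BB_def g)
qed

text \<open>If two distinct vertices have equal trees, then a minimal such pair has equal out-neighbours.\<close>
lemma inj_BB_iff:
  assumes ptr: "ptr \<in> ptr_space T"
  shows "inj_on (BB T ptr) (verts T) \<longleftrightarrow> inj_on (out_pair T ptr) (internal_pos T)"
proof
  assume inj: "inj_on (BB T ptr) (verts T)"
  show "inj_on (out_pair T ptr) (internal_pos T)"
  proof (rule inj_onI)
    fix u v assume uv: "u \<in> internal_pos T" "v \<in> internal_pos T" "out_pair T ptr u = out_pair T ptr v"
    then have "BB T ptr u = BB T ptr v" using BB_internal[OF ptr] by (auto simp: out_pair_def)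
    then show "u = v" using inj uv by (auto simp: inj_on_def verts_def)
  qed
next
  assume inj: "inj_on (out_pair T ptr) (internal_pos T)"
  \<comment> \<open>Induction on the larger of the two postorder indices; out-neighbours have
    smaller ones.\<close>
  have main: "\<forall>i j. i \<le> n \<longrightarrow> j \<le> n \<longrightarrow> i < length (post T) \<longrightarrow> j < length (post T) \<longrightarrow> post T ! i \<in> verts T \<longrightarrow> post T ! j \<in> verts T
     \<longrightarrow> BB T ptr (post T ! i) = BB T ptr (post T ! j) \<longrightarrow> post T ! i = post T ! j" for n
  proof (induction n rule: less_induct)
    case (less n)
    show ?case
    proof (intro allI impI)
      fix i j assume ij: "i \<le> n" "j \<le> n" "i < length (post T)" "j < length (post T)" "post T ! i \<in> verts T" "post T ! j \<in> verts T"
        and eq: "BB T ptr (post T ! i) = BB T ptr (post T ! j)"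
      show "post T ! i = post T ! j"
      proof (cases "post T ! i = lml T \<or> post T ! j = lml T")
        case True
        then show ?thesis using ij(5,6) eq BB_internal[OF ptr] BB_lml[of T ptr] by (auto simp: verts_def)
      next
        case False
        then have int: "post T ! i \<in> internal_pos T" "post T ! j \<in> internal_pos T" using ij by (auto simp: verts_def)
        have "outn T ptr (post T ! i) b = outn T ptr (post T ! j) b" for b
        proof -
          obtain i' where i': "i' < i" "post T ! i' = outn T ptr (post T ! i) b"
            using precedes_nth[OF outn_props(2)[OF ptr int(1)] ij(3)] by blast
          obtain j' where j': "j' < j" "post T ! j' = outn T ptr (post T ! j) b"
            using precedes_nth[OF outn_props(2)[OF ptr int(2)] ij(4)] by blast
          have "BB T ptr (outn T ptr (post T ! i) b) = BB T ptr (outn T ptr (post T ! j) b)"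
            using eq BB_internal[OF ptr int(1)] BB_internal[OF ptr int(2)] by (cases b) auto
          then show ?thesis
            using less.IH[of "max i' j'", rule_format, of i' j'] i' j' ij outn_props(1)[OF ptr int(1)] outn_props(1)[OF ptr int(2)]
            by auto
        qed
        then show ?thesis using inj int by (auto simp: inj_on_def out_pair_def)
      qed
    qed
  qed
  show "inj_on (BB T ptr) (verts T)"
  proof (rule inj_onI)
    fix u v assume uv: "u \<in> verts T" "v \<in> verts T" "BB T ptr u = BB T ptr v"
    have "verts T \<subseteq> set (post T)" using lml_leaf[of T] by (auto simp: verts_def set_post)
    then obtain i j where "i < length (post T)" "post T ! i = u" "j < length (post T)" "post T ! j = v"
      using uv by (metis in_set_conv_nth subsetD)
    then show "u = v" using main[of "max i j"] uv by auto
  qed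
qed

section \<open>Vertex numbers and the bijection with pointer assignments\<close>

definition internals :: "bt \<Rightarrow> bool list list" where
  "internals T = filter (\<lambda>p. p \<in> internal_pos T) (post T)"

definition numbering :: "bt \<Rightarrow> nat \<Rightarrow> bool list" where
  "numbering T i = (lml T # internals T) ! i"

definition targets :: "bt \<Rightarrow> bool list \<Rightarrow> bool list set" where
  "targets T c = (if c \<in> verts T then {c} else {v \<in> verts T. precedes T v c})"

definition target_pairs :: "bt \<Rightarrow> (bool list \<times> bool list) set list" where
  "target_pairs T = map (\<lambda>u. targets T (u @ [False]) \<times> targets T (u @ [True])) (internals T)"

lemma set_internals: "set (internals T) = internal_pos T"
  by (auto simp: internals_def set_post)

lemma distinct_internals: "distinct (internals T)"
  by (simp add: internals_def distinct_post)

lemma length_internals: "length (internals T) = bt_size T"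
proof (induction T)
  case (Nd l r)
  have 1: "filter (\<lambda>p. p \<in> internal_pos (Nd l r)) (map (Cons False) (post l)) = map (Cons False) (internals l)"
    unfolding internals_def filter_map o_def position_simps by simp
  have 2: "filter (\<lambda>p. p \<in> internal_pos (Nd l r)) (map (Cons True) (post r)) = map (Cons True) (internals r)"
    unfolding internals_def filter_map o_def position_simps by simp
  show ?case unfolding internals_def[of "Nd l r"] post.simps filter_append 1 2 using Nd by simp
qed (simp add: internals_def)

lemma inj_numbering: "inj_on (numbering T) {..bt_size T}"
proof -
  have "distinct (lml T # internals T)"
    using distinct_internals lml_not_internal by (simp add: set_internals)
  moreover have "length (lml T # internals T) = Suc (bt_size T)" by (simp add: length_internals)
  ultimately show ?thesis unfolding numbering_def[abs_def] by (intro inj_on_nth) auto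
qed

lemma numbering_prefix:
  assumes "internals T = xs @ ys"
  shows "numbering T ` {..length xs} = insert (lml T) (set xs)"
proof -
  have "numbering T ` {..length xs} = (\<lambda>i. (lml T # xs) ! i) ` {..<length (lml T # xs)}"
    unfolding numbering_def[abs_def] assms
    by (rule image_cong) (auto simp: nth_append nth_Cons')
  also have "\<dots> = set (lml T # xs)" by (simp only: set_conv_nth) auto
  finally show ?thesis by simp
qed

lemma subtree_internal_count:
  assumes "\<And>q. q \<in> set (post t) \<Longrightarrow> p @ q \<in> internal_pos T \<longleftrightarrow> q \<in> internal_pos t"
  shows "length (filter (\<lambda>p. p \<in> internal_pos T) (map ((@) p) (post t))) = bt_size t"
proof -
  have "filter (\<lambda>p. p \<in> internal_pos T) (map ((@) p) (post t)) = map ((@) p) (internals t)"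
    unfolding filter_map internals_def o_def using assms by (auto intro!: arg_cong[where f = "map _"] filter_cong)
  then show ?thesis by (simp add: length_internals)
qed

text \<open>A subtree occupies a contiguous block of the postorder list. Its root, if internal, is
  the last of \<open>bt_size t\<close> internal nodes after the first \<open>k\<close>. If it is a
  leaf, the vertices before it are the left-most leaf and those \<open>k\<close> nodes; for the
  left-most leaf itself the prefix is empty, and both sides consist of that leaf.\<close>

lemma targets_subtree:
  assumes T: "post T = xs @ map ((@) p) (post t) @ ys"
    and int: "\<And>q. q \<in> set (post t) \<Longrightarrow> p @ q \<in> internal_pos T \<longleftrightarrow> q \<in> internal_pos t"
    and k: "k = length (filter (\<lambda>p. p \<in> internal_pos T) xs)"
  shows "targets T p = numbering T ` edge_targets k t"
proof (cases t)
  case (Nd l r)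
  have p: "p \<in> internal_pos T" using int[of "[]"] root_in_post[of t] Nd by simp
  define F where "F = filter (\<lambda>p. p \<in> internal_pos T)"
  have e: "internals T = F xs @ F (map ((@) p) (post t)) @ F ys" unfolding internals_def T F_def by simp
  have "F (map ((@) p) (post t)) = F (map ((@) p) (map (Cons False) (post l) @ map (Cons True) (post r))) @ [p]"
    unfolding Nd F_def using p by simp
  then obtain zs where zs: "F (map ((@) p) (post t)) = zs @ [p]" by blast
  have "length (F (map ((@) p) (post t))) = bt_size t" unfolding F_def by (rule subtree_internal_count[OF int])
  then have "length zs + 1 = bt_size t" by (simp add: zs)
  then have "numbering T (k + bt_size t) = p"
    unfolding numbering_def e zs k F_def[symmetric] by (simp add: nth_append flip: \<open>length zs + 1 = bt_size t\<close>)
  then show ?thesis using p Nd by (simp add: targets_def verts_def)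
next
  case Lf
  have T': "post T = xs @ p # ys" using T Lf by simp
  have p: "p \<notin> internal_pos T" using int[of "[]"] Lf by simp
  define F where "F = filter (\<lambda>p. p \<in> internal_pos T)"
  have e: "internals T = F xs @ F ys" unfolding internals_def T' F_def using p by simp
  have num: "numbering T ` edge_targets k t = insert (lml T) (set (F xs))"
    using numbering_prefix[OF e] Lf by (simp add: k F_def)
  show ?thesis
  proof (cases "p = lml T")
    case True
    have "xs = []"
    proof (rule ccontr)
      assume "xs \<noteq> []"
      then have "hd (post T) \<in> set xs" by (simp add: T')
      then have "p \<in> set xs" using True by (simp add: hd_post)
      moreover have "p \<notin> set xs" using distinct_post[of T] unfolding T' by simp
      ultimately show False by blast
    qed
    then show ?thesis unfolding num using True by (simp add: targets_def verts_def F_def)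
  next
    case False
    have "xs \<noteq> []" using hd_post[of T] False by (auto simp: T')
    then have l: "lml T \<in> set xs" using hd_post[of T] by (cases xs) (auto simp: T')
    have "p \<notin> verts T" using p False by (simp add: verts_def)
    then have "targets T p = {v \<in> verts T. v \<in> set xs}" by (simp add: targets_def precedes_split[OF T'])
    then show ?thesis unfolding num using l by (auto simp: verts_def F_def)
  qed
qed

text \<open>Induction over subtrees needs the position \<open>p\<close>, the prefix
  \<open>xs\<close> of the postorder list and the count \<open>k\<close> to vary: the right subtree
  starts after the block of the left one.\<close>

lemma target_pairs_subtree:
  assumes "post T = xs @ map ((@) p) (post t) @ ys"
    and "\<And>q. q \<in> set (post t) \<Longrightarrow> p @ q \<in> internal_pos T \<longleftrightarrow> q \<in> internal_pos t"
    and "k = length (filter (\<lambda>p. p \<in> internal_pos T) xs)"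
  shows "map (\<lambda>u. targets T (u @ [False]) \<times> targets T (u @ [True])) (filter (\<lambda>p. p \<in> internal_pos T) (map ((@) p) (post t)))
     = map (\<lambda>S. map_prod (numbering T) (numbering T) ` S) (pair_choices k t)"
  using assms
proof (induction t arbitrary: p xs ys k)
  case Lf
  then show ?case by simp
next
  case (Nd l r)
  have intl: "(p @ [False]) @ q \<in> internal_pos T \<longleftrightarrow> q \<in> internal_pos l" if "q \<in> set (post l)" for q
    using Nd.prems(2)[of "False # q"] that position_simps(1)[of False q l r] by simp
  have intr: "(p @ [True]) @ q \<in> internal_pos T \<longleftrightarrow> q \<in> internal_pos r" if "q \<in> set (post r)" for q
    using Nd.prems(2)[of "True # q"] that position_simps(1)[of True q l r] by simp
  have p: "p \<in> internal_pos T" using Nd.prems(2)[of "[]"] by simp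
  have pl: "map ((@) p) (map (Cons False) (post l)) = map ((@) (p @ [False])) (post l)" by simp
  have pr: "map ((@) p) (map (Cons True) (post r)) = map ((@) (p @ [True])) (post r)" by simp
  have sp: "map ((@) p) (post (Nd l r)) = map ((@) (p @ [False])) (post l) @ map ((@) (p @ [True])) (post r) @ [p]" by simp
  have Tl: "post T = xs @ map ((@) (p @ [False])) (post l) @ (map ((@) (p @ [True])) (post r) @ [p] @ ys)"
    using Nd.prems(1) unfolding sp by simp
  have Tr: "post T = (xs @ map ((@) (p @ [False])) (post l)) @ map ((@) (p @ [True])) (post r) @ ([p] @ ys)"
    using Nd.prems(1) unfolding sp by simp
  have kr: "k + bt_size l = length (filter (\<lambda>p. p \<in> internal_pos T) (xs @ map ((@) (p @ [False])) (post l)))"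
  proof -
    have "length (filter (\<lambda>p. p \<in> internal_pos T) (map ((@) (p @ [False])) (post l))) = bt_size l"
      by (rule subtree_internal_count[OF intl])
    then show ?thesis unfolding filter_append length_append Nd.prems(3) by (rule arg_cong[OF sym])
  qed
  have ml: "targets T (p @ [False]) = numbering T ` edge_targets k l"
    by (rule targets_subtree[OF Tl intl Nd.prems(3)])
  have mr: "targets T (p @ [True]) = numbering T ` edge_targets (k + bt_size l) r"
    by (rule targets_subtree[OF Tr intr kr])
  have img: "map_prod f f ` (A \<times> B) = (f ` A) \<times> (f ` B)" for f :: "nat \<Rightarrow> bool list" and A B by auto
  have il: "map (\<lambda>u. targets T (u @ [False]) \<times> targets T (u @ [True])) (filter (\<lambda>p. p \<in> internal_pos T) (map ((@) (p @ [False])) (post l)))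
     = map (\<lambda>S. map_prod (numbering T) (numbering T) ` S) (pair_choices k l)"
    by (rule Nd.IH(1)[OF Tl intl Nd.prems(3)])
  have ir: "map (\<lambda>u. targets T (u @ [False]) \<times> targets T (u @ [True])) (filter (\<lambda>p. p \<in> internal_pos T) (map ((@) (p @ [True])) (post r)))
     = map (\<lambda>S. map_prod (numbering T) (numbering T) ` S) (pair_choices (k + bt_size l) r)"
    by (rule Nd.IH(2)[OF Tr intr kr])
  show ?case
    unfolding sp filter_append map_append il ir using p by (simp add: ml mr img)
qed

lemma target_pairs_numbering:
  "target_pairs T = map (\<lambda>S. map_prod (numbering T) (numbering T) ` S) (pair_choices 0 T)"
  using target_pairs_subtree[of T "[]" "[]" T "[]" 0] by (simp add: target_pairs_def internals_def cong: map_cong)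

lemma listset_image: "listset (map (\<lambda>S. f ` S) Ls) = map f ` listset Ls"
  by (induction Ls) (auto simp: set_Cons_def image_iff, force+)

text \<open>All numbers involved are at most \<open>bt_size T\<close>, where
  \<open>numbering\<close> is injective; so lists of positions can be counted, and tested for
  repetitions, as lists of numbers.\<close>

lemma listset_target_pairs:
  "bij_betw (map (map_prod (numbering T) (numbering T))) (listset (pair_choices 0 T)) (listset (target_pairs T))"
  "ps \<in> listset (pair_choices 0 T) \<Longrightarrow> distinct (map (map_prod (numbering T) (numbering T)) ps) \<longleftrightarrow> distinct ps"
proof -
  define f where "f = map_prod (numbering T) (numbering T)"
  have inj: "inj_on f ({..bt_size T} \<times> {..bt_size T})"
    unfolding f_def by (rule map_prod_inj_on[OF inj_numbering inj_numbering])
  have sub: "set ps \<subseteq> {..bt_size T} \<times> {..bt_size T}" if ps: "ps \<in> listset (pair_choices 0 T)" for ps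
  proof
    fix x assume "x \<in> set ps"
    then obtain i where i: "i < bt_size T" "x = ps ! i"
      using ps by (auto simp: in_set_conv_nth listset_iff length_pair_choices)
    then have "x \<in> pair_choices 0 T ! i" using ps by (simp add: listset_iff length_pair_choices)
    then have "x \<in> {..i} \<times> {..i}" using pair_choices_nth[OF i(1), of 0] by auto
    then show "x \<in> {..bt_size T} \<times> {..bt_size T}" using i by auto
  qed
  have "inj_on (map f) (listset (pair_choices 0 T))"
  proof (rule inj_onI)
    fix ps qs assume "ps \<in> listset (pair_choices 0 T)" "qs \<in> listset (pair_choices 0 T)" "map f ps = map f qs"
    then show "ps = qs" using sub[of ps] sub[of qs] by (intro map_inj_on[of f]) (auto intro: inj_on_subset[OF inj])
  qed
  then show "bij_betw (map (map_prod (numbering T) (numbering T))) (listset (pair_choices 0 T)) (listset (target_pairs T))"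
    by (simp add: bij_betw_def target_pairs_numbering listset_image f_def)
  show "ps \<in> listset (pair_choices 0 T) \<Longrightarrow> distinct (map (map_prod (numbering T) (numbering T)) ps) \<longleftrightarrow> distinct ps"
    using sub[of ps] inj_on_subset[OF inj] by (auto simp: distinct_map f_def)
qed

text \<open>Every leaf other than the left-most one is the left or right child of exactly one
  internal node, so choosing all pointers amounts to choosing a pair of out-neighbours at every
  internal node.\<close>

lemma pointers_bij:
  "bij_betw (\<lambda>ptr. map (out_pair T ptr) (internals T)) (ptr_space T) (listset (target_pairs T))"
  unfolding bij_betw_def
proof
  have leaf: "butlast l \<in> internal_pos T \<and> l = butlast l @ [last l]" if "l \<in> ptr_leaves T" for l
  proof -
    have "T \<noteq> Lf" using that by (auto simp: ptr_leaves_def)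
    then have "l \<noteq> [] \<and> butlast l \<in> internal_pos T" using that leaf_parent by (auto simp: ptr_leaves_def)
    then show ?thesis by simp
  qed
  have leaf_notin: "l \<notin> verts T" if "l \<in> ptr_leaves T" for l
    using that internal_leaf_disjoint by (auto simp: ptr_leaves_def verts_def)
  have child: "u @ [b] \<in> ptr_leaves T" if "u \<in> internal_pos T" "u @ [b] \<notin> verts T" for u b
    using child_position[OF that(1), of b] that(2) by (auto simp: ptr_leaves_def verts_def)
  show "inj_on (\<lambda>ptr. map (out_pair T ptr) (internals T)) (ptr_space T)"
  proof (rule inj_onI)
    fix f g assume f: "f \<in> ptr_space T" and g: "g \<in> ptr_space T" and eq: "map (out_pair T f) (internals T) = map (out_pair T g) (internals T)"
    have "f l = g l" if l: "l \<in> ptr_leaves T" for l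
    proof -
      define u where "u = butlast l" define b where "b = last l"
      have u: "u \<in> internal_pos T" "l = u @ [b]" using leaf[OF l] by (auto simp: u_def b_def)
      have "out_pair T f u = out_pair T g u" using eq u(1) by (simp add: set_internals)
      then have "outn T f u b = outn T g u b" by (cases b) (auto simp: out_pair_def)
      then show ?thesis using leaf_notin[OF l] by (simp add: outn_def flip: u(2))
    qed
    then show "f = g" using f g unfolding ptr_space_def by (intro PiE_ext) auto
  qed
  have out_target: "outn T f u b \<in> targets T (u @ [b])" if "f \<in> ptr_space T" "u \<in> internal_pos T" for f u b
    using that child[of u b] by (auto simp: outn_def targets_def ptr_space_def)
  show "(\<lambda>ptr. map (out_pair T ptr) (internals T)) ` ptr_space T = listset (target_pairs T)"
  proof (intro equalityI subsetI)
    fix ps assume "ps \<in> (\<lambda>ptr. map (out_pair T ptr) (internals T)) ` ptr_space T"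
    then obtain f where f: "f \<in> ptr_space T" "ps = map (out_pair T f) (internals T)" by blast
    have "internals T ! i \<in> internal_pos T" if "i < length (internals T)" for i
      using that nth_mem set_internals by blast
    then show "ps \<in> listset (target_pairs T)"
      using out_target[OF f(1)] by (auto simp: listset_iff target_pairs_def f(2) out_pair_def)
  next
    fix ps assume ps: "ps \<in> listset (target_pairs T)"
    define m where "m = map_of (zip (internals T) ps)"
    \<comment> \<open>The parent of a leaf \<open>l\<close> is \<open>butlast l\<close>, and
      \<open>last l\<close> tells which component of the parent's pair belongs to
      \<open>l\<close>.\<close>
    define f where "f = (\<lambda>l\<in>ptr_leaves T. (if last l then snd else fst) (the (m (butlast l))))"
    have len: "length ps = length (internals T)" using ps by (simp add: listset_iff target_pairs_def)
    have m: "m (internals T ! i) = Some (ps ! i)" if "i < length (internals T)" for i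
      unfolding m_def using that len by (intro map_of_zip_nth) (auto simp: distinct_internals)
    have tgt: "ps ! i \<in> targets T (internals T ! i @ [False]) \<times> targets T (internals T ! i @ [True])"
      if "i < length (internals T)" for i
      using ps that by (simp add: listset_iff target_pairs_def)
    have comp: "outn T f (internals T ! i) b = (if b then snd else fst) (ps ! i)" if i: "i < length (internals T)" for i b
    proof -
      have u: "internals T ! i \<in> internal_pos T" using nth_mem[OF i] by (simp add: set_internals)
      show ?thesis
      proof (cases "internals T ! i @ [b] \<in> verts T")
        case True
        then show ?thesis using tgt[OF i] by (cases b) (auto simp: outn_def targets_def)
      next
        case False
        then show ?thesis using child[OF u False] by (simp add: outn_def f_def m[OF i])
      qed
    qed
    have "f \<in> ptr_space T" unfolding ptr_space_def
    proof (rule PiE_I)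
      fix l assume l: "l \<in> ptr_leaves T"
      obtain i where i: "i < length (internals T)" "internals T ! i = butlast l"
        using leaf[OF l] by (metis in_set_conv_nth set_internals)
      have e: "internals T ! i @ [last l] = l" using leaf[OF l] i by simp
      have "f l = (if last l then snd else fst) (ps ! i)" using m[OF i(1)] i l by (simp add: f_def)
      moreover have "(if last l then snd else fst) (ps ! i) \<in> targets T (internals T ! i @ [last l])"
        using tgt[OF i(1)] by (cases "last l") auto
      ultimately have "f l \<in> targets T l" unfolding e by simp
      then show "f l \<in> {v \<in> verts T. precedes T v l}" using leaf_notin[OF l] by (simp add: targets_def)
    qed (simp add: f_def)
    moreover have "map (out_pair T f) (internals T) = ps"
      using len by (intro nth_equalityI) (auto simp: out_pair_def comp)
    ultimately show "ps \<in> (\<lambda>ptr. map (out_pair T ptr) (internals T)) ` ptr_space T" by blast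
  qed
qed

lemma card_ptr_space: "real (card (ptr_space T)) = wt 0 0 T"
  using bij_betw_same_card[OF pointers_bij] bij_betw_same_card[OF listset_target_pairs(1)] card_pair_choices[of T] by simp

text \<open>By \<open>inj_BB_iff\<close>, being compacted means that the list of out-neighbour pairs
  has no repetition, and the passage to numbers preserves this.\<close>

lemma card_compacted_ptrs: "real (card {ptr \<in> ptr_space T. inj_on (BB T ptr) (verts T)}) = wt 1 0 T"
proof -
  define \<Psi> where "\<Psi> = (\<lambda>ptr. map (out_pair T ptr) (internals T))"
  define f where "f = map (map_prod (numbering T) (numbering T))"
  have d: "inj_on (BB T ptr) (verts T) \<longleftrightarrow> distinct (\<Psi> ptr)" if "ptr \<in> ptr_space T" for ptr
    using inj_BB_iff[OF that] by (simp add: \<Psi>_def distinct_map distinct_internals set_internals)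
  have b1: "bij_betw \<Psi> (ptr_space T) (listset (target_pairs T))" unfolding \<Psi>_def by (rule pointers_bij)
  have b2: "bij_betw f (listset (pair_choices 0 T)) (listset (target_pairs T))" unfolding f_def by (rule listset_target_pairs)
  have b3: "bij_betw \<Psi> {ptr \<in> ptr_space T. inj_on (BB T ptr) (verts T)} {ps \<in> listset (target_pairs T). distinct ps}"
    using d by (intro bij_betw_Collect[OF b1]) simp
  have b4: "bij_betw f {ps \<in> listset (pair_choices 0 T). distinct ps} {ps \<in> listset (target_pairs T). distinct ps}"
  proof -
    have "distinct (f ps) \<longleftrightarrow> distinct ps" if "ps \<in> listset (pair_choices 0 T)" for ps
      unfolding f_def by (rule listset_target_pairs(2)[OF that])
    then show ?thesis by (intro bij_betw_Collect[OF b2])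
  qed
  show ?thesis using bij_betw_same_card[OF b3] bij_betw_same_card[OF b4] card_distinct_pair_choices[of T] by simp
qed

lemma finite_ptr_space: "finite (ptr_space T)"
  unfolding ptr_space_def ptr_leaves_def
  by (intro finite_PiE) (auto simp: finite_leaf_pos finite_verts)

lemma r_num_forest_sum: "real (r_num n) = forest_sum 0 1 n"
proof -
  have "relaxed n = (SIGMA T:{T. bt_size T = n}. ptr_space T)"
    by (auto simp: relaxed_def ptr_space_def)
  then have "r_num n = (\<Sum>T | bt_size T = n. card (ptr_space T))"
    by (simp add: r_num_def card_SigmaI finite_bt_size finite_ptr_space)
  then show ?thesis by (simp add: forest_sum_1 card_ptr_space del: One_nat_def)
qed

lemma c_num_forest_sum: "real (c_num n) = forest_sum 1 1 n"
proof -
  have "compacted n = (SIGMA T:{T. bt_size T = n}. {ptr \<in> ptr_space T. inj_on (BB T ptr) (verts T)})"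
    by (auto simp: compacted_def relaxed_def ptr_space_def)
  then have "c_num n = (\<Sum>T | bt_size T = n. card {ptr \<in> ptr_space T. inj_on (BB T ptr) (verts T)})"
    by (simp add: c_num_def card_SigmaI finite_bt_size finite_ptr_space)
  then show ?thesis by (simp add: forest_sum_1 card_compacted_ptrs del: One_nat_def)
qed

theorem theorem1p1:
  shows "(\<lambda>n. real (c_num n)) \<in>
           \<Theta>(\<lambda>n. fact n * 4 ^ n * exp (3 * airy_a1 * real n powr (1/3)) * real n powr (3/4))
       \<and> (\<lambda>n. real (r_num n)) \<in>
           \<Theta>(\<lambda>n. fact n * 4 ^ n * exp (3 * airy_a1 * real n powr (1/3)) * real n)"
proof
  obtain A A' where "airy_shift airy_a1 A A'" using airy_shift_exists by blast
  then interpret airy_shift airy_a1 A A' .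
  have "(\<lambda>n. forest_sum 1 1 n) \<in> \<Theta>(\<lambda>n. fact n * 4 ^ n * exp (3 * airy_a1 * real n powr (1/3)) * real n powr (1 - 1/4))"
    by (intro signed_recurrence_asymptotics forest_sum_recurrence) auto
  then show "(\<lambda>n. real (c_num n)) \<in>
           \<Theta>(\<lambda>n. fact n * 4 ^ n * exp (3 * airy_a1 * real n powr (1/3)) * real n powr (3/4))"
    by (simp add: c_num_forest_sum)
  have "(\<lambda>n. forest_sum 0 1 n) \<in> \<Theta>(\<lambda>n. fact n * 4 ^ n * exp (3 * airy_a1 * real n powr (1/3)) * real n powr (1 - 0/4))"
    by (intro signed_recurrence_asymptotics forest_sum_recurrence) auto
  then show "(\<lambda>n. real (r_num n)) \<in>
           \<Theta>(\<lambda>n. fact n * 4 ^ n * exp (3 * airy_a1 * real n powr (1/3)) * real n)"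
    by (simp add: r_num_forest_sum)
qed

end
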